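(* Let $G$ be a finite nonabelian group, let $x,y\in G$ not commute, let $\alpha=xy$, and let $T$ be the unique component of $\hat Y(G)$ which corresponds to the triangle $[(x,1),(y,1),(\alpha,2)]$. Then $T$ is a compact, connected, oriented $2$-manifold of some genus $g$ with cell structure consisting of $2$-faces which are all $n$-gons for some fixed $n\ge 3$. The cell automorphism group always acts face and (unoriented) edge transitively on $T$. (1) If $x$ and $y$ lie in different $\alpha$-conjugacy classes ($n$ even case), then $n=2\cdot(\text{size of the }\alpha\text{-conjugacy class of }x)$ and the automorphism group acts with at most $2$ orbits of vertices, represented by $(x,1)$ and $(y,1)$ respectively. The valency of $(x,1)$ in $T$ is $\lambda_1\ge 2$, the size of the $x$-conjugacy class of $\alpha$. The valency of $(y,1)$ in $T$ is $\lambda_2\ge 2$, the size of the $y$-conjugacy class of $\alpha$. In the case $\lambda_1\ne\lambda_2$ define the average valency of the component to be $\lambda=\frac{\lambda_1V_1+\lambda_2V_2}{V_1+V_2}\ge 2$, where $V_i$ denotes the number of vertices of valency $\lambda_i$ in the component. In this case each edge in the component joins a vertex of valency $\lambda_1$ with a vertex of valency $\lambda_2$, and $E=\lambda_iV_i$ for $i=1,2$, where $E$ and $V$ are the numbers of edges and vertices of $T$. Finally, the average valency can be computed either as $\lambda=\frac{2E}{V}$ or as the harmonic average of $\lambda_1,\lambda_2$, i.e. $$\frac{2}{\lambda}=\frac1{\lambda_1}+\frac1{\lambda_2}.$$ (2) If $x$ and $y$ lie in the same $\alpha$-conjugacy class ($n$ odd case), then $n$ is the size of the $\alpha$-conjugacy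 class of $x$, and the automorphism group acts transitively on edges and also on vertices. The common valency $\lambda\ge 2$ of all vertices is the size of the $x$-conjugacy class of $\alpha$. (3) If $V,E,F$ denote the numbers of vertices, edges and $2$-faces of the cell structure of $T$, whose faces are $n$-gons and whose average vertex valency is $\lambda$, then $$nF=2E,\qquad nF=\lambda V,\qquad 2-2g=V-E+F=2\Big(\frac1\lambda+\frac1n-\frac12\Big)E.$$
   Context: For a finite nonabelian group $G$ with center $Z(G)$, $X(G)$ is the $2$-dimensional simplicial complex with vertex set $\{(x,1): x\in G-Z(G)\}\sqcup\{(x,2): x\in G-Z(G)\}$ (type 1 and type 2 vertices), whose edges are $[(x,1),(y,1)]$ and $[(x,1),(y,2)]$ for all $x,y$ with $xy\ne yx$, and whose $2$-faces are $[(x,1),(y,1),(xy,2)]$ for all ordered pairs with $xy\neq yx$, oriented by the vertex order indicated. The link of every vertex is a disjoint union of finitely many circles. The desingularization $Y(G)$ is obtained by removing all vertices of $X(G)$ and filling in distinct punctures by distinct points (one new vertex, again labelled by $v$ and of the same type, for each vertex $v$ and each circle in the link of $v$); it has the same triangles as $X(G)$ and is a finite disjoint union of compact connected oriented triangulated surfaces, its components. In $Y(G)$ the closed star of each vertex is a single triangulated disk (its sheet). $\hat Y(G)$ is the same collection of surfaces with the cell structure obtained by erasing all type 2 vertices and all edges joining type 1 to type 2 vertices: vertices are the type 1 vertices, edges are those joining two type 1 vertices, and $2$-faces are the polygons formed by the sheets about type 2 vertices. The valency of a vertex is the number of edges of this cell structure incident to it; $(x,1)$ and $(y,1)$ in $T$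 mean the vertices of the given triangle. A cell automorphism is a bijection of vertices carrying edges to edges and boundaries of $2$-faces to boundaries of $2$-faces. If all vertices of $T$ have the same valency, $\lambda$ denotes this common valency. For $\alpha\in G$, the $\alpha$-conjugacy classes are the orbits of the cyclic group $\langle\alpha\rangle$ acting on $G$ by conjugation. *)

theory Defs
  imports
    "HOL-Analysis.Analysis"
    "HOL-Library.Function_Algebras"
    "HOL-Algebra.Group_Action"
    "HOL-Algebra.Elementary_Groups"
begin

section \<open>Groups\<close>

definition group_center :: "('a, 'b) monoid_scheme \<Rightarrow> 'a set" where
  "group_center G =
     {z \<in> carrier G. \<forall>x \<in> carrier G. z \<otimes>\<^bsub>G\<^esub> x = x \<otimes>\<^bsub>G\<^esub> z}"

text \<open>The \<open>a\<close>-conjugacy class of \<open>x\<close>: its orbit under the cyclic group generated by \<open>a\<close>,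
  acting on \<open>G\<close> by conjugation.\<close>

definition cyclic_conj_class :: "('a, 'b) monoid_scheme \<Rightarrow> 'a \<Rightarrow> 'a \<Rightarrow> 'a set" where
  "cyclic_conj_class G a x =
     orbit (subgroup_generated G {a})
           (\<lambda>g. \<lambda>h \<in> carrier G. g \<otimes>\<^bsub>G\<^esub> h \<otimes>\<^bsub>G\<^esub> inv\<^bsub>G\<^esub> g) x"


section \<open>Two-dimensional simplicial complexes with ordered triangles\<close>

record 'v complex2 =
  verts :: "'v set"
  edges :: "'v set set"
  tris  :: "('v \<times> 'v \<times> 'v) set"

definition tri_set :: "'v \<times> 'v \<times> 'v \<Rightarrow> 'v set" where
  "tri_set t = (case t of (a, b, c) \<Rightarrow> {a, b, c})"

definition wf_complex2 :: "'v complex2 \<Rightarrow> bool" where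
  "wf_complex2 K \<longleftrightarrow>
     finite (verts K) \<and>
     (\<forall>e \<in> edges K. e \<subseteq> verts K \<and> card e = 2) \<and>
     (\<forall>t \<in> tris K. tri_set t \<subseteq> verts K \<and> card (tri_set t) = 3 \<and>
        (\<forall>e. e \<subseteq> tri_set t \<and> card e = 2 \<longrightarrow> e \<in> edges K))"

definition conn_class :: "'v complex2 \<Rightarrow> 'v \<Rightarrow> 'v set" where
  "conn_class K u = {w \<in> verts K. (u, w) \<in> {(a, b). {a, b} \<in> edges K}\<^sup>*}"

definition full_subcomplex :: "'v complex2 \<Rightarrow> 'v set \<Rightarrow> 'v complex2" where
  "full_subcomplex K C =
     \<lparr>verts = verts K \<inter> C, edges = {e \<in> edges K. e \<subseteq> C}, tris = {t \<in> tris K. tri_set t \<subseteq> C}\<rparr>"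

definition components2 :: "'v complex2 \<Rightarrow> 'v complex2 set" where
  "components2 K = {full_subcomplex K (conn_class K u) | u. u \<in> verts K}"

definition link :: "'v complex2 \<Rightarrow> 'v \<Rightarrow> 'v complex2" where
  "link K v =
     \<lparr>verts = {u. u \<noteq> v \<and> {v, u} \<in> edges K},
      edges = {tri_set t - {v} | t. t \<in> tris K \<and> v \<in> tri_set t},
      tris = {}\<rparr>"


subsection \<open>Desingularization\<close>

text \<open>A vertex of the desingularization is a pair \<open>(v, C)\<close> of a vertex \<open>v\<close> of \<open>K\<close> and (the vertex
  set of) a connected component \<open>C\<close> of the link of \<open>v\<close>.  \<open>sheet_vertex K v u\<close> is the new vertex
  over \<open>v\<close> that lies on the edge from \<open>v\<close> to \<open>u\<close>.\<close>

definition sheet_vertex :: "'v complex2 \<Rightarrow> 'v \<Rightarrow> 'v \<Rightarrow> 'v \<times> 'v set" where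
  "sheet_vertex K v u = (v, conn_class (link K v) u)"

text \<open>If \<open>(a, b, c)\<close> is a triangle of \<open>K\<close>, then \<open>b\<close> and \<open>c\<close> are adjacent in the link of \<open>a\<close>, so
  either of them may be used to select the vertex over \<open>a\<close>.\<close>

definition lift_tri ::
  "'v complex2 \<Rightarrow> 'v \<times> 'v \<times> 'v \<Rightarrow> ('v \<times> 'v set) \<times> ('v \<times> 'v set) \<times> ('v \<times> 'v set)" where
  "lift_tri K t =
     (case t of (a, b, c) \<Rightarrow> (sheet_vertex K a b, sheet_vertex K b c, sheet_vertex K c a))"

definition desingularize :: "'v complex2 \<Rightarrow> ('v \<times> 'v set) complex2" where
  "desingularize K =
     \<lparr>verts = {sheet_vertex K v u | v u. v \<in> verts K \<and> u \<in> verts (link K v)},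
      edges = {{sheet_vertex K a b, sheet_vertex K b a} | a b. {a, b} \<in> edges K},
      tris = lift_tri K ` tris K\<rparr>"


subsection \<open>Underlying space, orientation, genus\<close>

definition simplices2 :: "'v complex2 \<Rightarrow> 'v set set" where
  "simplices2 K = (\<lambda>v. {v}) ` verts K \<union> edges K \<union> tri_set ` tris K"

text \<open>Barycentric coordinates, with the product topology on the function space.  For a finite
  complex this is the usual topology of the geometric realization.\<close>

definition geom_realization :: "'v complex2 \<Rightarrow> ('v \<Rightarrow> real) topology" where
  "geom_realization K =
     top_of_set {t. (\<forall>v. t v \<ge> 0) \<and> {v. t v \<noteq> 0} \<in> simplices2 K \<and> (\<Sum>v \<in> verts K. t v) = 1}"

definition two_manifold :: "'p topology \<Rightarrow> bool" where
  "two_manifold X \<longleftrightarrow>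
     Hausdorff_space X \<and> second_countable X \<and>
     (\<forall>p \<in> topspace X. \<exists>U (W :: (real ^ 2) set).
        openin X U \<and> p \<in> U \<and> open W \<and> subtopology X U homeomorphic_space top_of_set W)"

definition boundary_arcs :: "'v \<times> 'v \<times> 'v \<Rightarrow> ('v \<times> 'v) set" where
  "boundary_arcs t = (case t of (a, b, c) \<Rightarrow> {(a, b), (b, c), (c, a)})"

text \<open>The vertex orders of the triangles form an orientation of a closed triangulated surface:
  every triangle carries one order, and every edge lies in exactly two triangles, which induce
  opposite directions on it.  (The condition is applied to both \<open>(a, b)\<close> and \<open>(b, a)\<close>.)\<close>

definition coherently_oriented :: "'v complex2 \<Rightarrow> bool" where
  "coherently_oriented K \<longleftrightarrow>
     inj_on tri_set (tris K) \<and>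
     (\<forall>a b. {a, b} \<in> edges K \<longrightarrow> (\<exists>!t. t \<in> tris K \<and> (a, b) \<in> boundary_arcs t))"

definition compact_connected_oriented_surface :: "'v complex2 \<Rightarrow> bool" where
  "compact_connected_oriented_surface K \<longleftrightarrow>
     wf_complex2 K \<and> coherently_oriented K \<and>
     compact_space (geom_realization K) \<and>
     connected_space (geom_realization K) \<and>
     two_manifold (geom_realization K)"

text \<open>Simplicial chains with real coefficients are alternating functions on ordered simplices:
  the oriented simplex \<open>[a, b, d]\<close> is the function that is \<open>1\<close> on the even and \<open>-1\<close> on the odd
  rearrangements of \<open>(a, b, d)\<close> and \<open>0\<close> elsewhere.  In this form the boundary operator sums over
  the first argument, so that \<open>[a, b]\<close> has boundary \<open>[b] - [a]\<close> and \<open>[a, b, d]\<close> has boundary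
  \<open>[b, d] + [d, a] + [a, b]\<close>.\<close>

definition chains1 :: "'v complex2 \<Rightarrow> ('v \<Rightarrow> 'v \<Rightarrow> real) set" where
  "chains1 K =
     {c. (\<forall>a b. c b a = - c a b) \<and> (\<forall>a b. {a, b} \<notin> edges K \<longrightarrow> c a b = 0)}"

definition chains2 :: "'v complex2 \<Rightarrow> ('v \<Rightarrow> 'v \<Rightarrow> 'v \<Rightarrow> real) set" where
  "chains2 K =
     {c. (\<forall>a b d. c b a d = - c a b d \<and> c a d b = - c a b d) \<and>
         (\<forall>a b d. {a, b, d} \<notin> tri_set ` tris K \<longrightarrow> c a b d = 0)}"

definition boundary1 :: "'v complex2 \<Rightarrow> ('v \<Rightarrow> 'v \<Rightarrow> real) \<Rightarrow> 'v \<Rightarrow> real" where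
  "boundary1 K c = (\<lambda>b. \<Sum>a \<in> verts K. c a b)"

definition boundary2 :: "'v complex2 \<Rightarrow> ('v \<Rightarrow> 'v \<Rightarrow> 'v \<Rightarrow> real) \<Rightarrow> 'v \<Rightarrow> 'v \<Rightarrow> real" where
  "boundary2 K c = (\<lambda>b d. \<Sum>a \<in> verts K. c a b d)"

definition chain_scale :: "real \<Rightarrow> ('v \<Rightarrow> 'v \<Rightarrow> real) \<Rightarrow> 'v \<Rightarrow> 'v \<Rightarrow> real" where
  "chain_scale r c = (\<lambda>a b. r * c a b)"

lemma vector_space_chain_scale: "vector_space chain_scale"
  by standard (simp_all add: chain_scale_def fun_eq_iff algebra_simps)

definition betti1 :: "'v complex2 \<Rightarrow> int" where
  "betti1 K =
     int (vector_space.dim chain_scale {c \<in> chains1 K. boundary1 K c = (\<lambda>_. 0)})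
     - int (vector_space.dim chain_scale (boundary2 K ` chains2 K))"

text \<open>The genus of a compact connected oriented surface is half its first Betti number.\<close>

definition has_genus :: "'v complex2 \<Rightarrow> nat \<Rightarrow> bool" where
  "has_genus K g \<longleftrightarrow> betti1 K = 2 * int g"


section \<open>The complexes of a finite nonabelian group\<close>

text \<open>The vertices \<open>(x, 1)\<close> and \<open>(x, 2)\<close> are those of type 1 and type 2.\<close>

definition X_complex :: "('a, 'b) monoid_scheme \<Rightarrow> ('a \<times> nat) complex2" where
  "X_complex G =
     (let N = {(x, y). x \<in> carrier G \<and> y \<in> carrier G \<and> x \<otimes>\<^bsub>G\<^esub> y \<noteq> y \<otimes>\<^bsub>G\<^esub> x} in
      \<lparr>verts = (carrier G - group_center G) \<times> {1, 2},
       edges = {{(x, 1), (y, 1)} | x y. (x, y) \<in> N} \<union> {{(x, 1), (y, 2)} | x y. (x, y) \<in> N},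
       tris = {((x, 1), (y, 1), (x \<otimes>\<^bsub>G\<^esub> y, 2)) | x y. (x, y) \<in> N}\<rparr>)"

type_synonym 'a yvertex = "('a \<times> nat) \<times> ('a \<times> nat) set"

definition Y_complex :: "('a, 'b) monoid_scheme \<Rightarrow> 'a yvertex complex2" where
  "Y_complex G = desingularize (X_complex G)"

definition vtype :: "'a yvertex \<Rightarrow> nat" where
  "vtype v = snd (fst v)"


subsection \<open>The cell structure obtained by erasing the type 2 vertices\<close>

text \<open>In the following, \<open>T\<close> is a component of the triangulated surface \<open>Y_complex G\<close>.  The cell
  structure with the type 2 vertices erased lives on the same surface, and \<open>cell_verts T\<close>,
  \<open>cell_edges T\<close> and \<open>cell_faces T\<close> are its cells.  A 2-face is represented by the set of
  triangles in the sheet about a type 2 vertex, not by its boundary, because two different faces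
  can have the same boundary.\<close>

definition cell_verts :: "'a yvertex complex2 \<Rightarrow> 'a yvertex set" where
  "cell_verts T = {v \<in> verts T. vtype v = 1}"

definition cell_edges :: "'a yvertex complex2 \<Rightarrow> 'a yvertex set set" where
  "cell_edges T = {e \<in> edges T. e \<subseteq> cell_verts T}"

definition sheet ::
  "'a yvertex complex2 \<Rightarrow> 'a yvertex \<Rightarrow> ('a yvertex \<times> 'a yvertex \<times> 'a yvertex) set" where
  "sheet T w = {t \<in> tris T. w \<in> tri_set t}"

definition cell_faces ::
  "'a yvertex complex2 \<Rightarrow> ('a yvertex \<times> 'a yvertex \<times> 'a yvertex) set set" where
  "cell_faces T = sheet T ` {w \<in> verts T. vtype w = 2}"

definition face_boundary ::
  "'a yvertex complex2 \<Rightarrow> ('a yvertex \<times> 'a yvertex \<times> 'a yvertex) set \<Rightarrow> 'a yvertex set set" where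
  "face_boundary T P = {e \<in> cell_edges T. \<exists>t \<in> P. e \<subseteq> tri_set t}"

definition ngon_boundary :: "nat \<Rightarrow> 'v set set \<Rightarrow> bool" where
  "ngon_boundary n B \<longleftrightarrow>
     (\<exists>p. inj_on p {..<n} \<and> B = {{p i, p (Suc i mod n)} | i. i < n})"

definition valency :: "'a yvertex complex2 \<Rightarrow> 'a yvertex \<Rightarrow> nat" where
  "valency T v = card {e \<in> cell_edges T. v \<in> e}"

definition average_valency :: "'a yvertex complex2 \<Rightarrow> real" where
  "average_valency T = (\<Sum>v \<in> cell_verts T. real (valency T v)) / real (card (cell_verts T))"


subsection \<open>Cell automorphisms\<close>

definition cell_aut_group ::
  "'a yvertex complex2 \<Rightarrow> ('a yvertex \<Rightarrow> 'a yvertex) monoid" where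
  "cell_aut_group T =
     BijGroup (cell_verts T)
       \<lparr>carrier := {f \<in> Bij (cell_verts T).
          (image f) ` cell_edges T = cell_edges T \<and>
          (image (image f)) ` (face_boundary T ` cell_faces T) = face_boundary T ` cell_faces T}\<rparr>"

definition vertex_orbit :: "'a yvertex complex2 \<Rightarrow> 'a yvertex \<Rightarrow> 'a yvertex set" where
  "vertex_orbit T = orbit (cell_aut_group T) (\<lambda>f. f)"

definition vertex_transitive :: "'a yvertex complex2 \<Rightarrow> bool" where
  "vertex_transitive T \<longleftrightarrow> (\<forall>v \<in> cell_verts T. vertex_orbit T v = cell_verts T)"

definition edge_transitive :: "'a yvertex complex2 \<Rightarrow> bool" where
  "edge_transitive T \<longleftrightarrow>
     (\<forall>e \<in> cell_edges T. orbit (cell_aut_group T) image e = cell_edges T)"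

text \<open>Cell automorphisms are bijections of the vertices, so one carries a face \<open>P\<close> to a face \<open>Q\<close>
  if it carries the boundary of \<open>P\<close> to the boundary of \<open>Q\<close>.\<close>

definition face_transitive :: "'a yvertex complex2 \<Rightarrow> bool" where
  "face_transitive T \<longleftrightarrow>
     (\<forall>P \<in> cell_faces T. \<forall>Q \<in> cell_faces T. \<exists>f \<in> carrier (cell_aut_group T).
        (image f) ` face_boundary T P = face_boundary T Q)"

end

theory Submission
  imports Defs "HOL-Combinatorics.Cycles" "HOL-Algebra.Multiplicative_Group"
begin

text \<open>
  If every directed edge of a complex lies in exactly one ordered triangle, then turning about a
  vertex permutes its neighbours, and the components of the link are the cycles of this
  permutation.  Hence the desingularization is a closed oriented surface: the open star of a
  vertex is a disc, glued from sectors by piecewise linear functions of the angle.  On a connected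
  such surface a 2-cycle is determined by one coefficient, and the boundaries of 1-chains are the
  0-chains with sum zero, so the first Betti number is \<open>2 - (V - E + F)\<close>.  It is even because
  the rotation about the vertices is the edge reversal composed with a square, so that these two
  permutations of the directed edges have the same sign.

  Every triangle adjacent to that of \<open>(u, v)\<close> is the triangle of a conjugate of \<open>(v, u)\<close>.
  So all triangles of the component \<open>T\<close> come from conjugates of \<open>(x, y)\<close> and \<open>(y, x)\<close>, and
  the conjugating elements preserve \<open>T\<close>; this gives the transitivity statements.  The sheet about
  \<open>(\<alpha>, 2)\<close> is the orbit of \<open>x\<close> under \<open>u \<mapsto> u\<inverse>\<alpha>\<close>, whose square is conjugation by
  \<open>\<alpha>\<inverse>\<close>; thus \<open>n\<close> is odd exactly when \<open>y = x\<inverse>\<alpha>\<close> is in the \<open>\<alpha>\<close>-class of \<open>x\<close>.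
\<close>

text \<open>The vertices of the desingularization are built from sets of neighbours, which are
  awkward to compare. Hence each is named by a directed edge, as \<open>sheet_vertex K a b\<close>,
  and two names over the same vertex agree exactly when a power of \<open>nxt\<close> relates the
  chosen neighbours; identifying vertices becomes a computation with \<open>nxt\<close>. The group
  enters this first half only through the fact that two entries of \<open>u \<otimes> v = w\<close>
  determine the third, which puts each directed edge of \<open>X\<close> into exactly one triangle.
  Conjugation acts on all of \<open>Y\<close>, but an element may carry \<open>T\<close> to another
  component. It lies in the stabilizer \<open>H\<close> as soon as one vertex of \<open>T\<close> is
  sent into \<open>T\<close>, so each transitivity statement needs only one computed image.
  Triangles occur as translates of that of \<open>(x, y)\<close> and of that of
  \<open>(y, x)\<close>. For faces the distinction disappears, because \<open>x\<close> carries one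
  of the two faces at the edge of the pair to the other; for vertices it remains, and
  \<open>P x y\<close> and \<open>P y x\<close> may lie in different orbits unless a power of
  \<open>x \<otimes> y\<close> conjugates \<open>x\<close> to \<open>y\<close>.\<close>

lemma funpow_in:
  assumes "f ` S \<subseteq> S" "x \<in> S"
  shows "(f ^^ i) x \<in> S"
  by (induction i) (use assms in auto)

text \<open>Injectivity makes the first repetition in the orbit a return to \<open>x\<close> itself,
  since equal iterates can be cancelled down to index 0. The least positive return time is the
  length \<open>m\<close> of the cycle.\<close>

lemma funpow_cycle:
  assumes fin: "finite S" and sub: "f ` S \<subseteq> S" and inj: "inj_on f S" and x: "x \<in> S"
  obtains m where "m > 0" "(f ^^ m) x = x" "inj_on (\<lambda>i. (f ^^ i) x) {..<m}"
    "range (\<lambda>i. (f ^^ i) x) = (\<lambda>i. (f ^^ i) x) ` {..<m}"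
proof -
  have cancel: "(f ^^ d) x = x" if "(f ^^ i) x = (f ^^ (i + d)) x" for i d
    using that
  proof (induction i)
    case (Suc i)
    then have "f ((f ^^ i) x) = f ((f ^^ (i + d)) x)" by simp
    then have "(f ^^ i) x = (f ^^ (i + d)) x"
      using inj funpow_in[OF sub x] by (meson inj_onD)
    then show ?case by (rule Suc.IH)
  qed simp
  have "\<not> inj (\<lambda>i. (f ^^ i) x)"
  proof
    assume "inj (\<lambda>i. (f ^^ i) x)"
    moreover have "finite (range (\<lambda>i. (f ^^ i) x))"
      using funpow_in[OF sub x] by (intro finite_subset[OF _ fin]) auto
    ultimately show False using finite_imageD infinite_UNIV_nat by blast
  qed
  then obtain a b where ab: "a \<noteq> b" "(f ^^ a) x = (f ^^ b) x" unfolding inj_def by blast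
  then have "(f ^^ min a b) x = (f ^^ max a b) x" "min a b < max a b" by (auto simp: min_def max_def)
  then obtain i j where ij: "i < j" "(f ^^ i) x = (f ^^ j) x" by blast
  have e: "i + (j - i) = j" using ij(1) by linarith
  have "(f ^^ (j - i)) x = x" by (rule cancel[of i "j - i", unfolded e, OF ij(2)])
  moreover have "j - i > 0" using ij(1) by linarith
  ultimately have ex: "\<exists>m. m > 0 \<and> (f ^^ m) x = x" by blast
  define m where "m = (LEAST m. m > 0 \<and> (f ^^ m) x = x)"
  have "m > 0 \<and> (f ^^ m) x = x" unfolding m_def by (rule LeastI_ex[OF ex])
  then have m: "m > 0" "(f ^^ m) x = x" by blast+
  have least: "k = 0" if "k < m" "(f ^^ k) x = x" for k
    using that not_less_Least[of k "\<lambda>m. m > 0 \<and> (f ^^ m) x = x"] unfolding m_def by auto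
  have "inj_on (\<lambda>i. (f ^^ i) x) {..<m}"
  proof (rule linorder_inj_onI)
    fix i j assume ij: "i < j" "i \<in> {..<m}" "j \<in> {..<m}"
    show "(f ^^ i) x \<noteq> (f ^^ j) x"
    proof
      assume eq: "(f ^^ i) x = (f ^^ j) x"
      have e: "i + (j - i) = j" using ij(1) by linarith
      have "(f ^^ (j - i)) x = x" by (rule cancel[of i "j - i", unfolded e, OF eq])
      moreover have "j - i < m" using ij by auto
      ultimately show False using least[of "j - i"] ij(1) by linarith
    qed
  qed auto
  moreover have "range (\<lambda>i. (f ^^ i) x) = (\<lambda>i. (f ^^ i) x) ` {..<m}"
  proof -
    have "(f ^^ i) x \<in> (\<lambda>i. (f ^^ i) x) ` {..<m}" for i
      using m funpow_mod_eq[OF m(2), of i] by (intro image_eqI[of _ _ "i mod m"]) auto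
    then show ?thesis by blast
  qed
  ultimately show ?thesis using that m by blast
qed

lemma card2_subset3:
  assumes "e \<subseteq> {a, b, c}" "card e = 2"
  shows "e = {a, b} \<or> e = {b, c} \<or> e = {a, c}"
proof -
  obtain p q where "e = {p, q}" "p \<noteq> q" using assms(2) by (auto simp: card_2_iff)
  then show ?thesis using assms(1) by auto
qed

lemma card3_iff: "card {a, b, c} = 3 \<longleftrightarrow> a \<noteq> b \<and> b \<noteq> c \<and> a \<noteq> c"
  by (auto simp: card_insert_if)


section \<open>Oriented complexes\<close>

text \<open>Listing all three rotations of each triangle lets any of its directed boundary edges
  stand in front, so arguments about an edge need no case distinction on its position.\<close>

definition rot :: "'v complex2 \<Rightarrow> ('v \<times> 'v \<times> 'v) set" where
  "rot K = {(a, b, c). (a, b, c) \<in> tris K \<or> (b, c, a) \<in> tris K \<or> (c, a, b) \<in> tris K}"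

definition nbrs :: "'v complex2 \<Rightarrow> 'v \<Rightarrow> 'v set" where
  "nbrs K v = {u. {v, u} \<in> edges K}"

text \<open>In an oriented complex this is the third vertex of the only triangle that traverses the
  edge from \<open>v\<close> to \<open>u\<close>; as a map in \<open>u\<close> it turns about
  \<open>v\<close>.\<close>

definition nxt :: "'v complex2 \<Rightarrow> 'v \<Rightarrow> 'v \<Rightarrow> 'v" where
  "nxt K v u = (THE w. (v, u, w) \<in> rot K)"

lemma rot_cyc: "(a, b, c) \<in> rot K \<Longrightarrow> (b, c, a) \<in> rot K"
  by (auto simp: rot_def)

lemma rot_tri:
  assumes "(a, b, c) \<in> rot K"
  obtains t where "t \<in> tris K" "tri_set t = {a, b, c}"
    "boundary_arcs t = {(a, b), (b, c), (c, a)}"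
    "t \<in> {(a, b, c), (b, c, a), (c, a, b)}"
  using assms unfolding rot_def
  by (auto simp: tri_set_def boundary_arcs_def insert_commute)

lemma arc_rot:
  assumes "t \<in> tris K" "(a, b) \<in> boundary_arcs t"
  obtains c where "(a, b, c) \<in> rot K" "t \<in> {(a, b, c), (b, c, a), (c, a, b)}"
  using assms by (cases t) (auto simp: rot_def boundary_arcs_def)

lemma tris_rot: "(a, b, c) \<in> tris K \<Longrightarrow> (a, b, c) \<in> rot K"
  by (simp add: rot_def)

locale oriented_complex =
  fixes K :: "'v complex2"
  assumes wf: "wf_complex2 K" and coh: "coherently_oriented K"
begin

lemma finite_verts: "finite (verts K)"
  using wf by (simp add: wf_complex2_def)

lemma edge_verts: "{a, b} \<in> edges K \<Longrightarrow> a \<in> verts K \<and> b \<in> verts K \<and> a \<noteq> b"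
  using wf unfolding wf_complex2_def by (force simp: card_insert_if)

lemma edge_cases:
  assumes "e \<in> edges K"
  obtains a b where "e = {a, b}" "a \<noteq> b" "a \<in> verts K" "b \<in> verts K"
proof -
  have "card e = 2" "e \<subseteq> verts K" using wf assms by (auto simp: wf_complex2_def)
  then show ?thesis using that by (auto simp: card_2_iff)
qed

lemma finite_edges: "finite (edges K)"
  by (rule finite_subset[of _ "Pow (verts K)"])
    (use wf finite_verts in \<open>auto simp: wf_complex2_def\<close>)

lemma finite_tris: "finite (tris K)"
proof -
  have "tris K \<subseteq> verts K \<times> verts K \<times> verts K"
    using wf unfolding wf_complex2_def by (auto simp: tri_set_def)
  then show ?thesis using finite_verts by (meson finite_SigmaI finite_subset)
qed

lemma rot_edges:
  assumes "(a, b, c) \<in> rot K"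
  shows "a \<noteq> b" "b \<noteq> c" "a \<noteq> c" "{a, b} \<in> edges K" "{b, c} \<in> edges K" "{a, c} \<in> edges K"
    "a \<in> verts K" "b \<in> verts K" "c \<in> verts K"
proof -
  obtain t where t: "t \<in> tris K" "tri_set t = {a, b, c}" using assms by (rule rot_tri)
  then have *: "{a, b, c} \<subseteq> verts K" "card {a, b, c} = 3"
    "\<And>e. e \<subseteq> {a, b, c} \<Longrightarrow> card e = 2 \<Longrightarrow> e \<in> edges K"
    using wf unfolding wf_complex2_def by metis+
  then show d: "a \<noteq> b" "b \<noteq> c" "a \<noteq> c" by (auto simp: card3_iff)
  show "{a, b} \<in> edges K" "{b, c} \<in> edges K" "{a, c} \<in> edges K"
    using d by (auto intro!: *(3))
  show "a \<in> verts K" "b \<in> verts K" "c \<in> verts K" using * by auto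
qed

lemma rot_ex:
  assumes "{a, b} \<in> edges K"
  obtains c where "(a, b, c) \<in> rot K"
  using coh assms arc_rot unfolding coherently_oriented_def by metis

lemma rot_unique:
  assumes "(a, b, c) \<in> rot K" "(a, b, c') \<in> rot K"
  shows "c = c'"
proof -
  obtain t where t: "t \<in> tris K" "boundary_arcs t = {(a, b), (b, c), (c, a)}" "tri_set t = {a, b, c}"
    using assms(1) by (rule rot_tri)
  obtain t' where t': "t' \<in> tris K" "boundary_arcs t' = {(a, b), (b, c'), (c', a)}" "tri_set t' = {a, b, c'}"
    using assms(2) by (rule rot_tri)
  have "t = t'" using coh rot_edges(4)[OF assms(1)] t t' unfolding coherently_oriented_def by blast
  then show ?thesis using t t' rot_edges[OF assms(1)] rot_edges[OF assms(2)] by auto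
qed

text \<open>A common third vertex would give both triangles the same vertex set, hence make them
  equal by injectivity of \<open>tri_set\<close>, although one ordered triangle traverses an edge in
  one direction only.\<close>

lemma rot_swap:
  assumes "(a, b, c) \<in> rot K" "(b, a, c') \<in> rot K"
  shows "c \<noteq> c'"
proof
  assume "c = c'"
  obtain t where t: "t \<in> tris K" "boundary_arcs t = {(a, b), (b, c), (c, a)}" "tri_set t = {a, b, c}"
    using assms(1) by (rule rot_tri)
  obtain t' where t': "t' \<in> tris K" "boundary_arcs t' = {(b, a), (a, c'), (c', b)}" "tri_set t' = {b, a, c'}"
    using assms(2) by (rule rot_tri)
  have "tri_set t = tri_set t'" unfolding t(3) t'(3) \<open>c = c'\<close> by (rule insert_commute)
  moreover have "inj_on tri_set (tris K)" using coh by (simp add: coherently_oriented_def)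
  ultimately have "t = t'" using t(1) t'(1) by (meson inj_onD)
  then show False using t t' rot_edges[OF assms(1)] by auto
qed

lemma nxt_eq: "(v, u, w) \<in> rot K \<Longrightarrow> nxt K v u = w"
  unfolding nxt_def using rot_unique by blast

lemma nxt_rot: "u \<in> nbrs K v \<Longrightarrow> (v, u, nxt K v u) \<in> rot K"
  unfolding nbrs_def using nxt_eq rot_ex by (metis mem_Collect_eq)

lemma nbrs_sym: "u \<in> nbrs K v \<longleftrightarrow> v \<in> nbrs K u"
  by (simp add: nbrs_def insert_commute)

lemma nxt_nbrs: "nxt K v ` nbrs K v \<subseteq> nbrs K v"
  using nxt_rot rot_edges(6) by (force simp: nbrs_def)

lemma finite_nbrs: "finite (nbrs K v)"
  by (rule finite_subset[OF _ finite_verts]) (auto simp: nbrs_def dest: edge_verts)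

lemma nxt_inj: "inj_on (nxt K v) (nbrs K v)"
proof (rule inj_onI)
  fix u u' assume "u \<in> nbrs K v" "u' \<in> nbrs K v" "nxt K v u = nxt K v u'"
  then have "(v, u, nxt K v u) \<in> rot K" "(v, u', nxt K v u) \<in> rot K" using nxt_rot by metis+
  then show "u = u'" using rot_unique rot_cyc by metis
qed

lemma nxt_funpow_nbrs: "u \<in> nbrs K v \<Longrightarrow> (nxt K v ^^ i) u \<in> nbrs K v"
  using funpow_in nxt_nbrs by metis

text \<open>A turn back is a long turn forward: on a cycle of length \<open>m\<close>, another
  \<open>m * i - i\<close> steps complete \<open>i\<close> full rounds.\<close>

lemma nxt_funpow_sym:
  assumes "u \<in> nbrs K v"
  obtains j where "(nxt K v ^^ j) ((nxt K v ^^ i) u) = u"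
proof -
  obtain m where m: "m > 0" "(nxt K v ^^ m) u = u"
    by (rule funpow_cycle[OF finite_nbrs nxt_nbrs nxt_inj assms])
  have "(nxt K v ^^ (m * i)) u = u"
    using m(2) funpow_mod_eq[OF m(2), of "m * i"] by simp
  moreover have "m * i = (m * i - i) + i" using m(1) by simp
  ultimately have "(nxt K v ^^ (m * i - i)) ((nxt K v ^^ i) u) = u"
    by (metis funpow_add comp_apply)
  then show ?thesis using that by blast
qed

text \<open>Two neighbours are adjacent in the link exactly when \<open>nxt\<close> carries one to
  the other. A path in the link may go in both directions, but a step back is itself a power of
  \<open>nxt\<close>, so forward iteration reaches the whole component.\<close>

lemma conn_class_link:
  assumes u: "u \<in> nbrs K v"
  shows "conn_class (link K v) u = range (\<lambda>i. (nxt K v ^^ i) u)"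
proof (intro equalityI subsetI)
  let ?R = "{(a, b). {a, b} \<in> edges (link K v)}"
  have le: "{a, b} \<in> edges (link K v) \<longleftrightarrow> (v, a, b) \<in> rot K \<or> (v, b, a) \<in> rot K" for a b
  proof
    assume "{a, b} \<in> edges (link K v)"
    then obtain t where t: "t \<in> tris K" "v \<in> tri_set t" "{a, b} = tri_set t - {v}"
      by (auto simp: link_def)
    obtain p q r where pqr: "t = (p, q, r)" by (cases t)
    have rot: "(p, q, r) \<in> rot K" using t(1) unfolding pqr by (rule tris_rot)
    have ts: "tri_set t = {p, q, r}" by (simp add: pqr tri_set_def)
    consider "v = p" | "v = q" | "v = r" using t(2) ts by blast
    then obtain q' r' where qr: "(v, q', r') \<in> rot K" "tri_set t = {v, q', r'}"
    proof cases
      case 1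
      then show ?thesis using that rot ts by blast
    next
      case 2
      moreover have "tri_set t = {q, r, p}" using ts by blast
      ultimately show ?thesis using that rot_cyc[OF rot] by blast
    next
      case 3
      moreover have "tri_set t = {r, p, q}" using ts by blast
      ultimately show ?thesis using that rot_cyc[OF rot_cyc[OF rot]] by blast
    qed
    then have "{a, b} = {q', r'}" using t rot_edges(1-3)[OF qr(1)] by auto
    then show "(v, a, b) \<in> rot K \<or> (v, b, a) \<in> rot K" using qr by (auto simp: doubleton_eq_iff)
  next
    assume "(v, a, b) \<in> rot K \<or> (v, b, a) \<in> rot K"
    then obtain p q where pq: "(v, p, q) \<in> rot K" "{a, b} = {p, q}" by blast
    obtain t where "t \<in> tris K" "tri_set t = {v, p, q}" using pq(1) by (rule rot_tri)
    moreover have "{v, p, q} - {v} = {a, b}" using pq rot_edges(1-3)[OF pq(1)] by auto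
    ultimately have "t \<in> tris K \<and> v \<in> tri_set t \<and> {a, b} = tri_set t - {v}" by simp
    then have "{a, b} \<in> {tri_set t - {v} | t. t \<in> tris K \<and> v \<in> tri_set t}" by blast
    then show "{a, b} \<in> edges (link K v)" by (simp add: link_def)
  qed
  {
    fix w assume "w \<in> conn_class (link K v) u"
    then have "(u, w) \<in> ?R\<^sup>*" by (simp add: conn_class_def)
    then show "w \<in> range (\<lambda>i. (nxt K v ^^ i) u)"
    proof (induction rule: rtrancl_induct)
      case base
      show ?case by (rule range_eqI[of _ _ 0]) simp
    next
      case (step y z)
      then obtain i where i: "y = (nxt K v ^^ i) u" by (auto simp: image_iff)
      from step(2) consider "(v, y, z) \<in> rot K" | "(v, z, y) \<in> rot K" using le by auto
      then show ?case
      proof cases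
        case 1
        then have "z = (nxt K v ^^ Suc i) u" using nxt_eq[OF 1] i by simp
        then show ?thesis by (rule range_eqI)
      next
        case 2
        then have z: "z \<in> nbrs K v" "nxt K v z = y" using nxt_eq[OF 2] rot_edges(4)[OF 2] by (simp_all add: nbrs_def)
        obtain j where "(nxt K v ^^ j) ((nxt K v ^^ 1) z) = z" using nxt_funpow_sym[OF z(1)] .
        then have "z = (nxt K v ^^ (j + i)) u" using z i by (simp add: funpow_add)
        then show ?thesis by (rule range_eqI)
      qed
    qed
  }
  fix w assume "w \<in> range (\<lambda>i. (nxt K v ^^ i) u)"
  then obtain i where w: "w = (nxt K v ^^ i) u" by (auto simp: image_iff)
  have "(u, (nxt K v ^^ i) u) \<in> ?R\<^sup>*"
  proof (induction i)
    case (Suc i)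
    have "(v, (nxt K v ^^ i) u, (nxt K v ^^ Suc i) u) \<in> rot K"
      using nxt_rot[OF nxt_funpow_nbrs[OF u]] by simp
    then have "((nxt K v ^^ i) u, (nxt K v ^^ Suc i) u) \<in> ?R" using le by auto
    then show ?case using Suc by (meson rtrancl.rtrancl_into_rtrancl)
  qed simp
  moreover have "w \<in> verts (link K v)"
  proof -
    have e: "{v, w} \<in> edges K" using nxt_funpow_nbrs[OF u, of i] w by (simp add: nbrs_def)
    then show ?thesis using edge_verts[OF e] by (auto simp: link_def)
  qed
  ultimately show "w \<in> conn_class (link K v) u" using w by (simp add: conn_class_def)
qed

text \<open>Link components are cycles of \<open>nxt\<close>, and two of them coincide once they
  meet.\<close>

lemma sv_eq_iff:
  assumes "u \<in> nbrs K v" "u' \<in> nbrs K v'"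
  shows "sheet_vertex K v u = sheet_vertex K v' u' \<longleftrightarrow> v = v' \<and> (\<exists>i. u' = (nxt K v ^^ i) u)"
proof (intro iffI conjI; (elim conjE exE)?)
  assume *: "sheet_vertex K v u = sheet_vertex K v' u'"
  show v: "v = v'" using * by (simp add: sheet_vertex_def)
  have "u' \<in> range (\<lambda>i. (nxt K v ^^ i) u)"
    using * conn_class_link[OF assms(1)] conn_class_link[OF assms(2)] v
    unfolding sheet_vertex_def by (metis funpow_0 prod.inject rangeI)
  then show "\<exists>i. u' = (nxt K v ^^ i) u" by (simp add: image_iff)
next
  fix i assume v: "v = v'" and u': "u' = (nxt K v ^^ i) u"
  obtain j where j: "(nxt K v ^^ j) u' = u" using nxt_funpow_sym[OF assms(1)] u' by metis
  have "range (\<lambda>i. (nxt K v ^^ i) u) = range (\<lambda>i. (nxt K v ^^ i) u')"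
  proof (intro equalityI subsetI; elim rangeE)
    fix w k assume "w = (nxt K v ^^ k) u"
    then have "w = (nxt K v ^^ (k + j)) u'" using j by (simp add: funpow_add)
    then show "w \<in> range (\<lambda>i. (nxt K v ^^ i) u')" by (rule range_eqI)
  next
    fix w k assume "w = (nxt K v ^^ k) u'"
    then have "w = (nxt K v ^^ (k + i)) u" using u' by (simp add: funpow_add)
    then show "w \<in> range (\<lambda>i. (nxt K v ^^ i) u)" by (rule range_eqI)
  qed
  then show "sheet_vertex K v u = sheet_vertex K v' u'"
    using conn_class_link[OF assms(1)] conn_class_link[OF assms(2)] v by (simp add: sheet_vertex_def)
qed

text \<open>Since \<open>c\<close> follows \<open>b\<close> in the link of \<open>a\<close>, both
  edges select the same sheet; the choice of edges made in \<open>lift_tri\<close> is therefore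
  immaterial.\<close>

lemma sv_rot:
  assumes "(a, b, c) \<in> rot K"
  shows "sheet_vertex K a b = sheet_vertex K a c"
proof -
  have "b \<in> nbrs K a" "c \<in> nbrs K a" "c = (nxt K a ^^ 1) b"
    using rot_edges(4,6)[OF assms] nxt_eq[OF assms] by (auto simp: nbrs_def)
  then show ?thesis using sv_eq_iff by blast
qed

lemma sv_rot2: "(a, b, c) \<in> rot K \<Longrightarrow> sheet_vertex K b c = sheet_vertex K b a"
  "(a, b, c) \<in> rot K \<Longrightarrow> sheet_vertex K c a = sheet_vertex K c b"
  using sv_rot rot_cyc by metis+

text \<open>Length 1 would repeat a vertex in a triangle. Length 2 would give the two triangles at
  an edge the same third vertex, against \<open>rot_swap\<close>.\<close>

lemma link_cycle:
  assumes u: "u \<in> nbrs K v"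
  obtains m where "m \<ge> 3" "(nxt K v ^^ m) u = u" "inj_on (\<lambda>i. (nxt K v ^^ i) u) {..<m}"
    "range (\<lambda>i. (nxt K v ^^ i) u) = (\<lambda>i. (nxt K v ^^ i) u) ` {..<m}"
proof -
  obtain m where m: "m > 0" "(nxt K v ^^ m) u = u" "inj_on (\<lambda>i. (nxt K v ^^ i) u) {..<m}"
    "range (\<lambda>i. (nxt K v ^^ i) u) = (\<lambda>i. (nxt K v ^^ i) u) ` {..<m}"
    by (rule funpow_cycle[OF finite_nbrs nxt_nbrs nxt_inj u])
  have r: "(v, u, nxt K v u) \<in> rot K" using nxt_rot[OF u] .
  have r2: "(v, nxt K v u, nxt K v (nxt K v u)) \<in> rot K"
    using nxt_rot nxt_nbrs u by blast
  have "m \<noteq> 1" using m(2) rot_edges(2)[OF r] by auto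
  moreover have "m \<noteq> 2"
    using m(2) rot_swap[OF r2] r rot_cyc by (metis comp_apply funpow_0 funpow_Suc_right numeral_2_eq_2)
  ultimately have "m \<ge> 3" using m(1) by linarith
  then show ?thesis using that m by blast
qed

end

section \<open>Surfaces\<close>

text \<open>The condition \<open>single_link\<close> says that the link of a vertex is one circle,
  which is what desingularization achieves. It holds vacuously at a vertex without neighbours, and
  \<open>nonisolated\<close> excludes this.\<close>

locale oriented_surface = oriented_complex K for K :: "'v complex2" +
  assumes nonisolated: "v \<in> verts K \<Longrightarrow> \<exists>u. u \<in> nbrs K v"
    and single_link: "u \<in> nbrs K v \<Longrightarrow> u' \<in> nbrs K v \<Longrightarrow> \<exists>i. u' = (nxt K v ^^ i) u"

locale closed_surface = oriented_surface K for K :: "'v complex2" +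
  assumes nonempty: "verts K \<noteq> {}"
    and connected: "u \<in> verts K \<Longrightarrow> w \<in> verts K \<Longrightarrow> (u, w) \<in> {(a, b). {a, b} \<in> edges K}\<^sup>*"

lemma wf_complex2I:
  assumes "finite (verts K)" "\<And>e. e \<in> edges K \<Longrightarrow> e \<subseteq> verts K \<and> card e = 2"
    "\<And>t. t \<in> tris K \<Longrightarrow> tri_set t \<subseteq> verts K \<and> card (tri_set t) = 3 \<and>
      (\<forall>e. e \<subseteq> tri_set t \<and> card e = 2 \<longrightarrow> e \<in> edges K)"
  shows "wf_complex2 K"
  unfolding wf_complex2_def
  by (rule conjI, rule assms(1), rule conjI, rule ballI, erule assms(2), rule ballI, erule assms(3))

lemma coherently_orientedI:
  assumes "inj_on tri_set (tris K)"
    "\<And>a b. {a, b} \<in> edges K \<Longrightarrow> \<exists>!t. t \<in> tris K \<and> (a, b) \<in> boundary_arcs t"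
  shows "coherently_oriented K"
  unfolding coherently_oriented_def
  by (rule conjI, rule assms(1), intro allI impI, erule assms(2))

lemma fst_sheet_vertex [simp]: "fst (sheet_vertex K a b) = a"
  by (simp add: sheet_vertex_def)

lemma fst_tri_set_lift: "fst ` tri_set (lift_tri K t) = tri_set t"
  by (cases t) (simp add: lift_tri_def tri_set_def)

section \<open>The desingularization of an oriented complex is a surface\<close>

context oriented_complex
begin

lemma verts_desingularize: "verts (desingularize K) = {sheet_vertex K v u | v u. u \<in> nbrs K v}"
proof -
  have "v \<in> verts K \<and> u \<in> verts (link K v) \<longleftrightarrow> u \<in> nbrs K v" for u v
    using edge_verts[of v u] by (auto simp: link_def nbrs_def)
  then show ?thesis by (simp add: desingularize_def)
qed

lemma edges_desingularize:
  "edges (desingularize K) = {{sheet_vertex K a b, sheet_vertex K b a} | a b. b \<in> nbrs K a}"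
  by (simp add: desingularize_def nbrs_def)

lemma tris_desingularize: "tris (desingularize K) = lift_tri K ` tris K"
  by (simp add: desingularize_def)

text \<open>\<open>lift_tri\<close> refers to the listed order of a triangle, but its formula is
  invariant under rotation and so extends to \<open>rot\<close>.\<close>

lemma lift_rot:
  assumes "(a, b, c) \<in> rot K"
  shows "(sheet_vertex K a b, sheet_vertex K b c, sheet_vertex K c a) \<in> rot (desingularize K)"
proof -
  have l: "lift_tri K (p, q, r) \<in> lift_tri K ` tris K" if "(p, q, r) \<in> tris K" for p q r
    using that by (rule imageI)
  from assms consider "(a, b, c) \<in> tris K" | "(b, c, a) \<in> tris K" | "(c, a, b) \<in> tris K"
    unfolding rot_def by auto
  then show ?thesis
    using l[of a b c] l[of b c a] l[of c a b]
    unfolding rot_def tris_desingularize by cases (simp_all add: lift_tri_def)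
qed

lemma nbrs_desingularize:
  assumes "V \<in> nbrs (desingularize K) U"
  obtains a b where "b \<in> nbrs K a" "U = sheet_vertex K a b" "V = sheet_vertex K b a"
proof -
  have "{U, V} \<in> edges (desingularize K)" using assms by (simp add: nbrs_def)
  then obtain a b where ab: "b \<in> nbrs K a" "{U, V} = {sheet_vertex K a b, sheet_vertex K b a}"
    unfolding edges_desingularize by auto
  from ab(2) consider "U = sheet_vertex K a b \<and> V = sheet_vertex K b a"
    | "U = sheet_vertex K b a \<and> V = sheet_vertex K a b"
    by (auto simp: doubleton_eq_iff)
  then show ?thesis using that ab(1) nbrs_sym by cases blast+
qed

lemma nbrs_desingularizeI:
  "b \<in> nbrs K a \<Longrightarrow> sheet_vertex K b a \<in> nbrs (desingularize K) (sheet_vertex K a b)"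
  unfolding nbrs_def[of "desingularize K"] edges_desingularize by auto

lemma wf_desingularize: "wf_complex2 (desingularize K)"
proof -
  let ?Y = "desingularize K"
  have "verts ?Y \<subseteq> (\<lambda>(v, u). sheet_vertex K v u) ` (verts K \<times> verts K)"
  proof
    fix A assume "A \<in> verts ?Y"
    then obtain v u where vu: "A = sheet_vertex K v u" "u \<in> nbrs K v"
      unfolding verts_desingularize by blast
    have "(v, u) \<in> verts K \<times> verts K" using vu(2) edge_verts[of v u] by (simp add: nbrs_def)
    then show "A \<in> (\<lambda>(v, u). sheet_vertex K v u) ` (verts K \<times> verts K)"
      using vu(1) by (metis case_prod_conv imageI)
  qed
  then have fin: "finite (verts ?Y)" using finite_verts by (meson finite_SigmaI finite_imageI finite_subset)
  have e2: "e \<subseteq> verts ?Y \<and> card e = 2" if e: "e \<in> edges ?Y" for e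
  proof -
    obtain a b where ab: "b \<in> nbrs K a" "e = {sheet_vertex K a b, sheet_vertex K b a}"
      using e unfolding edges_desingularize by blast
    moreover have "a \<in> nbrs K b" using ab(1) nbrs_sym by blast
    moreover have "a \<noteq> b" using ab(1) edge_verts[of a b] by (auto simp: nbrs_def)
    then have "sheet_vertex K a b \<noteq> sheet_vertex K b a" by (metis fst_sheet_vertex)
    then have "card e = 2" using ab(2) by simp
    moreover have "e \<subseteq> verts ?Y" unfolding verts_desingularize ab(2) using ab(1) \<open>a \<in> nbrs K b\<close> by blast
    ultimately show ?thesis by blast
  qed
  have t3: "tri_set t \<subseteq> verts ?Y \<and> card (tri_set t) = 3 \<and>
        (\<forall>e. e \<subseteq> tri_set t \<and> card e = 2 \<longrightarrow> e \<in> edges ?Y)" if t: "t \<in> tris ?Y" for t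
  proof -
    obtain a b c where abc: "(a, b, c) \<in> tris K" "t = lift_tri K (a, b, c)"
      using t unfolding tris_desingularize by auto
    have r: "(a, b, c) \<in> rot K" using abc(1) by (rule tris_rot)
    note d = rot_edges(1-3)[OF r] and e = rot_edges(4-6)[OF r]
    have ts: "tri_set t = {sheet_vertex K a b, sheet_vertex K b c, sheet_vertex K c a}"
      by (simp add: abc lift_tri_def tri_set_def)
    have card: "card (tri_set t) = 3"
      unfolding ts card3_iff using d by (metis fst_sheet_vertex)
    have E: "{sheet_vertex K a b, sheet_vertex K b a} \<in> edges ?Y"
      "{sheet_vertex K b c, sheet_vertex K c b} \<in> edges ?Y"
      "{sheet_vertex K a c, sheet_vertex K c a} \<in> edges ?Y"
      using e unfolding edges_desingularize nbrs_def by auto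
    note S = sv_rot[OF r] sv_rot2[OF r]
    have E': "{sheet_vertex K a b, sheet_vertex K b c} \<in> edges ?Y"
      "{sheet_vertex K b c, sheet_vertex K c a} \<in> edges ?Y"
      "{sheet_vertex K a b, sheet_vertex K c a} \<in> edges ?Y"
      using E S by simp_all
    moreover have "tri_set t \<subseteq> verts ?Y" unfolding ts using e2[OF E'(1)] e2[OF E'(2)] by simp
    moreover have "e \<in> edges ?Y" if "e \<subseteq> tri_set t" "card e = 2" for e
      using card2_subset3[OF that(1)[unfolded ts] that(2)] E' by (elim disjE) simp_all
    ultimately show ?thesis using card by blast
  qed
  show ?thesis by (rule wf_complex2I[OF fin e2 t3])
qed

lemma lift_arc:
  assumes "t \<in> tris K" "(a, b) \<in> boundary_arcs t"
  shows "(sheet_vertex K a b, sheet_vertex K b a) \<in> boundary_arcs (lift_tri K t)"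
proof -
  obtain p q r where t: "t = (p, q, r)" by (cases t)
  have r: "(p, q, r) \<in> rot K" using assms(1) unfolding t by (rule tris_rot)
  note S = sv_rot[OF r] sv_rot2[OF r]
  show ?thesis using assms(2) S unfolding t by (auto simp: boundary_arcs_def lift_tri_def)
qed

text \<open>First components project a lifted triangle back to \<open>K\<close>, and a triangle of
  \<open>K\<close> determines its lift, so injectivity and uniqueness are inherited from
  \<open>K\<close>.\<close>

lemma coherent_desingularize: "coherently_oriented (desingularize K)"
  unfolding coherently_oriented_def
proof (intro conjI allI impI)
  have inj: "inj_on tri_set (tris K)" using coh by (simp add: coherently_oriented_def)
  show "inj_on tri_set (tris (desingularize K))"
  proof (rule inj_onI)
    fix t t' assume t: "t \<in> tris (desingularize K)" "t' \<in> tris (desingularize K)" "tri_set t = tri_set t'"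
    obtain s s' where s: "s \<in> tris K" "t = lift_tri K s" "s' \<in> tris K" "t' = lift_tri K s'"
      using t(1,2) unfolding tris_desingularize by auto
    have "fst ` tri_set t = fst ` tri_set t'" using t(3) by simp
    then have "tri_set s = tri_set s'" unfolding s(2,4) fst_tri_set_lift .
    then have "s = s'" using inj s(1,3) by (meson inj_onD)
    then show "t = t'" using s by simp
  qed
  fix A B assume AB: "{A, B} \<in> edges (desingularize K)"
  then have "B \<in> nbrs (desingularize K) A" by (simp add: nbrs_def)
  then obtain a b where ab: "b \<in> nbrs K a" "A = sheet_vertex K a b" "B = sheet_vertex K b a"
    by (rule nbrs_desingularize)
  have ex1: "\<exists>!t. t \<in> tris K \<and> (a, b) \<in> boundary_arcs t"
    using coh ab(1) unfolding coherently_oriented_def nbrs_def by blast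
  then obtain t where t: "t \<in> tris K" "(a, b) \<in> boundary_arcs t" by blast
  show "\<exists>!t. t \<in> tris (desingularize K) \<and> (A, B) \<in> boundary_arcs t"
  proof (intro ex1I conjI)
    show "lift_tri K t \<in> tris (desingularize K)" using t unfolding tris_desingularize by simp
    show "(A, B) \<in> boundary_arcs (lift_tri K t)" using lift_arc[OF t] ab by simp
    fix t' assume t': "t' \<in> tris (desingularize K) \<and> (A, B) \<in> boundary_arcs t'"
    then obtain s where s: "s \<in> tris K" "t' = lift_tri K s" unfolding tris_desingularize by blast
    have "(A, B) \<in> boundary_arcs (lift_tri K s)" using t' s by simp
    then have "(fst A, fst B) \<in> boundary_arcs s"
      by (cases s) (auto simp: boundary_arcs_def lift_tri_def)
    then have "(a, b) \<in> boundary_arcs s" using ab by simp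
    then have "s = t" using ex1 s t by blast
    then show "t' = lift_tri K t" using s by simp
  qed
qed

lemma oriented_complex_desingularize: "oriented_complex (desingularize K)"
  by unfold_locales (rule wf_desingularize coherent_desingularize)+

text \<open>Turning about a sheet vertex follows the turning about the vertex below it. Consequently
  the link of a sheet vertex is one circle.\<close>

lemma nxt_desingularize:
  assumes "b \<in> nbrs K a"
  shows "nxt (desingularize K) (sheet_vertex K a b) (sheet_vertex K b a) = sheet_vertex K (nxt K a b) a"
proof -
  interpret Y: oriented_complex "desingularize K" by (rule oriented_complex_desingularize)
  have r: "(a, b, nxt K a b) \<in> rot K" using nxt_rot[OF assms] .
  then show ?thesis using Y.nxt_eq[OF lift_rot[OF r]] sv_rot2(1)[OF r] by simp
qed

lemma nxt_funpow_desingularize: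
  assumes "b \<in> nbrs K a"
  shows "(nxt (desingularize K) (sheet_vertex K a b) ^^ i) (sheet_vertex K b a)
    = sheet_vertex K ((nxt K a ^^ i) b) a"
proof (induction i)
  case (Suc i)
  let ?b = "(nxt K a ^^ i) b"
  have b: "?b \<in> nbrs K a" using nxt_funpow_nbrs[OF assms] .
  \<comment> \<open>Renaming the centre by the neighbour just reached allows the single step to be
    applied again.\<close>
  have "sheet_vertex K a b = sheet_vertex K a ?b" using sv_eq_iff[OF assms b] by blast
  then show ?case using Suc nxt_desingularize[OF b] by simp
qed simp

text \<open>Two neighbours of one sheet vertex come from edges at a common vertex \<open>a\<close>
  in the same link component; the power of \<open>nxt\<close> that relates these edges
  lifts.\<close>

theorem oriented_surface_desingularize: "oriented_surface (desingularize K)"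
proof -
  interpret Y: oriented_complex "desingularize K" by (rule oriented_complex_desingularize)
  show ?thesis
  proof unfold_locales
    fix V assume "V \<in> verts (desingularize K)"
    then show "\<exists>U. U \<in> nbrs (desingularize K) V"
      unfolding verts_desingularize using nbrs_desingularizeI by blast
  next
    fix U V U' assume U: "U \<in> nbrs (desingularize K) V" and U': "U' \<in> nbrs (desingularize K) V"
    obtain a b where ab: "b \<in> nbrs K a" "V = sheet_vertex K a b" "U = sheet_vertex K b a"
      using U by (rule nbrs_desingularize)
    obtain a' b' where ab': "b' \<in> nbrs K a'" "V = sheet_vertex K a' b'" "U' = sheet_vertex K b' a'"
      using U' by (rule nbrs_desingularize)
    obtain i where i: "a = a'" "b' = (nxt K a ^^ i) b"
      using sv_eq_iff[OF ab(1) ab'(1)] ab(2) ab'(2) by auto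
    have "U' = (nxt (desingularize K) V ^^ i) U"
      using nxt_funpow_desingularize[OF ab(1), of i] ab ab' i by simp
    then show "\<exists>i. U' = (nxt (desingularize K) V ^^ i) U" by (rule exI)
  qed
qed

end

subsection \<open>Connected components\<close>

lemma conn_class_refl: "u \<in> verts K \<Longrightarrow> u \<in> conn_class K u"
  by (simp add: conn_class_def)

lemma conn_rel_sym:
  assumes "(a, b) \<in> {(a, b). {a, b} \<in> edges K}\<^sup>*"
  shows "(b, a) \<in> {(a, b). {a, b} \<in> edges K}\<^sup>*"
proof -
  have "sym ({(a, b). {a, b} \<in> edges K}\<^sup>*)"
    by (rule sym_rtrancl) (auto simp: sym_def insert_commute)
  then show ?thesis using assms by (meson symD)
qed

context oriented_complex
begin

lemma conn_class_edge:
  assumes "w \<in> conn_class K u" "{w, w'} \<in> edges K"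
  shows "w' \<in> conn_class K u"
proof -
  have "(w, w') \<in> {(a, b). {a, b} \<in> edges K}" using assms(2) by simp
  then have "(u, w') \<in> {(a, b). {a, b} \<in> edges K}\<^sup>*"
    using assms(1) unfolding conn_class_def by (auto intro: rtrancl_into_rtrancl)
  then show ?thesis using edge_verts[OF assms(2)] by (simp add: conn_class_def)
qed

lemma conn_class_eq:
  assumes "w \<in> conn_class K u"
  shows "conn_class K w = conn_class K u"
proof -
  have uw: "(u, w) \<in> {(a, b). {a, b} \<in> edges K}\<^sup>*" using assms by (simp add: conn_class_def)
  have wu: "(w, u) \<in> {(a, b). {a, b} \<in> edges K}\<^sup>*" by (rule conn_rel_sym[OF uw])
  show ?thesis
    unfolding conn_class_def using rtrancl_trans[OF uw] rtrancl_trans[OF wu] by auto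
qed

lemma tri_conn_class:
  assumes "t \<in> tris K" "v \<in> tri_set t" "v \<in> conn_class K u"
  shows "tri_set t \<subseteq> conn_class K u"
proof -
  obtain a b c where t: "t = (a, b, c)" by (cases t)
  have r: "(a, b, c) \<in> rot K" using assms(1) unfolding t by (rule tris_rot)
  note E = rot_edges(4-6)[OF r]
  have "v = a \<or> v = b \<or> v = c" using assms(2) by (auto simp: t tri_set_def)
  then show ?thesis
    using assms(3) conn_class_edge[of _ u] E unfolding t
    by (auto simp: tri_set_def insert_commute)
qed

end

context oriented_surface
begin

text \<open>A triangle with one vertex in the class lies entirely in it. Hence whole stars are kept,
  and \<open>rot\<close>, \<open>nbrs\<close> and \<open>nxt\<close> at a vertex of the component
  are the same as in \<open>K\<close>.\<close>

theorem closed_surface_component: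
  assumes u: "u \<in> verts K"
  defines "C \<equiv> conn_class K u"
  defines "T \<equiv> full_subcomplex K C"
  shows "closed_surface T" and "rot T = {(a, b, c) \<in> rot K. a \<in> C}"
    and "\<And>v w. v \<in> C \<Longrightarrow> w \<in> nbrs T v \<longleftrightarrow> w \<in> nbrs K v"
    and "\<And>v w. v \<in> C \<Longrightarrow> w \<in> nbrs K v \<Longrightarrow> nxt T v w = nxt K v w"
    and "verts T = C"
proof -
  have CV: "C \<subseteq> verts K" unfolding C_def conn_class_def by auto
  show vT: "verts T = C" using CV by (auto simp: T_def full_subcomplex_def)
  have eT: "{a, b} \<in> edges T \<longleftrightarrow> {a, b} \<in> edges K \<and> a \<in> C" for a b
    using conn_class_edge[of a u b] by (auto simp: T_def full_subcomplex_def C_def)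
  have eT': "e \<in> edges T \<longleftrightarrow> e \<in> edges K \<and> e \<subseteq> C" for e
    by (auto simp: T_def full_subcomplex_def)
  have tT: "t \<in> tris T \<longleftrightarrow> t \<in> tris K \<and> tri_set t \<subseteq> C" for t
    by (auto simp: T_def full_subcomplex_def)
  have tT': "t \<in> tris K \<Longrightarrow> v \<in> tri_set t \<Longrightarrow> v \<in> C \<Longrightarrow> t \<in> tris T" for t v
    using tri_conn_class[of t v u] tT by (auto simp: C_def)
  have rT: "(a, b, c) \<in> rot T \<longleftrightarrow> (a, b, c) \<in> rot K \<and> a \<in> C" for a b c
  proof
    assume "(a, b, c) \<in> rot T"
    then obtain t where "t \<in> tris T" "tri_set t = {a, b, c}" "t \<in> {(a, b, c), (b, c, a), (c, a, b)}"
      by (rule rot_tri)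
    then show "(a, b, c) \<in> rot K \<and> a \<in> C" using tT[of t] by (auto simp: rot_def)
  next
    assume *: "(a, b, c) \<in> rot K \<and> a \<in> C"
    then obtain t where t: "t \<in> tris K" "tri_set t = {a, b, c}" "t \<in> {(a, b, c), (b, c, a), (c, a, b)}"
      by (meson rot_tri)
    then have "t \<in> tris T" using tT'[of t a] * by auto
    then show "(a, b, c) \<in> rot T" using t(3) by (auto simp: rot_def)
  qed
  then show "rot T = {(a, b, c) \<in> rot K. a \<in> C}" by auto
  have nT: "w \<in> nbrs T v \<longleftrightarrow> w \<in> nbrs K v \<and> v \<in> C" for v w
    unfolding nbrs_def using eT by auto
  then show "\<And>v w. v \<in> C \<Longrightarrow> w \<in> nbrs T v \<longleftrightarrow> w \<in> nbrs K v" by blast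
  have xT: "nxt T v w = nxt K v w" if "v \<in> C" for v w
    unfolding nxt_def rT using that by simp
  then show "\<And>v w. v \<in> C \<Longrightarrow> w \<in> nbrs K v \<Longrightarrow> nxt T v w = nxt K v w" by blast
  interpret T: oriented_complex T
  proof
    have fin: "finite (verts T)" using vT CV finite_verts finite_subset by metis
    have e2: "e \<subseteq> verts T \<and> card e = 2" if "e \<in> edges T" for e
      using that eT'[of e] vT wf unfolding wf_complex2_def by auto
    have t3: "tri_set t \<subseteq> verts T \<and> card (tri_set t) = 3 \<and>
        (\<forall>e. e \<subseteq> tri_set t \<and> card e = 2 \<longrightarrow> e \<in> edges T)" if "t \<in> tris T" for t
    proof -
      have tK: "t \<in> tris K" "tri_set t \<subseteq> C" using that tT by simp_all
      then have "card (tri_set t) = 3 \<and> (\<forall>e. e \<subseteq> tri_set t \<and> card e = 2 \<longrightarrow> e \<in> edges K)"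
        using wf unfolding wf_complex2_def by simp
      then show ?thesis using tK(2) vT eT' by auto
    qed
    show "wf_complex2 T" by (rule wf_complex2I[OF fin e2 t3])
    have inj: "inj_on tri_set (tris K)" using coh by (simp add: coherently_oriented_def)
    have injT: "inj_on tri_set (tris T)" by (rule inj_on_subset[OF inj]) (use tT in blast)
    have exT: "\<exists>!t. t \<in> tris T \<and> (a, b) \<in> boundary_arcs t" if ab: "{a, b} \<in> edges T" for a b
    proof -
      have ab': "{a, b} \<in> edges K" "a \<in> C" using ab eT by blast+
      have "\<exists>!t. t \<in> tris K \<and> (a, b) \<in> boundary_arcs t"
        using coh ab'(1) unfolding coherently_oriented_def by blast
      moreover have "t \<in> tris T \<longleftrightarrow> t \<in> tris K" if "(a, b) \<in> boundary_arcs t" for t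
      proof -
        have "a \<in> tri_set t" using that by (cases t) (auto simp: boundary_arcs_def tri_set_def)
        then show ?thesis using tT tT' ab'(2) by blast
      qed
      ultimately show ?thesis by metis
    qed
    show "coherently_oriented T" by (rule coherently_orientedI[OF injT exT])
  qed
  show "closed_surface T"
  proof unfold_locales
    fix v assume "v \<in> verts T"
    then show "\<exists>u. u \<in> nbrs T v" using nonisolated[of v] nT vT CV by blast
  next
    fix a b v assume a: "a \<in> nbrs T v" and b: "b \<in> nbrs T v"
    have v: "v \<in> C" using a nT by blast
    obtain i where i: "b = (nxt K v ^^ i) a" using single_link[of a v b] a b nT by blast
    have "(nxt T v ^^ j) a = (nxt K v ^^ j) a" for j
      by (induction j) (simp_all add: xT[OF v])
    then show "\<exists>i. b = (nxt T v ^^ i) a" using i by metis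
  next
    show "verts T \<noteq> {}" using vT conn_class_refl[OF u] C_def by auto
  next
    fix a b assume a: "a \<in> verts T" and b: "b \<in> verts T"
    have "conn_class K a = C" using a vT conn_class_eq unfolding C_def by blast
    then have "b \<in> conn_class K a" using b vT by simp
    then have "(a, b) \<in> {(a, b). {a, b} \<in> edges K}\<^sup>*" by (simp add: conn_class_def)
    then have "(a, b) \<in> {(a, b). {a, b} \<in> edges T}\<^sup>* \<and> b \<in> C"
    proof (induction rule: rtrancl_induct)
      case base
      then show ?case using a vT by simp
    next
      case (step y z)
      then have "{y, z} \<in> edges K" "y \<in> C" by auto
      then have "{y, z} \<in> edges T" "z \<in> C" using eT conn_class_edge[of y u z] C_def by auto
      then show ?case using step by (auto intro: rtrancl_into_rtrancl)
    qed
    then show "(a, b) \<in> {(a, b). {a, b} \<in> edges T}\<^sup>*" by blast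
  qed
qed

end

context closed_surface
begin

text \<open>Turning a triangle and crossing an edge reach every rotated triangle: used alternately
  they lead around a vertex, whose link is one circle, and an edge path then leads to any other
  vertex.\<close>

lemma flag_induct:
  assumes ne: "f0 \<in> rot K" "P f0"
    and turn: "\<And>a b c. (a, b, c) \<in> rot K \<Longrightarrow> P (a, b, c) \<Longrightarrow> P (b, c, a)"
    and cross: "\<And>a b c d. (a, b, c) \<in> rot K \<Longrightarrow> (b, a, d) \<in> rot K \<Longrightarrow> P (a, b, c) \<Longrightarrow> P (b, a, d)"
    and f: "f \<in> rot K"
  shows "P f"
proof -
  have star: "P (a, b', c')" if r: "(a, b, c) \<in> rot K" "P (a, b, c)" and r': "(a, b', c') \<in> rot K" for a b c b' c'
  proof -
    have nb: "b \<in> nbrs K a" "b' \<in> nbrs K a" using r(1) r' rot_edges(4) by (auto simp: nbrs_def)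
    have "P (a, (nxt K a ^^ i) b, nxt K a ((nxt K a ^^ i) b))" for i
    proof (induction i)
      case 0
      then show ?case using r nxt_eq[OF r(1)] by simp
    next
      case (Suc i)
      let ?u = "(nxt K a ^^ i) b" and ?w = "(nxt K a ^^ Suc i) b"
      have 1: "(a, ?u, ?w) \<in> rot K" using nxt_rot[OF nxt_funpow_nbrs[OF nb(1)]] by simp
      have 2: "(a, ?w, nxt K a ?w) \<in> rot K" using nxt_rot[OF nxt_funpow_nbrs[OF nb(1)]] .
      \<comment> \<open>Two turns bring the edge between \<open>?w\<close> and \<open>a\<close> to
        the front, and crossing it gives the next triangle about \<open>a\<close>.\<close>
      have "P (a, ?u, ?w)" using Suc by simp
      then have "P (?w, a, ?u)" using turn 1 rot_cyc by metis
      then show ?case using cross[OF rot_cyc[OF rot_cyc[OF 1]] 2] by blast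
    qed
    moreover obtain i where "b' = (nxt K a ^^ i) b" using single_link[OF nb] by metis
    moreover have "c' = nxt K a b'" using nxt_eq[OF r'] by simp
    ultimately show ?thesis by metis
  qed
  obtain a0 b0 c0 where f0: "f0 = (a0, b0, c0)" by (cases f0)
  obtain a b c where fabc: "f = (a, b, c)" by (cases f)
  have "(a0, a) \<in> {(a, b). {a, b} \<in> edges K}\<^sup>*"
    using connected[of a0 a] rot_edges(7)[of a0 b0 c0] rot_edges(7)[of a b c] ne(1) f f0 fabc by blast
  then have "\<forall>b c. (a, b, c) \<in> rot K \<longrightarrow> P (a, b, c)"
  proof (induction rule: rtrancl_induct)
    case base
    then show ?case using star ne f0 by blast
  next
    case (step y z)
    then obtain w where w: "(y, z, w) \<in> rot K" using rot_ex[of y z] by auto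
    then have "P (y, z, w)" using step by blast
    then have "P (z, w, y)" using turn[OF w] by blast
    then show ?case using star[OF rot_cyc[OF w]] by blast
  qed
  then show ?thesis using f fabc by blast
qed

end

section \<open>The geometric realization of a closed surface\<close>

subsection \<open>A disc as a fan of sectors\<close>

text \<open>On the unit circle this is the tent of height 1 over the \<open>j\<close>-th of
  \<open>m\<close> equally spaced directions, vanishing from the adjacent directions on; it is
  extended homogeneously along rays. The \<open>arccos\<close> is the unsigned angle between
  \<open>z\<close> and that direction. At the origin the quotient is 0 by convention, and the factor
  \<open>cmod z\<close> makes the value 0.\<close>

definition hat :: "nat \<Rightarrow> nat \<Rightarrow> complex \<Rightarrow> real" where
  "hat m j z =
     cmod z * max 0 (1 - real m / (2 * pi) * arccos (Re (z * cis (- (2 * pi * real j / real m))) / cmod z))"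

lemma Re_div_cmod: "\<bar>Re (z * cis a) / cmod z\<bar> \<le> 1"
proof (cases "z = 0")
  case False
  have "\<bar>Re (z * cis a)\<bar> \<le> cmod z" using abs_Re_le_cmod[of "z * cis a"] by (simp add: norm_mult)
  then show ?thesis using False by (simp add: field_simps)
qed simp

lemma hat_bounds: "0 \<le> hat m j z" "hat m j z \<le> cmod z"
proof -
  have "0 \<le> arccos (Re (z * cis (- (2 * pi * real j / real m))) / cmod z)"
    using Re_div_cmod[of z "- (2 * pi * real j / real m)"] by (intro arccos_lbound) linarith+
  then have "0 \<le> real m / (2 * pi) * arccos (Re (z * cis (- (2 * pi * real j / real m))) / cmod z)"
    by simp
  then show "0 \<le> hat m j z" "hat m j z \<le> cmod z"
    unfolding hat_def by (auto intro!: mult_left_le)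
qed

lemma continuous_hat: "continuous_on UNIV (hat m j)"
proof (rule continuous_at_imp_continuous_on, rule ballI)
  fix z :: complex
  show "isCont (hat m j) z"
  proof (cases "z = 0")
    case True
    \<comment> \<open>The angle has no limit at the origin, but the tent lies between 0 and
      \<open>cmod\<close>.\<close>
    have "((\<lambda>w. hat m j w) \<longlongrightarrow> 0) (at 0)"
    proof (rule tendsto_sandwich[of "\<lambda>_. 0" _ _ cmod])
      show "(cmod \<longlongrightarrow> 0) (at 0)" by (rule tendsto_norm_zero) (rule tendsto_ident_at)
    qed (simp_all add: hat_bounds)
    moreover have "hat m j 0 = 0" by (simp add: hat_def)
    ultimately show ?thesis using True by (simp add: isCont_def)
  next
    case False
    have b: "\<forall>w \<in> - {0}. -1 \<le> Re (w * cis a) / cmod w \<and> Re (w * cis a) / cmod w \<le> 1" for a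
    proof
      fix w :: complex
      show "-1 \<le> Re (w * cis a) / cmod w \<and> Re (w * cis a) / cmod w \<le> 1"
        using Re_div_cmod[of w a] by linarith
    qed
    have "continuous_on (- {0}) (\<lambda>w. Re (w * cis a) / cmod w)" for a
      by (intro continuous_on_divide continuous_on_Re continuous_on_mult continuous_on_norm
          continuous_on_id continuous_on_const) simp
    then have c: "continuous_on (- {0}) (\<lambda>w. arccos (Re (w * cis a) / cmod w))" for a
      using b by (rule continuous_on_arccos)
    have "continuous_on (- {0}) (hat m j)"
      unfolding hat_def
      by (intro continuous_on_mult continuous_on_max continuous_on_diff continuous_on_norm
          continuous_on_id continuous_on_const c)
    then show ?thesis using False by (simp add: continuous_on_eq_continuous_at open_Compl)
  qed
qed

lemma arccos_cos_wrap:
  assumes "\<bar>x\<bar> \<le> 2 * pi"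
  shows "arccos (cos x) = min \<bar>x\<bar> (2 * pi - \<bar>x\<bar>)"
proof (cases "\<bar>x\<bar> \<le> pi")
  case True
  then show ?thesis using arccos_cos_eq_abs by simp
next
  case False
  have "cos x = cos (2 * pi - \<bar>x\<bar>)" by (simp add: abs_if cos_diff)
  then show ?thesis using False assms arccos_cos[of "2 * pi - \<bar>x\<bar>"] by simp
qed

text \<open>Here \<open>s\<close> is the fraction of the sector from direction \<open>i\<close> to
  the next one. Only the two bounding tents are nonzero in it, and they are affine in
  \<open>s\<close>: these are barycentric coordinates, so the disc becomes a fan of \<open>m\<close>
  triangles. Requiring \<open>s < 1\<close> assigns each ray to one sector only.\<close>

lemma hat_rcis:
  assumes m: "m \<ge> 3" and i: "i < m" and j: "j < m" and s: "0 \<le> s" "s < 1" and r: "0 \<le> r"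
  shows "hat m j (rcis r (2 * pi * (real i + s) / real m)) =
    r * (if j = i then 1 - s else if j = Suc i mod m then s else 0)"
proof (cases "r = 0")
  case False
  \<comment> \<open>Signed distance from direction \<open>j\<close>, measured in sectors. The
    \<open>arccos\<close> returns the wrapped distance, the smaller of \<open>\<bar>d\<bar>\<close>
    and \<open>real m - \<bar>d\<bar>\<close>.\<close>
  define d where "d = real i + s - real j"
  let ?z = "rcis r (2 * pi * (real i + s) / real m)"
  have m0: "real m > 0" using m by simp
  have d: "\<bar>d\<bar> \<le> real m" using i j s unfolding d_def by linarith
  have "?z * cis (- (2 * pi * real j / real m)) = rcis r (2 * pi * d / real m)"
    unfolding rcis_def d_def by (simp add: cis_mult mult.assoc diff_divide_distrib add_divide_distrib algebra_simps)
  then have "Re (?z * cis (- (2 * pi * real j / real m))) / cmod ?z = cos (2 * pi * d / real m)"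
    using False r by (simp only: Re_rcis complex_mod_rcis) simp
  moreover have "arccos (cos (2 * pi * d / real m)) = 2 * pi / real m * min \<bar>d\<bar> (real m - \<bar>d\<bar>)"
  proof -
    have a: "\<bar>2 * pi * d / real m\<bar> = 2 * pi / real m * \<bar>d\<bar>" by (simp add: abs_mult)
    have b: "2 * pi - 2 * pi / real m * \<bar>d\<bar> = 2 * pi / real m * (real m - \<bar>d\<bar>)"
      using m0 by (simp add: field_simps)
    have "2 * pi / real m * \<bar>d\<bar> \<le> 2 * pi / real m * real m"
      using d m0 by (intro mult_left_mono) auto
    then have "\<bar>2 * pi * d / real m\<bar> \<le> 2 * pi" unfolding a using m0 by simp
    then have "arccos (cos (2 * pi * d / real m)) =
        min (2 * pi / real m * \<bar>d\<bar>) (2 * pi / real m * (real m - \<bar>d\<bar>))"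
      using arccos_cos_wrap[of "2 * pi * d / real m"] unfolding a b by blast
    then show ?thesis using m0 by (simp add: min_mult_distrib_left)
  qed
  moreover have "real m / (2 * pi) * (2 * pi / real m * x) = x" for x
    using m0 by simp
  ultimately have "hat m j ?z = r * max 0 (1 - min \<bar>d\<bar> (real m - \<bar>d\<bar>))"
    unfolding hat_def using r by (simp add: norm_mult)
  moreover have "max 0 (1 - min \<bar>d\<bar> (real m - \<bar>d\<bar>)) = (if j = i then 1 - s else if j = Suc i mod m then s else 0)"
  proof -
    have m3: "real m \<ge> 3" using m by simp
    \<comment> \<open>The third case is the last sector, whose far boundary is direction 0.\<close>
    consider "j = i" | "j = Suc i" | "j < i" "i = m - 1" "j = 0" | "j < i" "i < m - 1 \<or> j > 0" | "j > Suc i"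
      using i j by linarith
    then show ?thesis
    proof cases
      case 1
      then show ?thesis using s m3 by (simp add: d_def)
    next
      case 2
      then have "d = s - 1" "j = Suc i mod m" "j \<noteq> i" using j by (simp_all add: d_def)
      then show ?thesis using s m3 by simp
    next
      case 3
      then have "real i = real m - 1" "Suc i mod m = j" using m by (auto simp: of_nat_diff)
      then have "d = real m - 1 + s" using 3 by (simp add: d_def)
      then show ?thesis using s m3 3 \<open>Suc i mod m = j\<close> by simp
    next
      case 4
      have "Suc i mod m \<noteq> j"
        using 4 i by (cases "Suc i = m") auto
      moreover have "1 \<le> d" using 4(1) s unfolding d_def by linarith
      moreover have "real m - d \<ge> 1"
      proof -
        have "real i + 2 \<le> real m + real j" using 4 i by linarith
        then show ?thesis using s unfolding d_def by linarith
      qed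
      ultimately show ?thesis using 4 by simp
    next
      case 5
      have "Suc i mod m \<noteq> j" using 5 i j by (cases "Suc i = m") auto
      moreover have "d \<le> -1" using 5 s unfolding d_def by linarith
      moreover have "real m + d \<ge> 1" using i j s unfolding d_def by linarith
      ultimately show ?thesis using 5 by simp
    qed
  qed
  ultimately show ?thesis by simp
qed (simp add: hat_def)

lemma sector_exists:
  assumes m: "m \<ge> 3"
  obtains i s where "i < m" "0 \<le> s" "s < 1" "z = rcis (cmod z) (2 * pi * (real i + s) / real m)"
proof -
  define t where "t = Arg2pi z * real m / (2 * pi)"
  have m0: "real m > 0" using m by simp
  have t: "0 \<le> t" "t < real m"
  proof -
    show "0 \<le> t" unfolding t_def using Arg2pi_ge_0 by simp
    have "Arg2pi z * real m < 2 * pi * real m"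
      using Arg2pi_lt_2pi m0 by (intro mult_strict_right_mono)
    then show "t < real m" unfolding t_def by (simp add: divide_less_eq mult.commute)
  qed
  define i where "i = nat \<lfloor>t\<rfloor>"
  define s where "s = t - real i"
  have i: "real i = \<lfloor>t\<rfloor>" unfolding i_def using t by simp
  have "i < m" "0 \<le> s" "s < 1"
    using i t unfolding s_def by linarith+
  moreover have "2 * pi * (real i + s) / real m = Arg2pi z"
    unfolding s_def t_def using m0 by simp
  moreover have "z = rcis (cmod z) (Arg2pi z)"
    using Arg2pi_eq[of z] by (simp add: rcis_def cis_conv_exp mult.commute)
  ultimately show ?thesis using that[of i s] by simp
qed

text \<open>The tent at the initial direction of the sector of a nonzero point is positive, because
  \<open>1 - s > 0\<close>. If the two sectors differed, each initial direction would be the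
  successor of the other modulo \<open>m\<close>, which \<open>m \<ge> 3\<close> forbids.\<close>

lemma hat_inject:
  assumes m: "m \<ge> 3" and c: "cmod z = cmod z'" and h: "\<And>j. j < m \<Longrightarrow> hat m j z = hat m j z'"
  shows "z = z'"
proof (cases "z = 0")
  case True
  then show ?thesis using c by simp
next
  case False
  obtain i s where q: "i < m" "0 \<le> s" "s < 1" "z = rcis (cmod z) (2 * pi * (real i + s) / real m)"
    using sector_exists[OF m] .
  obtain i' s' where q': "i' < m" "0 \<le> s'" "s' < 1" "z' = rcis (cmod z') (2 * pi * (real i' + s') / real m)"
    using sector_exists[OF m] .
  define w where "w j = (if j = i then 1 - s else if j = Suc i mod m then s else 0)" for j
  define w' where "w' j = (if j = i' then 1 - s' else if j = Suc i' mod m then s' else 0)" for j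
  have ww: "w j = w' j" if "j < m" for j
  proof -
    have A: "hat m j z = cmod z * w j"
      using hat_rcis[OF m q(1) that q(2,3), of "cmod z"] q(4) unfolding w_def by simp
    have B: "hat m j z' = cmod z * w' j"
      using hat_rcis[OF m q'(1) that q'(2,3), of "cmod z'"] q'(4) unfolding w'_def c by simp
    have "cmod z * w j = cmod z * w' j" using h[OF that] unfolding A B .
    then show ?thesis using False by simp
  qed
  have "i = i'"
  proof (rule ccontr)
    assume ii: "i \<noteq> i'"
    have "w' i > 0" using ww[OF q(1)] q(3) unfolding w_def by simp
    then have 1: "i = Suc i' mod m" using ii unfolding w'_def by (auto split: if_splits)
    have "w i' > 0" using ww[OF q'(1)] q'(3) unfolding w'_def by simp
    then have 2: "i' = Suc i mod m" using ii unfolding w_def by (auto split: if_splits)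
    have wrap: "k = 0 \<and> Suc l = m \<or> k = Suc l" if "k = Suc l mod m" "l < m" for k l
    proof (cases "Suc l = m")
      case True
      then show ?thesis using that(1) by simp
    next
      case False
      then show ?thesis using that by simp
    qed
    have "i = 0 \<and> Suc i' = m \<or> i = Suc i'" by (rule wrap[OF 1 q'(1)])
    moreover have "i' = 0 \<and> Suc i = m \<or> i' = Suc i" by (rule wrap[OF 2 q(1)])
    ultimately show False using m by linarith
  qed
  moreover have "s = s'" using ww[OF q(1)] \<open>i = i'\<close> unfolding w_def w'_def by simp
  ultimately show ?thesis using q(4) q'(4) c by simp
qed

section \<open>Topology of the realization: compactness, countability, connectedness, charts\<close>

definition realization :: "'v complex2 \<Rightarrow> ('v \<Rightarrow> real) set" where
  "realization K = {t. (\<forall>v. t v \<ge> 0) \<and> {v. t v \<noteq> 0} \<in> simplices2 K \<and> (\<Sum>v \<in> verts K. t v) = 1}"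

lemma geom_realization_eq: "geom_realization K = top_of_set (realization K)"
  by (simp add: geom_realization_def realization_def)

lemma Hausdorff_space_fun: "Hausdorff_space (euclidean :: ('i \<Rightarrow> real) topology)"
proof -
  have "Hausdorff_space (product_topology (\<lambda>i. euclidean :: real topology) (UNIV :: 'i set))"
    unfolding Hausdorff_space_product_topology by simp
  then show ?thesis unfolding euclidean_product_topology .
qed

lemma continuous_on_coordinate: "continuous_on S (\<lambda>t :: 'i \<Rightarrow> real. t i)"
  by (rule continuous_on_subset[OF continuous_on_product_coordinates]) simp

lemma homeomorphic_space_top_of_set:
  "S homeomorphic T \<Longrightarrow> top_of_set S homeomorphic_space top_of_set T"
  unfolding homeomorphic_def homeomorphic_space_def homeomorphic_maps_def homeomorphism_def
  by (force simp: Pi_iff)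

context oriented_complex
begin

lemma simplices_subset:
  assumes "\<sigma> \<in> simplices2 K" "\<tau> \<subseteq> \<sigma>" "\<tau> \<noteq> {}"
  shows "\<tau> \<in> simplices2 K"
proof -
  consider v where "v \<in> verts K" "\<sigma> = {v}" | "\<sigma> \<in> edges K" | t where "t \<in> tris K" "\<sigma> = tri_set t"
    using assms(1) unfolding simplices2_def by blast
  then show ?thesis
  proof cases
    case 1
    then show ?thesis using assms by (metis subset_singletonD)
  next
    case 2
    then obtain a b where ab: "\<sigma> = {a, b}" "a \<in> verts K" "b \<in> verts K" by (rule edge_cases)
    then have "\<tau> = {a} \<or> \<tau> = {b} \<or> \<tau> = \<sigma>" using assms(2,3) by blast
    then show ?thesis using 2 ab unfolding simplices2_def by blast
  next
    case 3
    obtain a b c where t: "t = (a, b, c)" by (cases t)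
    have r: "(a, b, c) \<in> rot K" using 3(1) unfolding t by (rule tris_rot)
    note e = rot_edges(4-9)[OF r]
    have \<sigma>: "\<sigma> = {a, b, c}" using 3 t by (simp add: tri_set_def)
    have "\<tau> \<in> Pow {a, b, c}" using assms(2) \<sigma> by simp
    then have "\<tau> = {a} \<or> \<tau> = {b} \<or> \<tau> = {c} \<or> \<tau> = {a, b} \<or> \<tau> = {b, c} \<or> \<tau> = {a, c} \<or> \<tau> = \<sigma>"
      using assms(3) unfolding \<sigma> Pow_insert by auto
    moreover have "{{a}, {b}, {c}, {a, b}, {b, c}, {a, c}, \<sigma>} \<subseteq> simplices2 K"
      using e assms(1) unfolding simplices2_def by simp
    ultimately show ?thesis by auto
  qed
qed

lemma simplices_verts: "\<sigma> \<in> simplices2 K \<Longrightarrow> \<sigma> \<subseteq> verts K"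
  using wf unfolding simplices2_def wf_complex2_def by auto

lemma simplices_nonempty: "\<sigma> \<in> simplices2 K \<Longrightarrow> \<sigma> \<noteq> {}"
  using wf unfolding simplices2_def wf_complex2_def by (auto simp: tri_set_def split: prod.splits)

lemma finite_simplices: "finite (simplices2 K)"
  using finite_subset[of "simplices2 K" "Pow (verts K)"] simplices_verts finite_verts by blast

text \<open>Supports only need to be contained in a simplex, since nonempty subsets of simplices are
  simplices. This displays the realization as a finite union of closed sets.\<close>

lemma realization_eq:
  "realization K = (\<Union>\<sigma> \<in> simplices2 K.
    {t. (\<forall>v. t v \<ge> 0) \<and> (\<forall>v. v \<notin> \<sigma> \<longrightarrow> t v = 0) \<and> (\<Sum>v \<in> verts K. t v) = 1})"
proof (intro equalityI subsetI)
  fix t assume "t \<in> realization K"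
  then show "t \<in> (\<Union>\<sigma> \<in> simplices2 K.
    {t. (\<forall>v. t v \<ge> 0) \<and> (\<forall>v. v \<notin> \<sigma> \<longrightarrow> t v = 0) \<and> (\<Sum>v \<in> verts K. t v) = 1})"
    unfolding realization_def by (intro UN_I[of "{v. t v \<noteq> 0}"]) auto
next
  fix t :: "'v \<Rightarrow> real"
  assume "t \<in> (\<Union>\<sigma> \<in> simplices2 K.
    {t. (\<forall>v. t v \<ge> 0) \<and> (\<forall>v. v \<notin> \<sigma> \<longrightarrow> t v = 0) \<and> (\<Sum>v \<in> verts K. t v) = 1})"
  then obtain \<sigma> where \<sigma>: "\<sigma> \<in> simplices2 K" and t: "\<forall>v. t v \<ge> 0" "\<forall>v. v \<notin> \<sigma> \<longrightarrow> t v = 0"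
    "(\<Sum>v \<in> verts K. t v) = 1" by blast
  have "{v. t v \<noteq> 0} \<subseteq> \<sigma>" using t(2) by blast
  moreover have "{v. t v \<noteq> 0} \<noteq> {}"
  proof
    assume "{v. t v \<noteq> 0} = {}"
    then have "t v = 0" for v by blast
    then have "(\<Sum>v \<in> verts K. t v) = 0" by (intro sum.neutral) blast
    then show False using t(3) by linarith
  qed
  ultimately show "t \<in> realization K"
    using simplices_subset[OF \<sigma>] t unfolding realization_def by blast
qed

lemma realizationI:
  assumes "\<sigma> \<in> simplices2 K" "\<And>v. t v \<ge> 0" "\<And>v. v \<notin> \<sigma> \<Longrightarrow> t v = 0" "(\<Sum>v \<in> verts K. t v) = 1"
  shows "t \<in> realization K"
  unfolding realization_eq using assms by blast

lemma closed_simplex: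
  "closed {t :: 'v \<Rightarrow> real. (\<forall>v. t v \<ge> 0) \<and> (\<forall>v. v \<notin> \<sigma> \<longrightarrow> t v = 0) \<and> (\<Sum>v \<in> verts K. t v) = 1}"
proof -
  have "closed {t :: 'v \<Rightarrow> real. \<forall>v. t v \<ge> 0}"
    by (intro closed_Collect_all closed_Collect_le continuous_on_const continuous_on_coordinate)
  moreover have "closed {t :: 'v \<Rightarrow> real. \<forall>v. v \<notin> \<sigma> \<longrightarrow> t v = 0}"
    by (intro closed_Collect_all closed_Collect_imp closed_Collect_eq continuous_on_const
        continuous_on_coordinate) simp
  moreover have "closed {t :: 'v \<Rightarrow> real. (\<Sum>v \<in> verts K. t v) = 1}"
    by (intro closed_Collect_eq continuous_on_const continuous_on_sum continuous_on_coordinate)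
  ultimately show ?thesis by (intro closed_Collect_conj)
qed

text \<open>A closed subset of a compact product. The factors outside \<open>verts K\<close> are
  \<open>{0}\<close>, because the function space has a coordinate for every element of the vertex
  type.\<close>

lemma compact_realization: "compact (realization K)"
proof -
  define C where "C v = (if v \<in> verts K then {0..1 :: real} else {0})" for v
  have "compactin (product_topology (\<lambda>i. euclidean) UNIV) (PiE UNIV C)"
    unfolding compactin_PiE C_def by simp
  then have "compact (PiE UNIV C)" unfolding euclidean_product_topology by simp
  moreover have "closed (realization K)"
    unfolding realization_eq by (intro closed_UN finite_simplices ballI closed_simplex)
  moreover have "realization K \<subseteq> PiE UNIV C"
  proof
    fix t assume t: "t \<in> realization K"
    have "t v \<in> C v" for v
    proof (cases "v \<in> verts K")
      case True
      have "t v \<le> (\<Sum>v \<in> verts K. t v)"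
        using t finite_verts True unfolding realization_def by (intro member_le_sum) auto
      then show ?thesis using t True unfolding realization_def C_def by auto
    next
      case False
      have "{v. t v \<noteq> 0} \<subseteq> verts K" using t simplices_verts unfolding realization_def by blast
      then show ?thesis using False unfolding C_def by auto
    qed
    then show "t \<in> PiE UNIV C" by (simp add: PiE_iff extensional_def)
  qed
  ultimately show ?thesis using closed_Int_compact[of "realization K" "PiE UNIV C"] by (simp add: inf_absorb1)
qed

lemma compact_space_realization: "compact_space (geom_realization K)"
  unfolding geom_realization_eq
  by (rule compact_space_subtopology) (simp add: compact_realization)

lemma Hausdorff_space_realization: "Hausdorff_space (geom_realization K)"
  unfolding geom_realization_eq by (rule Hausdorff_space_subtopology[OF Hausdorff_space_fun])

text \<open>The vertex type may be uncountable, and then the ambient function space is not second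
  countable. Numbering the finitely many vertices maps the realization into
  \<open>nat \<Rightarrow> real\<close>; a continuous injection of a compact space into a Hausdorff
  space is a homeomorphism onto its image.\<close>

lemma second_countable_realization: "second_countable (geom_realization K)"
proof -
  obtain e where e: "bij_betw e {..<card (verts K)} (verts K)"
    using bij_betw_from_nat_into_finite[OF finite_verts] by blast
  define f where "f t = (\<lambda>n. if n < card (verts K) then t (e n) else 0)" for t :: "'v \<Rightarrow> real"
  have cont: "continuous_map (geom_realization K) (top_of_set (f ` realization K)) f"
  proof -
    have "continuous_on (realization K) f"
      unfolding f_def
    proof (rule continuous_on_coordinatewise_then_product)
      fix n
      show "continuous_on (realization K) (\<lambda>t. if n < card (verts K) then t (e n) else 0)"
        using continuous_on_coordinate[of _ "e n"] by (cases "n < card (verts K)") simp_all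
    qed
    then show ?thesis unfolding geom_realization_eq by simp
  qed
  have inj: "inj_on f (realization K)"
  proof (rule inj_onI, rule ext)
    fix t t' v assume t: "t \<in> realization K" "t' \<in> realization K" and eq: "f t = f t'"
    show "t v = t' v"
    proof (cases "v \<in> verts K")
      case True
      then obtain n where "n < card (verts K)" "e n = v" using e unfolding bij_betw_def by (metis imageE lessThan_iff)
      then show ?thesis using fun_cong[OF eq, of n] by (simp add: f_def)
    next
      case False
      have "{v. t v \<noteq> 0} \<subseteq> verts K" "{v. t' v \<noteq> 0} \<subseteq> verts K"
        using t simplices_verts unfolding realization_def by blast+
      then have "t v = 0" "t' v = 0" using False by blast+
      then show ?thesis by simp
    qed
  qed
  have "homeomorphic_map (geom_realization K) (top_of_set (f ` realization K)) f"
  proof (rule continuous_imp_homeomorphic_map[OF cont compact_space_realization])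
    show "Hausdorff_space (top_of_set (f ` realization K))"
      by (rule Hausdorff_space_subtopology) simp
    show "f ` topspace (geom_realization K) = topspace (top_of_set (f ` realization K))"
      by (simp add: geom_realization_eq)
    show "inj_on f (topspace (geom_realization K))"
      using inj by (simp add: geom_realization_eq)
  qed
  then have "geom_realization K homeomorphic_space top_of_set (f ` realization K)"
    by (rule homeomorphic_map_imp_homeomorphic_space)
  moreover have "second_countable (euclidean :: (nat \<Rightarrow> real) topology)"
  proof -
    obtain B :: "(nat \<Rightarrow> real) set set" where "countable B" "topological_basis B"
      using ex_countable_basis by blast
    then have B: "countable B" "\<forall>V \<in> B. openin euclidean V"
      "\<forall>U x. openin euclidean U \<and> x \<in> U \<longrightarrow> (\<exists>V \<in> B. x \<in> V \<and> V \<subseteq> U)"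
      using topological_basis_open topological_basisE by (simp, fastforce, metis open_openin)
    then show ?thesis unfolding second_countable_def by blast
  qed
  then have "second_countable (top_of_set (f ` realization K))" by (rule second_countable_subtopology)
  ultimately show ?thesis using homeomorphic_space_second_countability by blast
qed

end

context closed_surface
begin

text \<open>A point is joined by a segment to each vertex in its support, and the midpoint of an
  edge thereby connects the two ends of the edge.\<close>

lemma connected_realization: "connected (realization K)"
proof -
  let ?R = "realization K"
  define \<delta> where "\<delta> v = (\<lambda>w. if w = v then 1 else 0 :: real)" for v :: 'v
  have toward: "connected_component ?R t (\<delta> v)" if t: "t \<in> ?R" and v: "t v \<noteq> 0" for t v
  proof -
    define \<gamma> where "\<gamma> s = (\<lambda>w. (1 - s) * t w + s * \<delta> v w)" for s :: real
    have supp: "{v. t v \<noteq> 0} \<in> simplices2 K" using t by (simp add: realization_def)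
    have v': "v \<in> verts K" using simplices_verts[OF supp] v by blast
    have "\<gamma> s \<in> ?R" if s: "s \<in> {0..1}" for s
    proof (rule realizationI[OF supp])
      show "\<gamma> s w \<ge> 0" for w
        using s t unfolding \<gamma>_def \<delta>_def realization_def by auto
      show "\<gamma> s w = 0" if "w \<notin> {v. t v \<noteq> 0}" for w
        using that v unfolding \<gamma>_def \<delta>_def by auto
      have "(\<Sum>w\<in>verts K. \<delta> v w) = 1" unfolding \<delta>_def using v' finite_verts by simp
      moreover have "(\<Sum>w\<in>verts K. t w) = 1" using t by (simp add: realization_def)
      ultimately show "(\<Sum>w\<in>verts K. \<gamma> s w) = 1"
        unfolding \<gamma>_def by (simp add: sum.distrib flip: sum_distrib_left)
    qed
    moreover have "connected (\<gamma> ` {0..1})"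
    proof (rule connected_continuous_image)
      show "continuous_on {0..1} \<gamma>"
        unfolding \<gamma>_def by (intro continuous_on_coordinatewise_then_product continuous_intros)
    qed simp
    moreover have "\<gamma> 0 = t" "\<gamma> 1 = \<delta> v" by (simp_all add: \<gamma>_def)
    then have "t \<in> \<gamma> ` {0..1}" "\<delta> v \<in> \<gamma> ` {0..1}" by (metis atLeastAtMost_iff image_eqI le_numeral_extra(3,4) zero_le_one)+
    ultimately show ?thesis unfolding connected_component_def by blast
  qed
  have \<delta>_in: "\<delta> v \<in> ?R" if "v \<in> verts K" for v
    by (rule realizationI[of "{v}"]) (use that finite_verts in \<open>auto simp: \<delta>_def simplices2_def\<close>)
  have step: "connected_component ?R (\<delta> a) (\<delta> b)" if e: "{a, b} \<in> edges K" for a b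
  proof -
    have ab: "a \<noteq> b" "a \<in> verts K" "b \<in> verts K" using edge_verts[OF e] by auto
    define t where "t w = (\<delta> a w + \<delta> b w) / 2" for w
    have "(\<Sum>w\<in>verts K. \<delta> a w + \<delta> b w) = 2"
      unfolding sum.distrib \<delta>_def using ab finite_verts by simp
    then have "(\<Sum>w\<in>verts K. t w) = 1" unfolding t_def by (simp flip: sum_divide_distrib)
    then have "t \<in> ?R"
      by (intro realizationI[of "{a, b}"]) (use e in \<open>auto simp: t_def \<delta>_def simplices2_def\<close>)
    moreover have "t a \<noteq> 0" "t b \<noteq> 0" unfolding t_def \<delta>_def by simp_all
    ultimately have "connected_component ?R t (\<delta> a)" "connected_component ?R t (\<delta> b)"
      using toward by blast+
    then show ?thesis by (metis connected_component_sym connected_component_trans)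
  qed
  have verts: "connected_component ?R (\<delta> a) (\<delta> b)" if ab: "a \<in> verts K" "b \<in> verts K" for a b
    using connected[OF ab]
  proof (induction rule: rtrancl_induct)
    case base
    then show ?case using \<delta>_in[OF ab(1)] by simp
  next
    case (step y z)
    then have "connected_component ?R (\<delta> y) (\<delta> z)" using \<open>\<And>b a. {a, b} \<in> edges K \<Longrightarrow> connected_component ?R (\<delta> a) (\<delta> b)\<close> by simp
    then show ?case using step(3) connected_component_trans by blast
  qed
  have "\<exists>v \<in> verts K. connected_component ?R t (\<delta> v)" if t: "t \<in> ?R" for t
  proof -
    have supp: "{v. t v \<noteq> 0} \<in> simplices2 K" using t by (simp add: realization_def)
    then obtain v where "t v \<noteq> 0" using simplices_nonempty by blast
    then show ?thesis using toward[OF t] simplices_verts[OF supp] by blast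
  qed
  then show ?thesis
    unfolding connected_iff_connected_component
    using verts connected_component_sym connected_component_trans by metis
qed

text \<open>The map \<open>g\<close> takes the closed unit disc into the realization and the open
  disc onto the open star: \<open>v\<close> is the image of the centre, the coordinate at
  \<open>v\<close> is \<open>1 - cmod z\<close>, and the \<open>j\<close>-th neighbour lies in the
  \<open>j\<close>-th direction. As the open disc is homeomorphic to the plane, \<open>W\<close> can
  be all of it.\<close>

lemma open_star:
  assumes v: "v \<in> verts K"
  shows "\<exists>U (W :: (real ^ 2) set). openin (geom_realization K) U \<and> {t \<in> realization K. t v > 0} \<subseteq> U \<and>
    open W \<and> subtopology (geom_realization K) U homeomorphic_space top_of_set W"
proof -
  obtain u0 where u0: "u0 \<in> nbrs K v" using nonisolated[OF v] by blast
  define u where "u i = (nxt K v ^^ i) u0" for i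
  obtain m where m: "m \<ge> 3" "u m = u0" "inj_on u {..<m}" "range u = u ` {..<m}"
    using link_cycle[OF u0] unfolding u_def by (metis (no_types))
  have nb: "u i \<in> nbrs K v" for i unfolding u_def using nxt_funpow_nbrs[OF u0] .
  have ui: "\<exists>i<m. w = u i" if w: "w \<in> nbrs K v" for w
  proof -
    obtain i where "w = u i" using single_link[OF u0 w] unfolding u_def by blast
    then have "w \<in> u ` {..<m}" using m(4) by blast
    then show ?thesis by blast
  qed
  have umod: "u (Suc i mod m) = u (Suc i)" for i
    using funpow_mod_eq[of m "nxt K v" u0 "Suc i"] m(2) unfolding u_def by simp
  have tri: "(v, u i, u (Suc i)) \<in> rot K" for i
    using nxt_rot[OF nb[of i]] by (simp add: u_def)
  have nv: "u i \<noteq> v" for i using rot_edges(1)[OF tri[of i]] by simp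
  have u_eq: "u i = u j \<longleftrightarrow> i = j" if "i < m" "j < m" for i j
    using m(3) that by (auto simp: inj_on_def)
  have sig: "{v, u i, u (Suc i)} \<in> simplices2 K" for i
    using rot_tri[OF tri[of i]] unfolding simplices2_def by (metis UnI2 imageI)
  \<comment> \<open>All neighbours lie on one cycle, so every simplex at \<open>v\<close> is a face
    of one of the \<open>m\<close> triangles about \<open>v\<close>.\<close>
  have sig_ex: "\<exists>i<m. \<sigma> \<subseteq> {v, u i, u (Suc i)}" if \<sigma>: "\<sigma> \<in> simplices2 K" "v \<in> \<sigma>" for \<sigma>
  proof -
    consider "\<sigma> = {v}" | "\<sigma> \<in> edges K" | t where "t \<in> tris K" "\<sigma> = tri_set t"
      using \<sigma> unfolding simplices2_def by blast
    then show ?thesis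
    proof cases
      case 1
      then show ?thesis using m(1) by (intro exI[of _ 0]) auto
    next
      case 2
      then obtain a b where "\<sigma> = {a, b}" "a \<noteq> b" by (rule edge_cases)
      then obtain w where "\<sigma> = {v, w}" using \<sigma>(2) by blast
      moreover obtain i where "i < m" "w = u i" using ui[of w] 2 calculation unfolding nbrs_def by blast
      ultimately show ?thesis by blast
    next
      case 3
      obtain a b c where t: "t = (a, b, c)" by (cases t)
      have r: "(a, b, c) \<in> rot K" using 3(1) unfolding t by (rule tris_rot)
      have s: "\<sigma> = {a, b, c}" using 3(2) t by (simp add: tri_set_def)
      have "\<exists>p q. (v, p, q) \<in> rot K \<and> \<sigma> = {v, p, q}"
      proof -
        consider "v = a" | "v = b" | "v = c" using \<sigma>(2) s by blast
        then show ?thesis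
        proof cases
          case 1
          then show ?thesis using r s by blast
        next
          case 2
          then have "(v, c, a) \<in> rot K" "\<sigma> = {v, c, a}" using rot_cyc[OF r] s by auto
          then show ?thesis by blast
        next
          case 3
          then have "(v, a, b) \<in> rot K" "\<sigma> = {v, a, b}" using rot_cyc[OF rot_cyc[OF r]] s by auto
          then show ?thesis by blast
        qed
      qed
      then obtain p q where pq: "(v, p, q) \<in> rot K" "\<sigma> = {v, p, q}" by blast
      have "p \<in> nbrs K v" using rot_edges(4)[OF pq(1)] by (simp add: nbrs_def)
      then obtain i where i: "i < m" "p = u i" using ui by blast
      have "q = u (Suc i)" using rot_unique[OF pq(1)] tri[of i] i by simp
      then show ?thesis using pq i by blast
    qed
  qed
  define g where "g z = (\<lambda>w. if w = v then 1 - cmod z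
    else if w \<in> u ` {..<m} then hat m (the_inv_into {..<m} u w) z else 0)" for z
  have gv: "g z v = 1 - cmod z" for z by (simp add: g_def)
  have gu: "g z (u j) = hat m j z" if "j < m" for z j
    using that nv the_inv_into_f_f[OF m(3), of j] by (auto simp: g_def)
  have go: "g z w = 0" if "w \<noteq> v" "w \<notin> u ` {..<m}" for z w
    using that by (simp add: g_def)
  have g_rcis: "g (rcis r (2 * pi * (real i + s) / real m)) =
      (\<lambda>w. if w = v then 1 - r else if w = u i then r * (1 - s) else if w = u (Suc i) then r * s else 0)"
    if i: "i < m" and s: "0 \<le> s" "s < 1" and r: "0 \<le> r" for i s r
  proof
    fix w
    let ?z = "rcis r (2 * pi * (real i + s) / real m)"
    have si: "Suc i mod m < m" using m(1) by simp
    consider "w = v" | j where "j < m" "w = u j" | "w \<noteq> v" "w \<notin> u ` {..<m}" by blast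
    then show "g ?z w =
      (if w = v then 1 - r else if w = u i then r * (1 - s) else if w = u (Suc i) then r * s else 0)"
    proof cases
      case 1
      then show ?thesis using gv[of ?z] r by simp
    next
      case 2
      have "w = u i \<longleftrightarrow> j = i" "w = u (Suc i) \<longleftrightarrow> j = Suc i mod m"
        using u_eq[OF 2(1) i] u_eq[OF 2(1) si] umod 2(2) by simp_all
      then show ?thesis using gu[OF 2(1), of ?z] hat_rcis[OF m(1) i 2(1) s r] nv 2(2) by simp
    next
      case 3
      have "u (Suc i) \<in> u ` {..<m}" using si umod[of i] by (metis imageI lessThan_iff)
      then have "w \<noteq> u i" "w \<noteq> u (Suc i)" using i 3 by auto
      then show ?thesis using go[OF 3] 3(1) by simp
    qed
  qed
  have cont: "continuous_on S g" for S
    unfolding g_def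
  proof (rule continuous_on_coordinatewise_then_product)
    fix w
    have "continuous_on S (\<lambda>z. 1 - cmod z)" by (intro continuous_intros)
    moreover have "continuous_on S (\<lambda>z. hat m (the_inv_into {..<m} u w) z)"
      using continuous_on_subset[OF continuous_hat] by simp
    ultimately show "continuous_on S (\<lambda>z. if w = v then 1 - cmod z
      else if w \<in> u ` {..<m} then hat m (the_inv_into {..<m} u w) z else 0)"
      by (cases "w = v"; cases "w \<in> u ` {..<m}") simp_all
  qed
  have inj: "inj_on g S" for S
  proof (rule inj_onI)
    fix z z' assume eq: "g z = g z'"
    show "z = z'"
    proof (rule hat_inject[OF m(1)])
      show "cmod z = cmod z'" using fun_cong[OF eq, of v] by (simp add: gv)
      show "hat m j z = hat m j z'" if "j < m" for j
        using fun_cong[OF eq, of "u j"] gu[OF that] by simp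
    qed
  qed
  have sub: "v \<in> verts K" "u i \<in> verts K" for i using rot_edges(7,8)[OF tri[of i]] by auto
  have mem: "g z \<in> realization K" if z: "cmod z \<le> 1" for z
  proof -
    obtain i s where q: "i < m" "0 \<le> s" "s < 1" "z = rcis (cmod z) (2 * pi * (real i + s) / real m)"
      using sector_exists[OF m(1)] .
    have gz: "g z = (\<lambda>w. if w = v then 1 - cmod z else if w = u i then cmod z * (1 - s)
        else if w = u (Suc i) then cmod z * s else 0)"
      using g_rcis[OF q(1-3) norm_ge_zero[of z]] q(4) by simp
    have d: "u i \<noteq> u (Suc i)" using rot_edges(2)[OF tri[of i]] .
    show ?thesis
    proof (rule realizationI[OF sig[of i]])
      show "g z w \<ge> 0" for w unfolding gz using z q by simp
      show "g z w = 0" if "w \<notin> {v, u i, u (Suc i)}" for w unfolding gz using that by simp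
      have "(\<Sum>w\<in>verts K. g z w) = (\<Sum>w\<in>{v, u i, u (Suc i)}. g z w)"
        by (rule sum.mono_neutral_right) (use finite_verts sub gz in auto)
      also have "\<dots> = 1" using d nv[of i] nv[of "Suc i"] nv[of i, symmetric] nv[of "Suc i", symmetric]
        unfolding gz by (simp add: algebra_simps)
      finally show "(\<Sum>w\<in>verts K. g z w) = 1" .
    qed
  qed
  define U where "U = {t \<in> realization K. t v > 0}"
  have img: "g ` ball 0 1 = U"
  proof (intro equalityI subsetI)
    fix t assume "t \<in> g ` ball 0 1"
    then show "t \<in> U" using mem gv unfolding U_def by auto
  next
    fix t assume tU: "t \<in> U"
    then have t: "\<And>w. t w \<ge> 0" "{v. t v \<noteq> 0} \<in> simplices2 K" "(\<Sum>w \<in> verts K. t w) = 1" "t v > 0"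
      unfolding U_def realization_def by auto
    obtain i where i: "i < m" "{v. t v \<noteq> 0} \<subseteq> {v, u i, u (Suc i)}" using sig_ex[OF t(2)] t(4) by auto
    have d: "u i \<noteq> u (Suc i)" using rot_edges(2)[OF tri[of i]] .
    have "1 = (\<Sum>w\<in>{v, u i, u (Suc i)}. t w)"
      unfolding t(3)[symmetric] by (rule sum.mono_neutral_right) (use finite_verts sub i in auto)
    also have "\<dots> = t v + t (u i) + t (u (Suc i))"
      using d nv[of i, symmetric] nv[of "Suc i", symmetric] by simp
    finally have sum: "t v = 1 - (t (u i) + t (u (Suc i)))" by simp
    have t0: "t w = 0" if "w \<noteq> v" "w \<noteq> u i" "w \<noteq> u (Suc i)" for w using i(2) that by blast
    define r where "r = t (u i) + t (u (Suc i))"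
    have r: "0 \<le> r" "r < 1" using t(1,4) sum unfolding r_def by (auto simp: add_nonneg_nonneg)
    have tw: "t w = (if w = v then 1 - r else if w = u i then t (u i)
        else if w = u (Suc i) then t (u (Suc i)) else 0)" for w
      using t0[of w] sum unfolding r_def by simp
    show "t \<in> g ` ball 0 1"
    proof (cases "t (u i) = 0")
      \<comment> \<open>With no weight at \<open>u i\<close> the fraction \<open>s\<close> would be
        1, or 0/0 at the centre; the point is taken as the start of the next sector instead.\<close>
      case True
      let ?i = "Suc i mod m"
      have i': "?i < m" using m(1) by simp
      have "g (rcis r (2 * pi * (real ?i + 0) / real m)) = t"
      proof (subst g_rcis[OF i' _ _ r(1)])
        show "(\<lambda>w. if w = v then 1 - r else if w = u ?i then r * (1 - 0)
          else if w = u (Suc ?i) then r * 0 else 0) = t"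
        proof (rule ext, unfold umod)
          fix w
          have "r = t (u (Suc i))" using True r_def by simp
          then show "(if w = v then 1 - r else if w = u (Suc i) then r * (1 - 0)
            else if w = u (Suc ?i) then r * 0 else 0) = t w"
            using tw[of w] True d by (simp split: if_splits)
        qed
      qed simp_all
      moreover have "rcis r (2 * pi * (real ?i + 0) / real m) \<in> ball 0 1" using r by simp
      ultimately show ?thesis by (metis imageI)
    next
      case False
      then have pos: "t (u i) > 0" using t(1)[of "u i"] by simp
      then have r0: "r > 0" using t(1)[of "u (Suc i)"] unfolding r_def by linarith
      define s where "s = t (u (Suc i)) / r"
      have s: "0 \<le> s" "s < 1" using r0 t(1) pos unfolding s_def r_def by auto
      have rs: "r * s = t (u (Suc i))" "r * (1 - s) = t (u i)"
        using r0 unfolding s_def right_diff_distrib by (simp_all add: r_def)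
      have "g (rcis r (2 * pi * (real i + s) / real m)) = t"
        unfolding g_rcis[OF i(1) s r(1)] rs by (rule ext) (rule tw[symmetric])
      moreover have "rcis r (2 * pi * (real i + s) / real m) \<in> ball 0 1" using r by simp
      ultimately show ?thesis by (metis imageI)
    qed
  qed
  \<comment> \<open>Compactness of the closed disc makes the inverse continuous; the statement about
    the open disc follows by restriction.\<close>
  have hom: "homeomorphic_map (top_of_set (cball 0 1)) (top_of_set (g ` cball 0 1)) g"
  proof (rule continuous_imp_homeomorphic_map)
    show "continuous_map (top_of_set (cball 0 1)) (top_of_set (g ` cball 0 1)) g"
      using cont by simp
    show "compact_space (top_of_set (cball 0 1 :: complex set))"
      by (rule compact_space_subtopology) simp
    show "Hausdorff_space (top_of_set (g ` cball 0 1))"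
      by (rule Hausdorff_space_subtopology[OF Hausdorff_space_fun])
  qed (use inj in simp_all)
  have "homeomorphic_map (subtopology (top_of_set (cball 0 1)) (ball 0 1))
     (subtopology (top_of_set (g ` cball 0 1)) (g ` ball 0 1)) g"
  proof (rule homeomorphic_map_subtopologies[OF hom])
    show "g ` (topspace (top_of_set (cball 0 1)) \<inter> ball 0 1) =
      topspace (top_of_set (g ` cball 0 1)) \<inter> g ` ball 0 1"
      using ball_subset_cball[of "0::complex" 1] by (auto simp: inf_absorb2)
  qed
  moreover have "cball (0::complex) 1 \<inter> ball 0 1 = ball 0 1" "g ` cball 0 1 \<inter> g ` ball 0 1 = g ` ball 0 1"
    using ball_subset_cball[of "0::complex" 1] by blast+
  ultimately have "homeomorphic_map (top_of_set (ball 0 1)) (top_of_set U) g"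
    by (simp add: subtopology_subtopology img)
  then have "top_of_set U homeomorphic_space top_of_set (ball (0::complex) 1)"
    using homeomorphic_map_imp_homeomorphic_space homeomorphic_space_sym by blast
  moreover have "ball (0::complex) 1 homeomorphic (UNIV :: (real ^ 2) set)"
  proof -
    have "(UNIV :: complex set) homeomorphic (UNIV :: (real ^ 2) set)"
      by (simp add: homeomorphic_UNIV_UNIV)
    then show ?thesis using homeomorphic_ball01_UNIV homeomorphic_trans by blast
  qed
  ultimately have "top_of_set U homeomorphic_space top_of_set (UNIV :: (real ^ 2) set)"
    using homeomorphic_space_top_of_set homeomorphic_space_trans by blast
  moreover have "subtopology (geom_realization K) U = top_of_set U"
    unfolding geom_realization_eq subtopology_subtopology U_def by (simp add: inf_absorb2)
  moreover have "openin (geom_realization K) U"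
  proof -
    have "open {t :: 'v \<Rightarrow> real. t v > 0}"
      by (intro open_Collect_less continuous_on_const continuous_on_coordinate)
    moreover have "U = realization K \<inter> {t. t v > 0}" unfolding U_def by blast
    ultimately show ?thesis unfolding geom_realization_eq by (simp add: openin_open_Int)
  qed
  ultimately show ?thesis unfolding U_def[symmetric] by (metis open_UNIV order_refl)
qed

theorem compact_connected_oriented_surface: "compact_connected_oriented_surface K"
proof -
  have "connected_space (geom_realization K)"
    unfolding geom_realization_eq by (rule connected_space_subtopology) (simp add: connected_realization)
  moreover have "two_manifold (geom_realization K)"
    unfolding two_manifold_def
  proof (intro conjI ballI Hausdorff_space_realization second_countable_realization)
    fix t assume "t \<in> topspace (geom_realization K)"
    then have t: "t \<in> realization K" by (simp add: geom_realization_eq)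
    then have supp: "{v. t v \<noteq> 0} \<in> simplices2 K" "\<And>v. t v \<ge> 0" by (auto simp: realization_def)
    then obtain v where v: "t v \<noteq> 0" using simplices_nonempty by blast
    then have "v \<in> verts K" using simplices_verts[OF supp(1)] by blast
    moreover have "t \<in> {t \<in> realization K. t v > 0}" using t v supp(2)[of v] by simp
    ultimately show "\<exists>U (W :: (real ^ 2) set). openin (geom_realization K) U \<and> t \<in> U \<and> open W \<and>
      subtopology (geom_realization K) U homeomorphic_space top_of_set W"
      using open_star by (meson subsetD)
  qed
  ultimately show ?thesis
    unfolding compact_connected_oriented_surface_def using wf coh compact_space_realization by blast
qed

end

section \<open>Euler characteristic and genus\<close>

subsection \<open>Parity\<close>

lemma card_fibres:
  assumes "finite A" "finite B" "\<And>a. a \<in> A \<Longrightarrow> f a \<in> B" "\<And>b. b \<in> B \<Longrightarrow> card {a \<in> A. f a = b} = k"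
  shows "card A = k * card B"
proof -
  have "(\<Sum>b\<in>B. \<Sum>a\<in>{a \<in> A. f a = b}. 1) = (\<Sum>a\<in>A. 1 :: nat)"
    by (rule sum.group) (use assms in auto)
  then have "(\<Sum>b\<in>B. card {a \<in> A. f a = b}) = card A" by simp
  moreover have "(\<Sum>b\<in>B. card {a \<in> A. f a = b}) = (\<Sum>b\<in>B. k)"
    using assms(4) by (intro sum.cong) auto
  ultimately show ?thesis by (simp add: mult.commute)
qed

lemma evenperm_cycle_of_list:
  assumes "distinct (x # xs)"
  shows "evenperm (cycle_of_list (x # xs)) \<longleftrightarrow> even (length xs)"
  using assms
proof (induction xs arbitrary: x)
  case Nil
  then show ?case by (simp add: id_def)
next
  case (Cons y ys)
  have "evenperm (Transposition.transpose x y \<circ> cycle_of_list (y # ys)) \<longleftrightarrow>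
      evenperm (Transposition.transpose x y) = evenperm (cycle_of_list (y # ys))"
    by (rule evenperm_comp[OF permutation_swap_id permutation_of_cycle])
  moreover have "evenperm (Transposition.transpose x y) \<longleftrightarrow> False" using Cons.prems by (simp add: evenperm_swap)
  moreover have "evenperm (cycle_of_list (y # ys)) \<longleftrightarrow> even (length ys)"
    using Cons.IH Cons.prems by simp
  ultimately show ?case by (simp only: cycle_of_list.simps length_Cons even_Suc) blast
qed

text \<open>The fibres of \<open>\<kappa>\<close> are the cycles of the permutation, fixed points included.\<close>

lemma evenperm_iff_even_cycles:
  assumes p: "p permutes S" and fin: "finite S"
    and inv: "\<And>x. x \<in> S \<Longrightarrow> \<kappa> (p x) = \<kappa> x"
    and trans: "\<And>x y. x \<in> S \<Longrightarrow> y \<in> S \<Longrightarrow> \<kappa> x = \<kappa> y \<Longrightarrow> \<exists>i. y = (p ^^ i) x"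
  shows "evenperm p \<longleftrightarrow> even (card S + card (\<kappa> ` S))"
proof -
  have "cycle_decomp S p" by (rule cycle_decomposition[OF p fin])
  \<comment> \<open>The conditions on \<open>\<kappa>\<close> belong to the induction statement, as
    they have to be restricted to the smaller set. Splitting off a cycle of length \<open>l\<close>
    removes \<open>l\<close> points and one fibre, and a cycle of length \<open>l\<close> has the
    parity of \<open>l - 1\<close>.\<close>
  then have "finite S \<and> p permutes S \<and> ((\<forall>x\<in>S. \<kappa> (p x) = \<kappa> x) \<and>
      (\<forall>x\<in>S. \<forall>y\<in>S. \<kappa> x = \<kappa> y \<longrightarrow> (\<exists>i. y = (p ^^ i) x)) \<longrightarrow>
      (evenperm p \<longleftrightarrow> even (card S + card (\<kappa> ` S))))"
  proof induction
    case empty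
    then show ?case by (auto simp: fun_eq_iff)
  next
    case (comp I p cs)
    let ?c = "cycle_of_list cs" and ?q = "cycle_of_list cs \<circ> p"
    have fin: "finite I" and p: "p permutes I" using comp.IH by blast+
    have c: "?c permutes set cs" by (rule cycle_permutes)
    have q: "?q permutes (set cs \<union> I)"
      by (rule permutes_compose) (use permutes_subset[OF p] permutes_subset[OF c] in auto)
    show ?case
    proof (intro conjI impI; (elim conjE)?)
      show "finite (set cs \<union> I)" using fin by simp
      show "?q permutes (set cs \<union> I)" by (rule q)
      assume inv: "\<forall>x\<in>set cs \<union> I. \<kappa> (?q x) = \<kappa> x"
        and trans: "\<forall>x\<in>set cs \<union> I. \<forall>y\<in>set cs \<union> I. \<kappa> x = \<kappa> y \<longrightarrow> (\<exists>i. y = (?q ^^ i) x)"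
      have qI: "?q x = p x" "p x \<in> I" if "x \<in> I" for x
      proof -
        show "p x \<in> I" using permutes_in_image[OF p] that by simp
        then have "p x \<notin> set cs" using comp.hyps(3) by blast
        then show "?q x = p x" using id_outside_supp by simp
      qed
      have qiI: "(?q ^^ i) x = (p ^^ i) x \<and> (?q ^^ i) x \<in> I" if "x \<in> I" for x i
      proof (induction i)
        case 0
        show ?case using that by simp
      next
        case (Suc i)
        have "(?q ^^ Suc i) x = ?q ((?q ^^ i) x)" "(p ^^ Suc i) x = p ((p ^^ i) x)"
          by (simp_all only: funpow.simps comp_apply)
        then show ?case using Suc qI[of "(p ^^ i) x"] by metis
      qed
      have qc: "?q x = ?c x" "?c x \<in> set cs" if "x \<in> set cs" for x
      proof -
        have "x \<notin> I" using that comp.hyps(3) by blast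
        then show "?q x = ?c x" using permutes_not_in[OF p] by simp
        show "?c x \<in> set cs" using permutes_in_image[OF c] that by simp
      qed
      have "\<forall>x\<in>I. \<kappa> (p x) = \<kappa> x" using inv qI by (metis UnCI)
      moreover have "\<forall>x\<in>I. \<forall>y\<in>I. \<kappa> x = \<kappa> y \<longrightarrow> (\<exists>i. y = (p ^^ i) x)"
      proof (intro ballI impI)
        fix x y assume xy: "x \<in> I" "y \<in> I" "\<kappa> x = \<kappa> y"
        then obtain i where "y = (?q ^^ i) x" using trans by blast
        then show "\<exists>i. y = (p ^^ i) x" using qiI[OF xy(1)] by metis
      qed
      ultimately have IH: "evenperm p \<longleftrightarrow> even (card I + card (\<kappa> ` I))" using comp.IH by blast
      show "evenperm ?q \<longleftrightarrow> even (card (set cs \<union> I) + card (\<kappa> ` (set cs \<union> I)))"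
      proof (cases cs)
        case Nil
        then show ?thesis using IH by simp
      next
        case (Cons x xs)
        have x: "x \<in> set cs" using Cons by simp
        have dist: "distinct (x # xs)" using comp.hyps(2) Cons by simp
        have \<kappa>c: "\<kappa> ((?c ^^ i) x) = \<kappa> x \<and> (?c ^^ i) x \<in> set cs" for i
        proof (induction i)
          case (Suc i)
          then show ?case using qc[of "(?c ^^ i) x"] inv by (metis UnI1 comp_apply funpow.simps(2))
        qed (use x in simp)
        have "\<kappa> y = \<kappa> x" if y: "y \<in> set cs" for y
        proof -
          obtain n where n: "n < length cs" "y = cs ! n" using y by (metis in_set_conv_nth)
          have "(?c ^^ n) (cs ! 0) = rotate n cs ! 0"
            using cyclic_rotation[OF comp.hyps(2), of n] n(1) by (metis length_map length_rotate less_nat_zero_code linorder_neqE_nat nth_map)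
          also have "\<dots> = y" using n nth_rotate[of 0 cs n] by (cases cs) auto
          finally show ?thesis using \<kappa>c[of n] Cons by simp
        qed
        then have im: "\<kappa> ` set cs = {\<kappa> x}" using x by blast
        have "\<kappa> x \<notin> \<kappa> ` I"
        proof
          assume "\<kappa> x \<in> \<kappa> ` I"
          then obtain z where z: "z \<in> I" "\<kappa> z = \<kappa> x" by auto
          then obtain i where "x = (?q ^^ i) z" using trans x by (metis UnCI)
          then have "x \<in> I" using qiI[OF z(1), of i] by metis
          then show False using x comp.hyps(3) by blast
        qed
        then have "card (\<kappa> ` (set cs \<union> I)) = Suc (card (\<kappa> ` I))"
          unfolding image_Un im using fin by simp
        moreover have "card (set cs \<union> I) = Suc (length xs) + card I"
          using card_Un_disjoint[OF _ fin comp.hyps(3)] distinct_card[OF dist] Cons by simp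
        moreover have "evenperm ?q \<longleftrightarrow> evenperm ?c = evenperm p"
          using evenperm_comp[OF permutation_of_cycle] p fin permutation_permutes by blast
        moreover have "evenperm ?c \<longleftrightarrow> even (length xs)" unfolding Cons by (rule evenperm_cycle_of_list[OF dist])
        ultimately show ?thesis using IH by simp blast
      qed
    qed
  qed
  then show ?thesis using inv trans by blast
qed

section \<open>Counting directed edges\<close>

context oriented_complex
begin

definition darts :: "('v \<times> 'v) set" where
  "darts = {(a, b). b \<in> nbrs K a}"

lemma finite_darts: "finite darts"
  by (rule finite_subset[of _ "verts K \<times> verts K"])
    (use finite_verts in \<open>auto simp: darts_def nbrs_def dest: edge_verts\<close>)

lemma card_darts_edges: "card darts = 2 * card (edges K)"
proof (rule card_fibres[where f = "\<lambda>(a, b). {a, b}"])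
  fix e assume e: "e \<in> edges K"
  then obtain a b where ab: "e = {a, b}" "a \<noteq> b" by (rule edge_cases)
  have "{d \<in> darts. (case d of (a, b) \<Rightarrow> {a, b}) = e} = {(a, b), (b, a)}"
    using e ab by (auto simp: darts_def nbrs_def doubleton_eq_iff insert_commute)
  then show "card {d \<in> darts. (case d of (a, b) \<Rightarrow> {a, b}) = e} = 2" using ab(2) by simp
qed (use finite_darts finite_edges in \<open>auto simp: darts_def nbrs_def\<close>)

lemma card_darts_rot: "card darts = card (rot K)"
proof -
  have "bij_betw (\<lambda>(a, b, c). (a, b)) (rot K) darts"
  proof (rule bij_betw_imageI)
    show "inj_on (\<lambda>(a, b, c). (a, b)) (rot K)"
      using rot_unique by (auto simp: inj_on_def)
    show "(\<lambda>(a, b, c). (a, b)) ` rot K = darts"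
    proof (intro equalityI subsetI)
      fix d assume "d \<in> (\<lambda>(a, b, c). (a, b)) ` rot K"
      then show "d \<in> darts" using rot_edges(4) by (auto simp: darts_def nbrs_def)
    next
      fix d assume "d \<in> darts"
      then obtain a b where ab: "d = (a, b)" "b \<in> nbrs K a" by (auto simp: darts_def)
      show "d \<in> (\<lambda>(a, b, c). (a, b)) ` rot K"
        unfolding ab(1) using nxt_rot[OF ab(2)] by force
    qed
  qed
  then show ?thesis by (rule bij_betw_same_card[symmetric])
qed

lemma tris_not_rotated:
  assumes "(a, b, c) \<in> tris K"
  shows "(b, c, a) \<notin> tris K" "(c, a, b) \<notin> tris K"
proof -
  have inj: "inj_on tri_set (tris K)" using coh by (simp add: coherently_oriented_def)
  have ne: "a \<noteq> b" "a \<noteq> c" using rot_edges(1,3)[OF tris_rot[OF assms]] by auto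
  have "tri_set (a, b, c) = tri_set (b, c, a)" "tri_set (a, b, c) = tri_set (c, a, b)"
    by (auto simp: tri_set_def)
  then show "(b, c, a) \<notin> tris K" "(c, a, b) \<notin> tris K"
    using inj_onD[OF inj _ assms] inj_onD[OF inj _ assms] ne by (metis prod.inject)+
qed

text \<open>The three rotated copies of \<open>tris K\<close> are disjoint, since injectivity of
  \<open>tri_set\<close> admits only one listed order per triangle.\<close>

lemma card_rot: "card (rot K) = 3 * card (tris K)"
proof -
  let ?f = "\<lambda>(a :: 'v, b :: 'v, c :: 'v). (b, c, a)" and ?g = "\<lambda>(a :: 'v, b :: 'v, c :: 'v). (c, a, b)"
  have im: "(p, q, r) \<in> ?f ` tris K \<longleftrightarrow> (r, p, q) \<in> tris K"
    "(p, q, r) \<in> ?g ` tris K \<longleftrightarrow> (q, r, p) \<in> tris K" for p q r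
    by (force simp: image_iff)+
  have "rot K = tris K \<union> (?f ` tris K \<union> ?g ` tris K)"
    unfolding set_eq_iff
  proof
    fix t :: "'v \<times> 'v \<times> 'v"
    obtain p q r where t: "t = (p, q, r)" by (cases t)
    show "t \<in> rot K \<longleftrightarrow> t \<in> tris K \<union> (?f ` tris K \<union> ?g ` tris K)"
      unfolding t Un_iff im rot_def by blast
  qed
  moreover have "tris K \<inter> (?f ` tris K \<union> ?g ` tris K) = {}" "?f ` tris K \<inter> ?g ` tris K = {}"
  proof -
    have "\<not> (t \<in> tris K \<and> (t \<in> ?f ` tris K \<or> t \<in> ?g ` tris K))"
      "\<not> (t \<in> ?f ` tris K \<and> t \<in> ?g ` tris K)" for t :: "'v \<times> 'v \<times> 'v"
    proof -
      obtain p q r where t: "t = (p, q, r)" by (cases t)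
      show "\<not> (t \<in> tris K \<and> (t \<in> ?f ` tris K \<or> t \<in> ?g ` tris K))"
        "\<not> (t \<in> ?f ` tris K \<and> t \<in> ?g ` tris K)"
        unfolding t im using tris_not_rotated by metis+
    qed
    then show "tris K \<inter> (?f ` tris K \<union> ?g ` tris K) = {}" "?f ` tris K \<inter> ?g ` tris K = {}"
      by blast+
  qed
  moreover have "card (?f ` tris K) = card (tris K)" "card (?g ` tris K) = card (tris K)"
    by (rule card_image, simp add: inj_on_def split: prod.splits)+
  ultimately show ?thesis using finite_tris by (simp add: card_Un_disjoint)
qed

lemma three_tris_two_edges: "3 * card (tris K) = 2 * card (edges K)"
  using card_rot card_darts_rot card_darts_edges by simp

end

lemma permutes_restrict:
  assumes "finite S" "inj_on f S" "f ` S \<subseteq> S"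
  shows "(\<lambda>x. if x \<in> S then f x else x) permutes S"
proof (rule bij_imp_permutes)
  have "bij_betw f S S"
    unfolding bij_betw_def using assms endo_inj_surj by blast
  then show "bij_betw (\<lambda>x. if x \<in> S then f x else x) S S"
    by (rule bij_betw_cong[THEN iffD1, rotated]) simp
qed simp

context oriented_surface
begin

text \<open>The vertices are the cycles of the permutation \<open>(a, b) \<mapsto> (a, nxt K a b)\<close> of the darts and
  the edges are the cycles of the reversal \<open>(a, b) \<mapsto> (b, a)\<close>; the former is the latter
  composed with the square of \<open>(a, b) \<mapsto> (b, nxt K a b)\<close>.\<close>

lemma even_verts_edges: "even (card (verts K) + card (edges K))"
proof -
  let ?D = darts
  define \<sigma> where "\<sigma> d = (if d \<in> ?D then (fst d, nxt K (fst d) (snd d)) else d)" for d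
  define \<alpha> where "\<alpha> d = (if d \<in> ?D then (snd d, fst d) else d)" for d
  define \<phi> where "\<phi> d = (if d \<in> ?D then (snd d, nxt K (fst d) (snd d)) else d)" for d
  have D: "(a, b) \<in> ?D \<longleftrightarrow> b \<in> nbrs K a" for a b by (simp add: darts_def)
  have rD: "(a, b) \<in> ?D" "(b, c) \<in> ?D" "(c, a) \<in> ?D" "(a, c) \<in> ?D" if "(a, b, c) \<in> rot K" for a b c
    using rot_edges(4-6)[OF that] unfolding D nbrs_def by (auto simp: insert_commute)
  have r: "\<sigma> (a, b) = (a, c)" "\<phi> (a, b) = (b, c)" if "(a, b, c) \<in> rot K" for a b c
    using rD[OF that] nxt_eq[OF that] by (simp_all add: \<sigma>_def \<phi>_def)
  have dart: "\<exists>a b c. d = (a, b) \<and> (a, b, c) \<in> rot K" if d: "d \<in> ?D" for d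
  proof -
    obtain a b where "d = (a, b)" "b \<in> nbrs K a" using d by (auto simp: darts_def)
    then show ?thesis using nxt_rot[of b a] by blast
  qed
  have "\<sigma> permutes ?D"
    unfolding \<sigma>_def
  proof (rule permutes_restrict[OF finite_darts])
    show "inj_on (\<lambda>d. (fst d, nxt K (fst d) (snd d))) ?D"
      using nxt_inj unfolding darts_def inj_on_def by auto
    show "(\<lambda>d. (fst d, nxt K (fst d) (snd d))) ` ?D \<subseteq> ?D"
      by (auto simp: darts_def intro: nxt_nbrs[THEN subsetD])
  qed
  note \<sigma> = this
  have \<alpha>: "\<alpha> permutes ?D"
    unfolding \<alpha>_def
    by (rule permutes_restrict[OF finite_darts]) (auto simp: inj_on_def darts_def nbrs_sym)
  have \<phi>: "\<phi> permutes ?D"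
    unfolding \<phi>_def
  proof (rule permutes_restrict[OF finite_darts])
    show "inj_on (\<lambda>d. (snd d, nxt K (fst d) (snd d))) ?D"
    proof (rule inj_onI)
      fix d d' assume d: "d \<in> ?D" "d' \<in> ?D"
        and eq: "(snd d, nxt K (fst d) (snd d)) = (snd d', nxt K (fst d') (snd d'))"
      obtain a b c where 1: "d = (a, b)" "(a, b, c) \<in> rot K" using dart[OF d(1)] by blast
      obtain a' b' c' where 2: "d' = (a', b')" "(a', b', c') \<in> rot K" using dart[OF d(2)] by blast
      have e: "b = b'" "c = c'" using eq nxt_eq[OF 1(2)] nxt_eq[OF 2(2)] 1(1) 2(1) by auto
      have "(b, c, a) \<in> rot K" "(b, c, a') \<in> rot K" using rot_cyc[OF 1(2)] rot_cyc[OF 2(2)] e by auto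
      then have "a = a'" by (rule rot_unique)
      then show "d = d'" using 1 2 e by simp
    qed
    show "(\<lambda>d. (snd d, nxt K (fst d) (snd d))) ` ?D \<subseteq> ?D"
    proof
      fix e assume "e \<in> (\<lambda>d. (snd d, nxt K (fst d) (snd d))) ` ?D"
      then obtain d where d: "d \<in> ?D" "e = (snd d, nxt K (fst d) (snd d))" by blast
      obtain a b c where 1: "d = (a, b)" "(a, b, c) \<in> rot K" using dart[OF d(1)] by blast
      show "e \<in> ?D" using d(2) 1(1) nxt_eq[OF 1(2)] rD(2)[OF 1(2)] by simp
    qed
  qed
  \<comment> \<open>\<open>\<phi>\<close> passes to the next edge of the triangle, so its square
    sends \<open>(a, b)\<close> to \<open>(c, a)\<close>, and reversal turns this into
    \<open>(a, c)\<close>.\<close>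
  have comp: "\<sigma> = \<alpha> \<circ> (\<phi> \<circ> \<phi>)"
  proof
    fix d
    show "\<sigma> d = (\<alpha> \<circ> (\<phi> \<circ> \<phi>)) d"
    proof (cases "d \<in> ?D")
      case True
      then obtain a b c where d: "d = (a, b)" "(a, b, c) \<in> rot K" using dart by blast
      have "\<phi> (\<phi> d) = (c, a)" using r(2)[OF d(2)] r(2)[OF rot_cyc[OF d(2)]] d(1) by simp
      then show ?thesis using r(1)[OF d(2)] d(1) rD(3)[OF d(2)] by (simp add: \<alpha>_def)
    next
      case False
      then show ?thesis by (simp add: \<sigma>_def \<alpha>_def \<phi>_def)
    qed
  qed
  have perm: "permutation f" if "f permutes ?D" for f :: "'v \<times> 'v \<Rightarrow> 'v \<times> 'v"
    using that finite_darts permutation_permutes by blast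
  have "evenperm (\<phi> \<circ> \<phi>)" using evenperm_comp[OF perm[OF \<phi>] perm[OF \<phi>]] by simp
  then have par: "evenperm \<sigma> = evenperm \<alpha>"
    unfolding comp using evenperm_comp[OF perm[OF \<alpha>] perm[OF permutes_compose[OF \<phi> \<phi>]]] by simp
  \<comment> \<open>The signs of \<open>\<sigma>\<close> and \<open>\<alpha>\<close> are both
    expressed by numbers of cycles. The common term \<open>card ?D\<close> cancels, so the numbers
    of vertices and edges have the same parity.\<close>
  have "evenperm \<sigma> \<longleftrightarrow> even (card ?D + card (fst ` ?D))"
  proof (rule evenperm_iff_even_cycles[OF \<sigma> finite_darts])
    show "fst (\<sigma> d) = fst d" if "d \<in> ?D" for d by (simp add: \<sigma>_def)
    fix d d' assume d: "d \<in> ?D" "d' \<in> ?D" "fst d = fst d'"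
    obtain a b where 1: "d = (a, b)" "b \<in> nbrs K a" using d(1) by (auto simp: darts_def)
    obtain b' where 2: "d' = (a, b')" "b' \<in> nbrs K a" using d(2,3) 1 by (auto simp: darts_def)
    obtain i where i: "b' = (nxt K a ^^ i) b" using single_link[OF 1(2) 2(2)] by blast
    have "(\<sigma> ^^ j) (a, b) = (a, (nxt K a ^^ j) b)" for j
    proof (induction j)
      case (Suc j)
      then show ?case using nxt_funpow_nbrs[OF 1(2), of j] by (simp add: \<sigma>_def D)
    qed simp
    then have "d' = (\<sigma> ^^ i) d" using 1 2 i by simp
    then show "\<exists>i. d' = (\<sigma> ^^ i) d" by (rule exI)
  qed
  moreover have "fst ` ?D = verts K"
  proof (intro equalityI subsetI)
    fix v assume "v \<in> fst ` ?D"
    then obtain u where "u \<in> nbrs K v" by (auto simp: darts_def)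
    then show "v \<in> verts K" using edge_verts[of v u] by (simp add: nbrs_def)
  next
    fix v assume "v \<in> verts K"
    then obtain u where "u \<in> nbrs K v" using nonisolated by blast
    then show "v \<in> fst ` ?D" using D by force
  qed
  moreover have "evenperm \<alpha> \<longleftrightarrow> even (card ?D + card ((\<lambda>d. {fst d, snd d}) ` ?D))"
  proof (rule evenperm_iff_even_cycles[OF \<alpha> finite_darts])
    show "{fst (\<alpha> d), snd (\<alpha> d)} = {fst d, snd d}" if "d \<in> ?D" for d
      by (auto simp: \<alpha>_def)
    fix d d' assume d: "d \<in> ?D" "d' \<in> ?D" "{fst d, snd d} = {fst d', snd d'}"
    have "d' = d \<or> d' = (snd d, fst d)" using d(3) by (auto simp: doubleton_eq_iff prod_eq_iff)
    then have "d' = (\<alpha> ^^ 0) d \<or> d' = (\<alpha> ^^ 1) d" using d(1) by (simp add: \<alpha>_def)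
    then show "\<exists>i. d' = (\<alpha> ^^ i) d" by blast
  qed
  moreover have "(\<lambda>d. {fst d, snd d}) ` ?D = edges K"
  proof (intro equalityI subsetI)
    fix e assume "e \<in> (\<lambda>d. {fst d, snd d}) ` ?D"
    then show "e \<in> edges K" by (auto simp: darts_def nbrs_def)
  next
    fix e assume e: "e \<in> edges K"
    then obtain a b where "e = {a, b}" by (rule edge_cases)
    then show "e \<in> (\<lambda>d. {fst d, snd d}) ` ?D"
      using e by (intro image_eqI[of _ _ "(a, b)"]) (auto simp: darts_def nbrs_def)
  qed
  ultimately show ?thesis using par by simp blast
qed

lemma even_tris: "even (card (tris K))"
proof -
  have "even (3 * card (tris K))" unfolding three_tris_two_edges by simp
  then show ?thesis by simp
qed

end

subsection \<open>Dimensions of spaces of chains\<close>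

text \<open>The functionals \<open>\<phi> i\<close> are dual to the vectors \<open>e i\<close>,
  which are therefore independent. They also separate the elements of \<open>S\<close>, so every
  \<open>x\<close> equals the combination of the \<open>e i\<close> with coefficients
  \<open>\<phi> i x\<close>.\<close>

lemma (in vector_space) dim_by_coordinates:
  assumes fin: "finite I" and S: "subspace S"
    and e: "\<And>i. i \<in> I \<Longrightarrow> e i \<in> S"
    and add: "\<And>i x y. \<phi> i (x + y) = \<phi> i x + \<phi> i y"
    and mult: "\<And>i r x. \<phi> i (scale r x) = r * \<phi> i x"
    and dual: "\<And>i j. i \<in> I \<Longrightarrow> j \<in> I \<Longrightarrow> \<phi> i (e j) = (if i = j then 1 else 0)"
    and sep: "\<And>x. x \<in> S \<Longrightarrow> (\<And>i. i \<in> I \<Longrightarrow> \<phi> i x = 0) \<Longrightarrow> x = 0"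
  shows "dim S = card I" and "\<exists>B. finite B \<and> S \<subseteq> span B"
proof -
  have zero: "\<phi> i 0 = 0" for i using mult[of i 0 0] by simp
  have coord: "\<phi> i (\<Sum>j\<in>J. scale (r j) (e j)) = (if i \<in> J then r i else 0)"
    if "i \<in> I" "J \<subseteq> I" "finite J" for i r J
    using that(3,2)
  proof (induction J rule: finite_induct)
    case empty
    show ?case using zero by simp
  next
    case (insert j J)
    have "\<phi> i (\<Sum>j\<in>insert j J. scale (r j) (e j)) = r j * \<phi> i (e j) + \<phi> i (\<Sum>j\<in>J. scale (r j) (e j))"
      using insert.hyps by (simp add: add mult)
    then show ?case using insert dual[OF that(1), of j] by auto
  qed
  have inj: "inj_on e I"
  proof (rule inj_onI)
    fix i j assume ij: "i \<in> I" "j \<in> I" "e i = e j"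
    have "\<phi> i (e i) = 1" using dual[OF ij(1,1)] by simp
    then show "i = j" using dual[OF ij(1,2)] ij(3) by (metis zero_neq_one)
  qed
  have "independent (e ` I)"
  proof
    assume "dependent (e ` I)"
    then obtain u v where u: "v \<in> e ` I" "u v \<noteq> 0" "(\<Sum>v\<in>e ` I. scale (u v) v) = 0"
      using fin by (auto simp: dependent_finite)
    obtain i where i: "i \<in> I" "v = e i" using u(1) by blast
    have "(\<Sum>j\<in>I. scale (u (e j)) (e j)) = 0"
      using u(3) sum.reindex[OF inj, of "\<lambda>v. scale (u v) v"] by simp
    then have "u (e i) = 0" using coord[OF i(1) subset_refl fin, of "\<lambda>j. u (e j)"] zero i(1) by simp
    then show False using u(2) i(2) by simp
  qed
  moreover have "S \<subseteq> span (e ` I)"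
  proof
    fix x assume x: "x \<in> S"
    define y where "y = (\<Sum>j\<in>I. scale (\<phi> j x) (e j))"
    have y: "y \<in> S" unfolding y_def using e S by (intro subspace_sum subspace_scale) auto
    have "x - y = 0"
    proof (rule sep)
      show "x - y \<in> S" by (rule subspace_diff[OF S x y])
      fix i assume i: "i \<in> I"
      have "\<phi> i y = \<phi> i x" unfolding y_def using coord[OF i subset_refl fin] i by simp
      moreover have "\<phi> i x = \<phi> i (x - y) + \<phi> i y" using add[of i "x - y" y] by simp
      ultimately show "\<phi> i (x - y) = 0" by simp
    qed
    then have "x = y" by simp
    moreover have "y \<in> span (e ` I)" unfolding y_def by (intro span_sum span_scale span_base imageI)
    ultimately show "x \<in> span (e ` I)" by simp
  qed
  moreover have "e ` I \<subseteq> S" using e by blast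
  ultimately have "card (e ` I) = dim S" by (intro basis_card_eq_dim)
  then show "dim S = card I" using card_image[OF inj] by simp
  show "\<exists>B. finite B \<and> S \<subseteq> span B" using fin \<open>S \<subseteq> span (e ` I)\<close> by blast
qed

text \<open>Finiteness is asked of the subspace \<open>S\<close>, because the function spaces that
  contain the chains are infinite-dimensional over an infinite vertex type. A basis of the kernel in
  \<open>S\<close> is extended to one of \<open>S\<close>, and the added vectors map to a basis of
  the image.\<close>

lemma (in Vector_Spaces.linear) rank_nullity:
  assumes S: "vs1.subspace S" and fin: "finite T" "S \<subseteq> vs1.span T"
  shows "vs1.dim S = vs1.dim {x \<in> S. f x = 0} + vs2.dim (f ` S)"
proof -
  let ?N = "{x \<in> S. f x = 0}"
  obtain BN where BN: "BN \<subseteq> ?N" "vs1.independent BN" "?N \<subseteq> vs1.span BN" "card BN = vs1.dim ?N"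
    by (rule vs1.basis_exists)
  have "BN \<subseteq> S" using BN(1) by blast
  then obtain B where B: "BN \<subseteq> B" "B \<subseteq> S" "vs1.independent B" "S \<subseteq> vs1.span B"
    using BN(2) by (rule vs1.maximal_independent_subset_extend)
  have finB: "finite B"
    using vs1.independent_span_bound[OF fin(1) B(3)] B(2) fin(2) by blast
  define C where "C = B - BN"
  have spanS: "vs1.span B' \<subseteq> S" if "B' \<subseteq> B" for B'
    using that B(2) S by (intro vs1.span_minimal) auto
  have inj: "inj_on f (vs1.span C)"
    unfolding inj_on_iff_eq_0[OF vs1.subspace_span]
  proof (intro ballI impI)
    fix x assume x: "x \<in> vs1.span C" "f x = 0"
    have CB: "C \<subseteq> B" unfolding C_def by blast
    have xN: "x \<in> vs1.span BN" using x spanS[OF CB] BN(3) by blast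
    \<comment> \<open>A vector in the spans of both \<open>BN\<close> and \<open>C\<close> has its
      coordinates supported in their empty intersection, so it vanishes.\<close>
    have "vs1.representation B x = vs1.representation BN x"
      by (rule vs1.representation_extend[OF B(3) xN B(1)])
    moreover have "vs1.representation B x = vs1.representation C x"
      by (rule vs1.representation_extend[OF B(3) x(1) CB])
    ultimately have "vs1.representation B x b = 0" for b
      using vs1.representation_ne_zero[of BN x b] vs1.representation_ne_zero[of C x b]
      unfolding C_def by (metis Diff_iff)
    moreover have "x \<in> vs1.span B" using vs1.span_mono[OF CB] x(1) by blast
    ultimately show "x = 0"
      using vs1.sum_nonzero_representation_eq[OF B(3)] by (metis (mono_tags, lifting) sum.neutral vs1.scale_zero_left)
  qed
  then have ind: "vs2.independent (f ` C)"
    using vs1.independent_mono[OF B(3)] unfolding C_def by (intro independent_injective_image) auto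
  have injC: "inj_on f C" using inj vs1.span_superset inj_on_subset by blast
  have "f ` S \<subseteq> vs2.span (f ` C)"
  proof -
    have "f ` S \<subseteq> vs2.span (f ` B)" using spans_image[OF B(4)] .
    also have "\<dots> \<subseteq> vs2.span (f ` C)"
    proof (rule vs2.span_minimal)
      show "f ` B \<subseteq> vs2.span (f ` C)"
      proof
        fix y assume "y \<in> f ` B"
        then obtain b where b: "b \<in> B" "y = f b" by blast
        show "y \<in> vs2.span (f ` C)"
        proof (cases "b \<in> BN")
          case True
          then have "y = 0" using BN(1) b(2) by blast
          then show ?thesis by (simp add: vs2.span_zero)
        next
          case False
          then show ?thesis using b unfolding C_def by (intro vs2.span_base) blast
        qed
      qed
    qed (rule vs2.subspace_span)
    finally show ?thesis .
  qed
  moreover have "f ` C \<subseteq> f ` S" using B(2) unfolding C_def by blast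
  ultimately have "vs2.dim (f ` S) = card C"
    using vs2.basis_card_eq_dim[OF _ _ ind] card_image[OF injC] by metis
  moreover have "vs1.dim S = card B" using vs1.basis_card_eq_dim[OF B(2,4,3)] by simp
  moreover have "card B = card BN + card C"
    using card_Diff_subset[OF finite_subset[OF B(1) finB] B(1)] card_mono[OF finB B(1)]
    unfolding C_def by simp
  ultimately show ?thesis using BN(4) by simp
qed

definition scale0 :: "real \<Rightarrow> ('v \<Rightarrow> real) \<Rightarrow> 'v \<Rightarrow> real" where
  "scale0 r f = (\<lambda>a. r * f a)"

definition scale2 :: "real \<Rightarrow> ('v \<Rightarrow> 'v \<Rightarrow> 'v \<Rightarrow> real) \<Rightarrow> 'v \<Rightarrow> 'v \<Rightarrow> 'v \<Rightarrow> real" where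
  "scale2 r f = (\<lambda>a b c. r * f a b c)"

interpretation s0: vector_space scale0
  by standard (simp_all add: scale0_def fun_eq_iff algebra_simps)

interpretation s1: vector_space chain_scale
  by (rule vector_space_chain_scale)

interpretation s2: vector_space scale2
  by standard (simp_all add: scale2_def fun_eq_iff algebra_simps)

lemma linear_boundary1: "Vector_Spaces.linear chain_scale scale0 (boundary1 K)"
  by unfold_locales
    (simp_all add: boundary1_def chain_scale_def scale0_def fun_eq_iff sum.distrib sum_distrib_left)

lemma linear_boundary2: "Vector_Spaces.linear scale2 chain_scale (boundary2 K)"
  by unfold_locales
    (simp_all add: boundary2_def chain_scale_def scale2_def fun_eq_iff sum.distrib sum_distrib_left)

lemma subspace_chains1: "s1.subspace (chains1 K)"
proof (rule s1.subspaceI)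
  show "0 \<in> chains1 K" by (simp add: chains1_def)
next
  fix x y assume "x \<in> chains1 K" "y \<in> chains1 K"
  then have h: "x b a = - x a b" "y b a = - y a b"
    "{a, b} \<notin> edges K \<Longrightarrow> x a b = 0" "{a, b} \<notin> edges K \<Longrightarrow> y a b = 0" for a b
    unfolding chains1_def by blast+
  have "(x + y) b a = - (x + y) a b" for a b using h(1,2)[of b a] by simp
  moreover have "(x + y) a b = 0" if "{a, b} \<notin> edges K" for a b using h(3,4)[OF that] by simp
  ultimately show "x + y \<in> chains1 K" unfolding chains1_def by blast
next
  fix r x assume "x \<in> chains1 K"
  then have h: "x b a = - x a b" "{a, b} \<notin> edges K \<Longrightarrow> x a b = 0" for a b
    unfolding chains1_def by blast+
  have "chain_scale r x b a = - chain_scale r x a b" for a b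
    using h(1)[of b a] by (simp add: chain_scale_def)
  moreover have "chain_scale r x a b = 0" if "{a, b} \<notin> edges K" for a b
    using h(2)[OF that] by (simp add: chain_scale_def)
  ultimately show "chain_scale r x \<in> chains1 K" unfolding chains1_def by blast
qed

lemma subspace_chains2: "s2.subspace (chains2 K)"
proof (rule s2.subspaceI)
  show "0 \<in> chains2 K" by (simp add: chains2_def)
next
  fix x y assume "x \<in> chains2 K" "y \<in> chains2 K"
  then have h: "x b a d = - x a b d" "y b a d = - y a b d" "x a d b = - x a b d" "y a d b = - y a b d"
    "{a, b, d} \<notin> tri_set ` tris K \<Longrightarrow> x a b d = 0" "{a, b, d} \<notin> tri_set ` tris K \<Longrightarrow> y a b d = 0"
    for a b d
    unfolding chains2_def by blast+
  have "(x + y) b a d = - (x + y) a b d" for a b d using h(1,2)[of b a d] by simp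
  moreover have "(x + y) a d b = - (x + y) a b d" for a b d using h(3,4)[of a d b] by simp
  moreover have "(x + y) a b d = 0" if "{a, b, d} \<notin> tri_set ` tris K" for a b d
    using h(5,6)[OF that] by simp
  ultimately show "x + y \<in> chains2 K" unfolding chains2_def by blast
next
  fix r x assume "x \<in> chains2 K"
  then have h: "x b a d = - x a b d" "x a d b = - x a b d"
    "{a, b, d} \<notin> tri_set ` tris K \<Longrightarrow> x a b d = 0" for a b d
    unfolding chains2_def by blast+
  have "scale2 r x b a d = - scale2 r x a b d" for a b d
    using h(1)[of b a d] by (simp add: scale2_def)
  moreover have "scale2 r x a d b = - scale2 r x a b d" for a b d
    using h(2)[of a d b] by (simp add: scale2_def)
  moreover have "scale2 r x a b d = 0" if "{a, b, d} \<notin> tri_set ` tris K" for a b d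
    using h(3)[OF that] by (simp add: scale2_def)
  ultimately show "scale2 r x \<in> chains2 K" unfolding chains2_def by blast
qed

context oriented_complex
begin

text \<open>An order \<open>d e\<close> of the ends is chosen for each edge, and the value of an
  alternating chain there is its coordinate.\<close>

lemma dim_chains1:
  shows "s1.dim (chains1 K) = card (edges K)" and "\<exists>B. finite B \<and> chains1 K \<subseteq> s1.span B"
proof -
  have "\<exists>d. fst d \<noteq> snd d \<and> {fst d, snd d} = e" if "e \<in> edges K" for e
    using edge_cases[OF that] by (metis fst_conv snd_conv)
  then obtain d where d: "\<And>e. e \<in> edges K \<Longrightarrow> fst (d e) \<noteq> snd (d e) \<and> {fst (d e), snd (d e)} = e"
    by metis
  define w where "w e = (\<lambda>a b. if (a, b) = d e then 1 else if (b, a) = d e then -1 else 0 :: real)" for e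
  define \<phi> where "\<phi> e c = c (fst (d e)) (snd (d e))" for e and c :: "'v \<Rightarrow> 'v \<Rightarrow> real"
  have w: "w e \<in> chains1 K" if e: "e \<in> edges K" for e
  proof -
    have "w e b a = - w e a b" for a b
      using d[OF e] unfolding w_def by (cases "d e") auto
    moreover have "w e a b = 0" if "{a, b} \<notin> edges K" for a b
      using d[OF e] e that unfolding w_def by (cases "d e") (auto simp: insert_commute)
    ultimately show ?thesis unfolding chains1_def by blast
  qed
  have dual: "\<phi> e (w e') = (if e = e' then 1 else 0)" if e: "e \<in> edges K" "e' \<in> edges K" for e e'
  proof (cases "e = e'")
    case True
    then show ?thesis by (simp add: \<phi>_def w_def)
  next
    case False
    then have "d e \<noteq> d e'" "(snd (d e), fst (d e)) \<noteq> d e'"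
      using d[OF e(1)] d[OF e(2)] by (metis, metis fst_conv insert_commute snd_conv)
    then show ?thesis using False by (simp add: \<phi>_def w_def)
  qed
  have sep: "c = 0" if c: "c \<in> chains1 K" and z: "\<And>e. e \<in> edges K \<Longrightarrow> \<phi> e c = 0" for c
  proof (intro ext)
    fix a b
    have anti: "c b a = - c a b" for a b using c unfolding chains1_def by blast
    show "c a b = 0 a b"
    proof (cases "{a, b} \<in> edges K")
      case True
      have "d {a, b} = (a, b) \<or> d {a, b} = (b, a)"
        using d[OF True] by (cases "d {a, b}") (auto simp: doubleton_eq_iff)
      then have "c a b = 0 \<or> c b a = 0" using z[OF True] unfolding \<phi>_def by auto
      then show ?thesis using anti[of a b] by auto
    next
      case False
      then have "c a b = 0" using c unfolding chains1_def by blast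
      then show ?thesis by simp
    qed
  qed
  have add: "\<phi> e (c + c') = \<phi> e c + \<phi> e c'" and mult: "\<phi> e (chain_scale r c) = r * \<phi> e c" for e r c c'
    by (simp_all add: \<phi>_def chain_scale_def)
  show "s1.dim (chains1 K) = card (edges K)" "\<exists>B. finite B \<and> chains1 K \<subseteq> s1.span B"
    using s1.dim_by_coordinates[of "edges K" "chains1 K" w \<phi>, OF finite_edges subspace_chains1 w add mult dual sep]
    by blast+
qed

text \<open>For the three rotations of one triangle this is its elementary chain; for
  \<open>rot K\<close> it is the fundamental class.\<close>

definition fundamental :: "('v \<times> 'v \<times> 'v) set \<Rightarrow> 'v \<Rightarrow> 'v \<Rightarrow> 'v \<Rightarrow> real" where
  "fundamental R = (\<lambda>a b c. if (a, b, c) \<in> R then 1 else if (b, a, c) \<in> R then -1 else 0)"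

lemma rot_odd: "(a, b, c) \<in> rot K \<Longrightarrow> (b, a, c) \<notin> rot K"
  using rot_swap by blast

lemma chains2D:
  assumes "c \<in> chains2 K"
  shows "c a b d = - c b a d" "c a b d = - c a d b" "{a, b, d} \<notin> tri_set ` tris K \<Longrightarrow> c a b d = 0"
    "c a b d = c b d a"
proof -
  have 1: "c a b d = - c b a d" and 2: "c a b d = - c a d b" for a b d
    using assms unfolding chains2_def by blast+
  show "c a b d = - c b a d" "c a b d = - c a d b" by (rule 1, rule 2)
  show "c a b d = c b d a" using 1[of a b d] 2[of b a d] by simp
  show "{a, b, d} \<notin> tri_set ` tris K \<Longrightarrow> c a b d = 0" using assms unfolding chains2_def by blast
qed

text \<open>An order of the vertices of a triangle is an even rearrangement of the listed one, hence
  in \<open>rot K\<close>, or becomes even after exchanging its first two entries.\<close>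

lemma tri_set_rot:
  assumes "{a, b, c} \<in> tri_set ` tris K"
  shows "(a, b, c) \<in> rot K \<or> (b, a, c) \<in> rot K"
proof -
  obtain t where t: "t \<in> tris K" "tri_set t = {a, b, c}" using assms by auto
  obtain p q r where pqr: "t = (p, q, r)" by (cases t)
  have R: "(p, q, r) \<in> rot K" using t(1) unfolding pqr by (rule tris_rot)
  note R1 = rot_cyc[OF R] and R2 = rot_cyc[OF rot_cyc[OF R]]
  have e: "{p, q, r} = {a, b, c}" using t(2) pqr by (simp add: tri_set_def)
  note ne = rot_edges(1-3)[OF R]
  have "a \<in> {p, q, r}" "b \<in> {p, q, r}" "c \<in> {p, q, r}" unfolding e by blast+
  moreover have "p \<in> {a, b, c}" "q \<in> {a, b, c}" "r \<in> {a, b, c}" unfolding e[symmetric] by blast+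
  ultimately have "(a, b, c) \<in> {(p, q, r), (q, r, p), (r, p, q), (q, p, r), (r, q, p), (p, r, q)}"
    using ne by auto
  then show ?thesis using R R1 R2 by auto
qed

lemma rot_tri_set: "(a, b, c) \<in> rot K \<Longrightarrow> {a, b, c} \<in> tri_set ` tris K"
  using rot_tri by (metis imageI)

lemma fundamental_chains2:
  assumes R: "R \<subseteq> rot K" and cyc: "\<And>a b c. (a, b, c) \<in> R \<Longrightarrow> (b, c, a) \<in> R"
  shows "fundamental R \<in> chains2 K"
proof -
  have odd: "(a, b, c) \<in> R \<Longrightarrow> (b, a, c) \<notin> R" for a b c using R rot_odd by blast
  have "fundamental R b a d = - fundamental R a b d" for a b d
    using odd[of a b d] odd[of b a d] by (simp add: fundamental_def)
  moreover have "fundamental R a d b = - fundamental R a b d" for a b d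
  proof -
    have "(a, d, b) \<in> R \<longleftrightarrow> (b, a, d) \<in> R" "(d, a, b) \<in> R \<longleftrightarrow> (a, b, d) \<in> R"
      using cyc by blast+
    then show ?thesis using odd[of a b d] odd[of b a d] by (simp add: fundamental_def)
  qed
  moreover have "fundamental R a b d = 0" if "{a, b, d} \<notin> tri_set ` tris K" for a b d
  proof -
    have "{b, a, d} = {a, b, d}" by blast
    then have "(a, b, d) \<notin> R" "(b, a, d) \<notin> R" using that R rot_tri_set by (metis subsetD)+
    then show ?thesis by (simp add: fundamental_def)
  qed
  ultimately show ?thesis unfolding chains2_def by blast
qed

lemma dim_chains2:
  shows "s2.dim (chains2 K) = card (tris K)" and "\<exists>B. finite B \<and> chains2 K \<subseteq> s2.span B"
proof -
  define R where "R t = (case t of (a, b, c) \<Rightarrow> {(a, b, c), (b, c, a), (c, a, b)})"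
    for t :: "'v \<times> 'v \<times> 'v"
  define \<phi> where "\<phi> t f = (case t of (a, b, c) \<Rightarrow> f a b c)"
    for t :: "'v \<times> 'v \<times> 'v" and f :: "'v \<Rightarrow> 'v \<Rightarrow> 'v \<Rightarrow> real"
  have w: "fundamental (R t) \<in> chains2 K" if "t \<in> tris K" for t
  proof (rule fundamental_chains2)
    show "R t \<subseteq> rot K" using that unfolding R_def rot_def by auto
    show "(b, c, a) \<in> R t" if "(a, b, c) \<in> R t" for a b c
      using that unfolding R_def by (cases t) auto
  qed
  have dual: "\<phi> t (fundamental (R t')) = (if t = t' then 1 else 0)" if t: "t \<in> tris K" "t' \<in> tris K" for t t'
  proof -
    obtain a b c where abc: "t = (a, b, c)" by (cases t)
    obtain p q r where pqr: "t' = (p, q, r)" by (cases t')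
    show ?thesis
    proof (cases "t = t'")
      case True
      have t': "t' = (a, b, c)" using True abc by simp
      show ?thesis unfolding \<phi>_def fundamental_def abc t' R_def by simp
    next
      case False
      have "t \<notin> R t'"
        using False t tris_not_rotated[of p q r] unfolding abc pqr R_def by auto
      moreover have "(b, a, c) \<notin> R t'"
      proof
        assume *: "(b, a, c) \<in> R t'"
        have "(b, a, c) \<in> rot K" using * t(2) unfolding R_def rot_def pqr by auto
        then show False using rot_odd[of b a c] tris_rot[OF t(1)[unfolded abc]] by blast
      qed
      ultimately show ?thesis using False unfolding \<phi>_def fundamental_def abc by simp
    qed
  qed
  have sep: "c = 0" if c: "c \<in> chains2 K" and z: "\<And>t. t \<in> tris K \<Longrightarrow> \<phi> t c = 0" for c
  proof (intro ext)
    fix a b d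
    note C = chains2D[OF c]
    have zr: "c a b d = 0" if "(a, b, d) \<in> rot K" for a b d
    proof -
      have "c a b d = 0 \<or> c b d a = 0 \<or> c d a b = 0"
        using that z[of "(a, b, d)"] z[of "(b, d, a)"] z[of "(d, a, b)"] unfolding rot_def \<phi>_def by auto
      then show ?thesis using C(4)[of b d a] C(4)[of d a b] by auto
    qed
    show "c a b d = 0 a b d"
    proof (cases "{a, b, d} \<in> tri_set ` tris K")
      case True
      then have "c a b d = 0 \<or> c b a d = 0" using tri_set_rot zr by blast
      then show ?thesis using C(1)[of b a d] by auto
    next
      case False
      then show ?thesis using C(3) by simp
    qed
  qed
  have add: "\<phi> t (c + c') = \<phi> t c + \<phi> t c'" and mult: "\<phi> t (scale2 r c) = r * \<phi> t c" for t r c c'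
    by (simp_all add: \<phi>_def scale2_def split: prod.splits)
  show "s2.dim (chains2 K) = card (tris K)" "\<exists>B. finite B \<and> chains2 K \<subseteq> s2.span B"
    using s2.dim_by_coordinates[of "tris K" "chains2 K" "\<lambda>t. fundamental (R t)" \<phi>,
        OF finite_tris subspace_chains2 w add mult dual sep] by blast+
qed

end

section \<open>Homology of a closed surface\<close>

context closed_surface
begin

text \<open>Boundaries have sum zero because chains alternate. Conversely, adding up the boundaries
  of the edges of a path from \<open>v0\<close> to \<open>v\<close> gives
  \<open>\<delta> v - \<delta> v0\<close>, and these form a basis for
  \<open>v \<noteq> v0\<close>.\<close>

lemma dim_boundaries0: "s0.dim (boundary1 K ` chains1 K) = card (verts K) - 1"
proof -
  interpret b1: Vector_Spaces.linear chain_scale scale0 "boundary1 K" by (rule linear_boundary1)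
  let ?B = "boundary1 K ` chains1 K"
  have sub: "s0.subspace ?B" by (rule b1.subspace_image[OF subspace_chains1])
  obtain v0 where v0: "v0 \<in> verts K" using nonempty by blast
  define \<delta> where "\<delta> v = (\<lambda>w. if w = v then 1 else 0 :: real)" for v :: 'v
  have edge: "\<delta> b - \<delta> a \<in> ?B" if e: "{a, b} \<in> edges K" for a b
  proof
    define c where "c = (\<lambda>p q. if p = a \<and> q = b then 1 else if p = b \<and> q = a then -1 else 0 :: real)"
    have ab: "a \<noteq> b" "a \<in> verts K" "b \<in> verts K" using edge_verts[OF e] by auto
    show "c \<in> chains1 K" using ab e unfolding chains1_def c_def by (auto simp: insert_commute)
    show "\<delta> b - \<delta> a = boundary1 K c"
    proof
      fix q
      have "(\<Sum>p\<in>verts K. c p q) = (\<Sum>p\<in>verts K. (if p = a then (if q = b then 1 else 0) else 0)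
          + (if p = b then (if q = a then -1 else 0) else 0))"
        by (rule sum.cong) (use ab in \<open>auto simp: c_def\<close>)
      also have "\<dots> = (if q = b then 1 else 0) + (if q = a then -1 else 0)"
        unfolding sum.distrib using ab finite_verts by simp
      also have "\<dots> = (\<delta> b - \<delta> a) q" by (simp add: \<delta>_def)
      finally show "(\<delta> b - \<delta> a) q = boundary1 K c q" by (simp add: boundary1_def)
    qed
  qed
  have w: "\<delta> v - \<delta> v0 \<in> ?B" if v: "v \<in> verts K - {v0}" for v
  proof -
    have "(v0, v) \<in> {(a, b). {a, b} \<in> edges K}\<^sup>*" using connected v0 v by blast
    then show ?thesis
    proof (induction rule: rtrancl_induct)
      case base
      have "\<delta> v0 - \<delta> v0 = 0" by (rule diff_self)
      then show ?case using s0.subspace_0[OF sub] by metis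
    next
      case (step y z)
      then have "\<delta> z - \<delta> y \<in> ?B" using edge by simp
      then have "(\<delta> z - \<delta> y) + (\<delta> y - \<delta> v0) \<in> ?B" by (rule s0.subspace_add[OF sub _ step.IH])
      moreover have "(\<delta> z - \<delta> y) + (\<delta> y - \<delta> v0) = \<delta> z - \<delta> v0" by (simp add: fun_eq_iff)
      ultimately show ?case by metis
    qed
  qed
  have zero: "(\<Sum>v\<in>verts K. f v) = 0 \<and> (\<forall>v. v \<notin> verts K \<longrightarrow> f v = 0)" if f: "f \<in> ?B" for f
  proof -
    obtain c where c: "c \<in> chains1 K" "f = boundary1 K c" using f by blast
    have anti: "c b a = - c a b" for a b using c(1) unfolding chains1_def by blast
    have "(\<Sum>v\<in>verts K. f v) = (\<Sum>v\<in>verts K. \<Sum>u\<in>verts K. c u v)" by (simp add: c(2) boundary1_def)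
    moreover have "\<dots> = (\<Sum>u\<in>verts K. \<Sum>v\<in>verts K. c u v)" by (rule sum.swap)
    moreover have "\<dots> = - (\<Sum>u\<in>verts K. \<Sum>v\<in>verts K. c v u)"
      unfolding sum_negf[symmetric] by (intro sum.cong refl) (rule anti)
    ultimately have "(\<Sum>v\<in>verts K. f v) = 0" by linarith
    moreover have "f v = 0" if "v \<notin> verts K" for v
    proof -
      have "c u v = 0" for u using c(1) that edge_verts[of u v] unfolding chains1_def by blast
      then show ?thesis by (simp add: c(2) boundary1_def)
    qed
    ultimately show ?thesis by blast
  qed
  have "s0.dim ?B = card (verts K - {v0})"
  proof (rule s0.dim_by_coordinates(1)[where \<phi> = "\<lambda>v f. f v" and e = "\<lambda>v. \<delta> v - \<delta> v0"])
    show "finite (verts K - {v0})" using finite_verts by simp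
    show "s0.subspace ?B" by (rule sub)
    show "\<delta> i - \<delta> v0 \<in> ?B" if "i \<in> verts K - {v0}" for i by (rule w[OF that])
    show "(\<delta> j - \<delta> v0) i = (if i = j then 1 else 0)" if "i \<in> verts K - {v0}" "j \<in> verts K - {v0}" for i j
      using that by (auto simp: \<delta>_def)
    show "f = 0" if f: "f \<in> ?B" and z: "\<And>i. i \<in> verts K - {v0} \<Longrightarrow> f i = 0" for f
    proof -
      have "(\<Sum>v\<in>verts K. f v) = f v0 + (\<Sum>v\<in>verts K - {v0}. f v)"
        using v0 finite_verts by (rule sum.remove[rotated])
      then have "f v0 = 0" using z zero[OF f] by simp
      then have "f v = 0" for v using z[of v] zero[OF f] by (cases "v = v0"; cases "v \<in> verts K") auto
      then show ?thesis by (auto simp: fun_eq_iff)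
    qed
  qed (simp_all add: scale0_def)
  then show ?thesis using v0 finite_verts by simp
qed

text \<open>Only the two triangles at the edge contribute, and they traverse it in opposite
  directions.\<close>

lemma boundary2_at:
  assumes c: "c \<in> chains2 K" and r: "(a, b, d) \<in> rot K" "(b, a, d') \<in> rot K"
  shows "boundary2 K c a b = c a b d - c b a d'"
proof -
  note C = chains2D[OF c]
  have dd: "d \<noteq> d'" by (rule rot_swap[OF r])
  have V: "d \<in> verts K" "d' \<in> verts K" using rot_edges(9)[OF r(1)] rot_edges(9)[OF r(2)] .
  have "(\<Sum>x\<in>verts K. c x a b) = (\<Sum>x\<in>{d, d'}. c x a b)"
  proof (rule sum.mono_neutral_right)
    show "\<forall>x\<in>verts K - {d, d'}. c x a b = 0"
    proof
      fix x assume x: "x \<in> verts K - {d, d'}"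
      have "(a, b, x) \<notin> rot K" "(b, a, x) \<notin> rot K"
        using x rot_unique[OF r(1)] rot_unique[OF r(2)] by blast+
      then have "{a, b, x} \<notin> tri_set ` tris K" using tri_set_rot by blast
      moreover have "{x, a, b} = {a, b, x}" by blast
      ultimately show "c x a b = 0" using C(3)[of x a b] by simp
    qed
  qed (use finite_verts V in auto)
  also have "\<dots> = c d a b + c d' a b" using dd by simp
  also have "c d a b = c a b d" using C(4)[of d a b] by simp
  also have "c d' a b = - c b a d'" using C(4)[of d' a b] C(1)[of a b d'] by simp
  finally show ?thesis by (simp add: boundary2_def)
qed

text \<open>By \<open>boundary2_at\<close> a cycle has equal coefficients on the two triangles at an
  edge, so \<open>flag_induct\<close> spreads a zero coefficient over the surface. Thus evaluation
  at one triangle separates cycles, with the fundamental class as dual vector.\<close>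

lemma dim_cycles2: "s2.dim {c \<in> chains2 K. boundary2 K c = 0} = 1"
proof -
  interpret b2: Vector_Spaces.linear scale2 chain_scale "boundary2 K" by (rule linear_boundary2)
  let ?Z = "{c \<in> chains2 K. boundary2 K c = 0}"
  have sub: "s2.subspace ?Z"
    using subspace_chains2[of K] unfolding s2.subspace_def by (auto simp: b2.add b2.scale b2.zero)
  obtain v u where "u \<in> nbrs K v" using nonempty nonisolated by blast
  then obtain a0 b0 d0 where f0: "(a0, b0, d0) \<in> rot K" using nxt_rot by blast
  let ?w = "fundamental (rot K)"
  have wC: "?w \<in> chains2 K" by (rule fundamental_chains2[OF subset_refl rot_cyc])
  have w: "?w \<in> ?Z"
  proof -
    have "boundary2 K ?w a b = 0" for a b
    proof (cases "{a, b} \<in> edges K")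
      case True
      obtain d where d: "(a, b, d) \<in> rot K" using True by (rule rot_ex)
      have "{b, a} \<in> edges K" using True by (simp add: insert_commute)
      then obtain d' where d': "(b, a, d') \<in> rot K" by (rule rot_ex)
      show ?thesis unfolding boundary2_at[OF wC d d'] using d d' by (simp add: fundamental_def)
    next
      case False
      have "?w x a b = 0" for x
        using False rot_edges(5)[of x a b] rot_edges(6)[of a x b] by (auto simp: fundamental_def)
      then show ?thesis by (simp add: boundary2_def)
    qed
    then show ?thesis using wC by (auto simp: fun_eq_iff)
  qed
  have "s2.dim ?Z = card {()}"
  proof (rule s2.dim_by_coordinates(1)[where \<phi> = "\<lambda>_ c. c a0 b0 d0" and e = "\<lambda>_. ?w"])
    show "?w a0 b0 d0 = (if i = j then 1 else 0)" for i j :: unit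
      using f0 by (simp add: fundamental_def)
    show "c = 0" if c: "c \<in> ?Z" and z: "\<And>i::unit. i \<in> {()} \<Longrightarrow> c a0 b0 d0 = 0" for c
    proof -
      have cC: "c \<in> chains2 K" and c0: "boundary2 K c = 0" using c by auto
      note C = chains2D[OF cC]
      have all: "(case f of (a, b, d) \<Rightarrow> c a b d = 0)" if "f \<in> rot K" for f
      proof (rule flag_induct[OF f0 _ _ _ that])
        show "case (a0, b0, d0) of (a, b, d) \<Rightarrow> c a b d = 0" using z by simp
        show "case (b, d, a) of (a, b, d) \<Rightarrow> c a b d = 0"
          if "case (a, b, d) of (a, b, d) \<Rightarrow> c a b d = 0" for a b d using that C(4)[of a b d] by simp
        show "case (b, a, d') of (a, b, d) \<Rightarrow> c a b d = 0"
          if "(a, b, d) \<in> rot K" "(b, a, d') \<in> rot K" "case (a, b, d) of (a, b, d) \<Rightarrow> c a b d = 0"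
          for a b d d'
          using boundary2_at[OF cC that(1,2)] c0 that(3) by simp
      qed
      have "c a b d = 0" for a b d
      proof (cases "{a, b, d} \<in> tri_set ` tris K")
        case True
        then have "c a b d = 0 \<or> c b a d = 0" using tri_set_rot all by blast
        then show ?thesis using C(1)[of b a d] by auto
      next
        case False
        then show ?thesis using C(3) by simp
      qed
      then show ?thesis by (auto simp: fun_eq_iff)
    qed
  qed (use sub w in \<open>simp_all add: scale2_def\<close>)
  then show ?thesis by simp
qed

text \<open>The double sum for the boundary of a boundary changes sign when its two summation
  variables are exchanged.\<close>

lemma boundaries_cycles: "boundary2 K ` chains2 K \<subseteq> {c \<in> chains1 K. boundary1 K c = (\<lambda>_. 0)}"
proof
  fix b assume "b \<in> boundary2 K ` chains2 K"
  then obtain c where c: "c \<in> chains2 K" "b = boundary2 K c" by blast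
  note C = chains2D[OF c(1)]
  have "b q p = - b p q" for p q
    unfolding c(2) boundary2_def sum_negf[symmetric] by (intro sum.cong refl) (rule C(2))
  moreover have "b p q = 0" if "{p, q} \<notin> edges K" for p q
  proof -
    have "c x p q = 0" for x
    proof (rule C(3), rule notI)
      assume "{x, p, q} \<in> tri_set ` tris K"
      then have "(x, p, q) \<in> rot K \<or> (p, x, q) \<in> rot K" by (rule tri_set_rot)
      then show False using that rot_edges(5)[of x p q] rot_edges(6)[of p x q] by blast
    qed
    then show ?thesis by (simp add: c(2) boundary2_def)
  qed
  moreover have "boundary1 K b q = 0" for q
  proof -
    have "(\<Sum>p\<in>verts K. \<Sum>x\<in>verts K. c x p q) = (\<Sum>x\<in>verts K. \<Sum>p\<in>verts K. c x p q)" by (rule sum.swap)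
    moreover have "\<dots> = - (\<Sum>p\<in>verts K. \<Sum>x\<in>verts K. c x p q)"
      unfolding sum_negf[symmetric] by (intro sum.cong refl) (rule C(1))
    ultimately have "(\<Sum>p\<in>verts K. \<Sum>x\<in>verts K. c x p q) = 0" by linarith
    then show ?thesis by (simp add: c(2) boundary1_def boundary2_def)
  qed
  then have "boundary1 K b = (\<lambda>_. 0)" by (rule ext)
  ultimately show "b \<in> {c \<in> chains1 K. boundary1 K c = (\<lambda>_. 0)}" unfolding chains1_def by blast
qed

text \<open>With V, E, F the numbers of vertices, edges and triangles, rank-nullity gives dimension
  E - (V - 1) for the cycles and F - 1 for the boundaries, so the Betti number is 2 - (V - E + F).
  It is nonnegative since boundaries are cycles, and even since V + E and F are even.\<close>

theorem genus_euler:
  "\<exists>g. has_genus K g \<and> 2 - 2 * int g = int (card (verts K)) - int (card (edges K)) + int (card (tris K))"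
proof -
  interpret b1: Vector_Spaces.linear chain_scale scale0 "boundary1 K" by (rule linear_boundary1)
  interpret b2: Vector_Spaces.linear scale2 chain_scale "boundary2 K" by (rule linear_boundary2)
  let ?Z = "{c \<in> chains1 K. boundary1 K c = (\<lambda>_. 0)}" and ?B = "boundary2 K ` chains2 K"
  have z: "(\<lambda>_. 0) = (0 :: 'v \<Rightarrow> real)" by (simp add: fun_eq_iff)
  obtain B1 where B1: "finite B1" "chains1 K \<subseteq> s1.span B1" using dim_chains1(2) by blast
  obtain B2 where B2: "finite B2" "chains2 K \<subseteq> s2.span B2" using dim_chains2(2) by blast
  have 1: "card (edges K) = s1.dim ?Z + (card (verts K) - 1)"
    using b1.rank_nullity[OF subspace_chains1 B1] dim_chains1(1) dim_boundaries0 unfolding z by simp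
  have 2: "card (tris K) = 1 + s1.dim ?B"
    using b2.rank_nullity[OF subspace_chains2 B2] dim_chains2(1) dim_cycles2 by simp
  \<comment> \<open>This makes the natural subtraction \<open>card (verts K) - 1\<close>
    exact.\<close>
  have v: "card (verts K) \<ge> 1" using nonempty finite_verts by (simp add: Suc_leI card_gt_0_iff)
  have b: "betti1 K = 2 - (int (card (verts K)) - int (card (edges K)) + int (card (tris K)))"
    unfolding betti1_def using 1 2 v by linarith
  have "s1.dim ?B \<le> s1.dim ?Z"
  proof -
    obtain C where C: "C \<subseteq> ?B" "s1.independent C" "?B \<subseteq> s1.span C" "card C = s1.dim ?B"
      by (rule s1.basis_exists)
    have "C \<subseteq> ?Z" using C(1) boundaries_cycles by blast
    then obtain D where D: "C \<subseteq> D" "D \<subseteq> ?Z" "s1.independent D" "?Z \<subseteq> s1.span D"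
      using C(2) by (rule s1.maximal_independent_subset_extend)
    have "finite D" using s1.independent_span_bound[OF B1(1) D(3)] D(2) B1(2) by blast
    then have "card C \<le> card D" using D(1) by (rule card_mono)
    moreover have "card D = s1.dim ?Z" by (rule s1.basis_card_eq_dim[OF D(2,4,3)])
    ultimately show ?thesis using C(4) by simp
  qed
  then have nonneg: "betti1 K \<ge> 0" unfolding betti1_def by simp
  have "even (betti1 K)"
    unfolding b using even_verts_edges even_tris by simp
  then obtain k where k: "betti1 K = 2 * k" by (rule evenE)
  then have "has_genus K (nat k)" using nonneg by (simp add: has_genus_def)
  moreover have "2 - 2 * int (nat k) = int (card (verts K)) - int (card (edges K)) + int (card (tris K))"
    using b k nonneg by simp
  ultimately show ?thesis by blast
qed

end

section \<open>Lifting automorphisms to the desingularization\<close>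

definition lift_map :: "('v \<Rightarrow> 'v) \<Rightarrow> 'v \<times> 'v set \<Rightarrow> 'v \<times> 'v set" where
  "lift_map f A = (f (fst A), f ` snd A)"

context oriented_complex
begin

text \<open>A map that preserves \<open>rot\<close> commutes with \<open>nxt\<close>, hence carries
  link components onto link components.\<close>

lemma lift_map_sheet_vertex:
  assumes f: "\<And>a b c. (a, b, c) \<in> rot K \<Longrightarrow> (f a, f b, f c) \<in> rot K" and u: "u \<in> nbrs K v"
  shows "lift_map f (sheet_vertex K v u) = sheet_vertex K (f v) (f u)"
proof -
  have nb: "f w \<in> nbrs K (f v)" if "w \<in> nbrs K v" for w
    using rot_edges(4)[OF f[OF nxt_rot[OF that]]] by (simp add: nbrs_def)
  have it: "(nxt K (f v) ^^ i) (f u) = f ((nxt K v ^^ i) u)" for i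
  proof (induction i)
    case (Suc i)
    have "nxt K (f v) (f ((nxt K v ^^ i) u)) = f (nxt K v ((nxt K v ^^ i) u))"
      by (rule nxt_eq[OF f[OF nxt_rot[OF nxt_funpow_nbrs[OF u]]]])
    then show ?case using Suc by simp
  qed simp
  have "f ` range (\<lambda>i. (nxt K v ^^ i) u) = range (\<lambda>i. (nxt K (f v) ^^ i) (f u))"
    unfolding it by (simp add: image_image)
  then show ?thesis
    unfolding lift_map_def sheet_vertex_def conn_class_link[OF u] conn_class_link[OF nb[OF u]] by simp
qed

lemma lift_map_edges:
  assumes f: "\<And>a b c. (a, b, c) \<in> rot K \<Longrightarrow> (f a, f b, f c) \<in> rot K"
    and e: "{A, B} \<in> edges (desingularize K)"
  shows "{lift_map f A, lift_map f B} \<in> edges (desingularize K)"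
proof -
  have "B \<in> nbrs (desingularize K) A" using e by (simp add: nbrs_def)
  then obtain a b where ab: "b \<in> nbrs K a" "A = sheet_vertex K a b" "B = sheet_vertex K b a"
    by (rule nbrs_desingularize)
  have ba: "a \<in> nbrs K b" using ab(1) nbrs_sym by blast
  have "f b \<in> nbrs K (f a)"
    using rot_edges(4)[OF f[OF nxt_rot[OF ab(1)]]] by (simp add: nbrs_def)
  then show ?thesis
    using nbrs_desingularizeI[of "f b" "f a"] lift_map_sheet_vertex[OF f ab(1)] lift_map_sheet_vertex[OF f ba]
    unfolding ab(2,3) nbrs_def by simp
qed

text \<open>Edge paths go to edge paths, so one vertex that stays in the component keeps all others
  there.\<close>

lemma lift_map_conn_class:
  assumes f: "\<And>a b c. (a, b, c) \<in> rot K \<Longrightarrow> (f a, f b, f c) \<in> rot K"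
    and A: "A \<in> conn_class (desingularize K) U" "lift_map f A \<in> conn_class (desingularize K) U"
    and B: "B \<in> conn_class (desingularize K) U"
  shows "lift_map f B \<in> conn_class (desingularize K) U"
proof -
  let ?Y = "desingularize K"
  interpret Y: oriented_complex ?Y by (rule oriented_complex_desingularize)
  have "B \<in> conn_class ?Y A" using B Y.conn_class_eq[OF A(1)] by simp
  then have "(A, B) \<in> {(a, b). {a, b} \<in> edges ?Y}\<^sup>*" by (simp add: conn_class_def)
  then show ?thesis
  proof (induction rule: rtrancl_induct)
    case base
    show ?case by (rule A(2))
  next
    case (step C D)
    have "{lift_map f C, lift_map f D} \<in> edges ?Y"
      by (rule lift_map_edges[OF f]) (use step(2) in auto)
    then show ?case using Y.conn_class_edge step.IH by blast
  qed
qed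

end


section \<open>The complexes of a group\<close>

locale finite_group = group G for G (structure) +
  assumes fin: "finite (carrier G)"
begin

definition noncomm :: "'a \<Rightarrow> 'a \<Rightarrow> bool" where
  "noncomm x y \<longleftrightarrow> x \<in> carrier G \<and> y \<in> carrier G \<and> x \<otimes> y \<noteq> y \<otimes> x"

definition cj :: "'a \<Rightarrow> 'a \<Rightarrow> 'a" where
  "cj h g = h \<otimes> g \<otimes> inv h"

definition cjv :: "'a \<Rightarrow> 'a \<times> nat \<Rightarrow> 'a \<times> nat" where
  "cjv h v = (cj h (fst v), snd v)"

lemma cancel [simp]:
  "x \<in> carrier G \<Longrightarrow> z \<in> carrier G \<Longrightarrow> inv x \<otimes> (x \<otimes> z) = z"
  "x \<in> carrier G \<Longrightarrow> z \<in> carrier G \<Longrightarrow> x \<otimes> (inv x \<otimes> z) = z"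
  by (simp_all flip: m_assoc)

lemma cj_closed [simp]: "h \<in> carrier G \<Longrightarrow> g \<in> carrier G \<Longrightarrow> cj h g \<in> carrier G"
  by (simp add: cj_def)

lemma cj_mult: "h \<in> carrier G \<Longrightarrow> a \<in> carrier G \<Longrightarrow> b \<in> carrier G \<Longrightarrow> cj h (a \<otimes> b) = cj h a \<otimes> cj h b"
  by (simp add: cj_def m_assoc)

lemma cj_cj: "h \<in> carrier G \<Longrightarrow> k \<in> carrier G \<Longrightarrow> g \<in> carrier G \<Longrightarrow> cj h (cj k g) = cj (h \<otimes> k) g"
  by (simp add: cj_def m_assoc inv_mult_group)

lemma cj_one [simp]: "g \<in> carrier G \<Longrightarrow> cj \<one> g = g"
  by (simp add: cj_def)

lemma cj_inv [simp]:
  "h \<in> carrier G \<Longrightarrow> g \<in> carrier G \<Longrightarrow> cj h (cj (inv h) g) = g"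
  "h \<in> carrier G \<Longrightarrow> g \<in> carrier G \<Longrightarrow> cj (inv h) (cj h g) = g"
  by (simp_all add: cj_cj)

lemma cj_self [simp]: "h \<in> carrier G \<Longrightarrow> cj h h = h"
  by (simp add: cj_def m_assoc)

lemma cj_inj: "h \<in> carrier G \<Longrightarrow> a \<in> carrier G \<Longrightarrow> b \<in> carrier G \<Longrightarrow> cj h a = cj h b \<longleftrightarrow> a = b"
  by (metis cj_inv(2))

lemma noncomm_carrier: "noncomm x y \<Longrightarrow> x \<in> carrier G" "noncomm x y \<Longrightarrow> y \<in> carrier G"
  by (auto simp: noncomm_def)

lemma noncomm_sym: "noncomm x y \<Longrightarrow> noncomm y x"
  by (auto simp: noncomm_def)

lemma noncomm_cj: "h \<in> carrier G \<Longrightarrow> noncomm x y \<Longrightarrow> noncomm (cj h x) (cj h y)"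
  unfolding noncomm_def using cj_inj[of h "x \<otimes> y" "y \<otimes> x"] by (simp add: cj_mult)

text \<open>Cancelling a factor reduces commutation with the product to commutation of
  \<open>x\<close> and \<open>y\<close>. This puts the two edges of a triangle that end at its type
  2 vertex into \<open>X\<close>.\<close>

lemma noncomm_mult:
  assumes "noncomm x y"
  shows "noncomm x (x \<otimes> y)" "noncomm y (x \<otimes> y)"
proof -
  have c: "x \<in> carrier G" "y \<in> carrier G" "x \<otimes> y \<noteq> y \<otimes> x" using assms by (auto simp: noncomm_def)
  have "x \<otimes> y \<otimes> x = x \<otimes> (y \<otimes> x)" "y \<otimes> (x \<otimes> y) = y \<otimes> x \<otimes> y"
    using c(1,2) by (simp_all add: m_assoc)
  then have "x \<otimes> (x \<otimes> y) \<noteq> x \<otimes> y \<otimes> x" "y \<otimes> (x \<otimes> y) \<noteq> x \<otimes> y \<otimes> y"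
    using c by (metis cancel(1) m_closed, metis right_cancel m_closed)
  then show "noncomm x (x \<otimes> y)" "noncomm y (x \<otimes> y)" using c(1,2) by (simp_all add: noncomm_def)
qed

text \<open>The solutions of \<open>x \<otimes> v = z\<close> here, and of
  \<open>u \<otimes> x = z\<close> in the next lemma, complete an edge between types 1 and 2 to a
  triangle; for this they must not commute with \<open>x\<close>.\<close>

lemma noncomm_ldiv:
  assumes "noncomm x z"
  shows "noncomm x (inv x \<otimes> z)"
proof -
  have c: "x \<in> carrier G" "z \<in> carrier G" using assms by (auto simp: noncomm_def)
  have "inv x \<otimes> z \<otimes> x \<noteq> z"
  proof
    assume "inv x \<otimes> z \<otimes> x = z"
    then have "x \<otimes> (inv x \<otimes> z \<otimes> x) = x \<otimes> z" by simp
    then show False using c assms by (simp add: noncomm_def m_assoc)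
  qed
  then show ?thesis using c by (auto simp: noncomm_def)
qed

lemma noncomm_rdiv:
  assumes "noncomm x z"
  shows "noncomm (z \<otimes> inv x) x"
proof -
  have c: "x \<in> carrier G" "z \<in> carrier G" using assms by (auto simp: noncomm_def)
  have "x \<otimes> (z \<otimes> inv x) \<noteq> z"
  proof
    assume "x \<otimes> (z \<otimes> inv x) = z"
    then have "x \<otimes> (z \<otimes> inv x) \<otimes> x = z \<otimes> x" by simp
    then show False using c assms by (simp add: noncomm_def m_assoc)
  qed
  then show ?thesis using c by (auto simp: noncomm_def m_assoc)
qed

section \<open>The complex of the group as an oriented complex\<close>

abbreviation X :: "('a \<times> nat) complex2" where "X \<equiv> X_complex G"

lemma verts_X: "verts X = (carrier G - group_center G) \<times> {1, 2}"
  by (simp add: X_complex_def Let_def)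

lemma noncomm_noncentral: "noncomm x y \<Longrightarrow> x \<in> carrier G - group_center G"
  by (auto simp: noncomm_def group_center_def)

lemma edges_X: "{(a, i), (b, j)} \<in> edges X \<longleftrightarrow>
  noncomm a b \<and> (i = 1 \<and> j = 1 \<or> i = 1 \<and> j = 2 \<or> i = 2 \<and> j = 1)"
proof
  assume "{(a, i), (b, j)} \<in> edges X"
  then obtain x y k where k: "{(a, i), (b, j)} = {(x, 1), (y, k)}" "noncomm x y" "k = 1 \<or> k = 2"
    unfolding X_complex_def Let_def noncomm_def by auto
  then show "noncomm a b \<and> (i = 1 \<and> j = 1 \<or> i = 1 \<and> j = 2 \<or> i = 2 \<and> j = 1)"
    using noncomm_sym by (auto simp: doubleton_eq_iff)
next
  assume *: "noncomm a b \<and> (i = 1 \<and> j = 1 \<or> i = 1 \<and> j = 2 \<or> i = 2 \<and> j = 1)"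
  have E: "{(x, 1), (y, k)} \<in> edges X" if "noncomm x y" "k = 1 \<or> k = 2" for x y k
    using that unfolding X_complex_def Let_def noncomm_def by auto
  have "{(b, 1), (a, 2)} \<in> edges X" using E[OF noncomm_sym] * by simp
  then have "{(a, 2), (b, 1)} \<in> edges X" by (simp add: insert_commute)
  then show "{(a, i), (b, j)} \<in> edges X" using * E[of a b 1] E[of a b 2] by auto
qed

lemma edges_X_cases:
  assumes "e \<in> edges X"
  obtains x y k where "e = {(x, 1), (y, k)}" "noncomm x y" "k = 1 \<or> k = 2"
  using assms unfolding X_complex_def Let_def noncomm_def by auto

lemma tris_X: "t \<in> tris X \<longleftrightarrow> (\<exists>x y. noncomm x y \<and> t = ((x, 1), (y, 1), (x \<otimes> y, 2)))"
  unfolding X_complex_def Let_def noncomm_def by auto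

lemma wf_X: "wf_complex2 X"
proof (rule wf_complex2I)
  show "finite (verts X)" using fin by (simp add: verts_X)
next
  fix e assume "e \<in> edges X"
  then obtain x y k where e: "e = {(x, 1), (y, k)}" "noncomm x y" "k = 1 \<or> k = 2"
    by (rule edges_X_cases)
  have "x \<noteq> y" using e(2) by (auto simp: noncomm_def)
  then show "e \<subseteq> verts X \<and> card e = 2"
    using e noncomm_noncentral[OF e(2)] noncomm_noncentral[OF noncomm_sym[OF e(2)]] by (auto simp: verts_X)
next
  fix t assume "t \<in> tris X"
  then obtain x y where t: "noncomm x y" "t = ((x, 1), (y, 1), (x \<otimes> y, 2))" by (auto simp: tris_X)
  have ts: "tri_set t = {(x, 1), (y, 1), (x \<otimes> y, 2)}" using t by (simp add: tri_set_def)
  note n = noncomm_mult[OF t(1)]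
  have "x \<noteq> y" using t(1) by (auto simp: noncomm_def)
  then have "card (tri_set t) = 3" unfolding ts card3_iff by simp
  moreover have "tri_set t \<subseteq> verts X"
    using noncomm_noncentral[OF t(1)] noncomm_noncentral[OF noncomm_sym[OF t(1)]]
      noncomm_noncentral[OF noncomm_sym[OF n(1)]] by (simp add: ts verts_X)
  moreover have "e \<in> edges X" if "e \<subseteq> tri_set t" "card e = 2" for e
    using card2_subset3[OF that(1)[unfolded ts] that(2)] t(1) n
    by (elim disjE) (simp_all add: edges_X)
  ultimately show "tri_set t \<subseteq> verts X \<and> card (tri_set t) = 3 \<and>
    (\<forall>e. e \<subseteq> tri_set t \<and> card e = 2 \<longrightarrow> e \<in> edges X)" by blast
qed

text \<open>The type 2 vertex of a triangle tells the orders \<open>(x, y)\<close> and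
  \<open>(y, x)\<close> apart. A directed edge is of one of three kinds, each of which prescribes
  two entries of \<open>u \<otimes> v = w\<close> and so the triangle.\<close>

lemma coherent_X: "coherently_oriented X"
proof (rule coherently_orientedI)
  show "inj_on tri_set (tris X)"
  proof (rule inj_onI)
    fix t t' assume t: "t \<in> tris X" "t' \<in> tris X" "tri_set t = tri_set t'"
    obtain x y where 1: "noncomm x y" "t = ((x, 1), (y, 1), (x \<otimes> y, 2))" using t(1) by (auto simp: tris_X)
    obtain u v where 2: "noncomm u v" "t' = ((u, 1), (v, 1), (u \<otimes> v, 2))" using t(2) by (auto simp: tris_X)
    have eq: "{(x, 1), (y, 1), (x \<otimes> y, 2)} = {(u, 1), (v, 1), (u \<otimes> v, 2 :: nat)}"
      using t(3) 1 2 by (simp add: tri_set_def)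
    have "(x \<otimes> y, 2) \<in> {(u, 1), (v, 1), (u \<otimes> v, 2 :: nat)}" unfolding eq[symmetric] by simp
    then have xy: "x \<otimes> y = u \<otimes> v" by simp
    have "(x, 1) \<in> {(u, 1), (v, 1), (u \<otimes> v, 2 :: nat)}" "(y, 1) \<in> {(u, 1), (v, 1), (u \<otimes> v, 2 :: nat)}"
      unfolding eq[symmetric] by simp_all
    then have "x = u \<or> x = v" "y = u \<or> y = v" by simp_all
    moreover have "x \<noteq> y" using 1(1) by (auto simp: noncomm_def)
    moreover have "\<not> (x = v \<and> y = u)" using xy 1(1) by (auto simp: noncomm_def)
    ultimately have "x = u \<and> y = v" by blast
    then show "t = t'" using 1 2 by simp
  qed
next
  fix a b assume ab: "{a, b} \<in> edges X"
  obtain x i where a: "a = (x, i)" by (cases a)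
  obtain y j where b: "b = (y, j)" by (cases b)
  have n: "noncomm x y" "i = 1 \<and> j = 1 \<or> i = 1 \<and> j = 2 \<or> i = 2 \<and> j = 1"
    using ab by (auto simp: a b edges_X)
  have c: "x \<in> carrier G" "y \<in> carrier G" using n(1) by (auto simp: noncomm_def)
  have I: "((u, 1), (v, 1), (w, 2)) \<in> tris X" if "noncomm u v" "w = u \<otimes> v" for u v w
    using that by (auto simp: tris_X)
  have D: "\<exists>u v. noncomm u v \<and> t = ((u, 1), (v, 1), (u \<otimes> v, 2)) \<and>
      (a, b) \<in> {((u, 1), (v, 1)), ((v, 1), (u \<otimes> v, 2)), ((u \<otimes> v, 2), (u, 1))}"
    if "t \<in> tris X \<and> (a, b) \<in> boundary_arcs t" for t
    using that by (auto simp: tris_X boundary_arcs_def)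
  consider "i = 1" "j = 1" | "i = 1" "j = 2" | "i = 2" "j = 1" using n(2) by blast
  then show "\<exists>!t. t \<in> tris X \<and> (a, b) \<in> boundary_arcs t"
  proof cases
    case 1
    show ?thesis
    proof (rule ex1I[of _ "((x, 1), (y, 1), (x \<otimes> y, 2))"])
      show "((x, 1), (y, 1), (x \<otimes> y, 2)) \<in> tris X \<and> (a, b) \<in> boundary_arcs ((x, 1), (y, 1), (x \<otimes> y, 2))"
        using I[OF n(1)] by (simp add: boundary_arcs_def a b 1)
      fix t assume "t \<in> tris X \<and> (a, b) \<in> boundary_arcs t"
      then show "t = ((x, 1), (y, 1), (x \<otimes> y, 2))" using D[of t] by (auto simp: a b 1)
    qed
  next
    case 2
    have yx: "y \<otimes> inv x \<otimes> x = y" using c by (simp add: m_assoc)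
    show ?thesis
    proof (rule ex1I[of _ "((y \<otimes> inv x, 1), (x, 1), (y, 2))"])
      show "((y \<otimes> inv x, 1), (x, 1), (y, 2)) \<in> tris X \<and>
          (a, b) \<in> boundary_arcs ((y \<otimes> inv x, 1), (x, 1), (y, 2))"
        using I[OF noncomm_rdiv[OF n(1)] yx[symmetric]] by (simp add: boundary_arcs_def a b 2)
      fix t assume "t \<in> tris X \<and> (a, b) \<in> boundary_arcs t"
      then obtain u where "noncomm u x" "t = ((u, 1), (x, 1), (u \<otimes> x, 2))" "y = u \<otimes> x"
        using D[of t] by (auto simp: a b 2)
      moreover have "u = u \<otimes> x \<otimes> inv x" using calculation(1) by (simp add: noncomm_def m_assoc)
      ultimately show "t = ((y \<otimes> inv x, 1), (x, 1), (y, 2))" by simp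
    qed
  next
    case 3
    have yx: "y \<otimes> (inv y \<otimes> x) = x" using c by simp
    show ?thesis
    proof (rule ex1I[of _ "((y, 1), (inv y \<otimes> x, 1), (x, 2))"])
      show "((y, 1), (inv y \<otimes> x, 1), (x, 2)) \<in> tris X \<and>
          (a, b) \<in> boundary_arcs ((y, 1), (inv y \<otimes> x, 1), (x, 2))"
        using I[OF noncomm_ldiv[OF noncomm_sym[OF n(1)]] yx[symmetric]] by (simp add: boundary_arcs_def a b 3)
      fix t assume "t \<in> tris X \<and> (a, b) \<in> boundary_arcs t"
      then obtain v where "noncomm y v" "t = ((y, 1), (v, 1), (y \<otimes> v, 2))" "x = y \<otimes> v"
        using D[of t] by (auto simp: a b 3)
      moreover have "v = inv y \<otimes> (y \<otimes> v)" using calculation(1) by (simp add: noncomm_def)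
      ultimately show "t = ((y, 1), (inv y \<otimes> x, 1), (x, 2))" by simp
    qed
  qed
qed

sublocale X: oriented_complex X
  by unfold_locales (rule wf_X coherent_X)+

abbreviation Y :: "'a yvertex complex2" where "Y \<equiv> Y_complex G"

sublocale Y: oriented_surface Y
  unfolding Y_complex_def by (rule X.oriented_surface_desingularize)

lemma rot_X: "noncomm x y \<Longrightarrow> ((x, 1), (y, 1), (x \<otimes> y, 2)) \<in> rot X"
  by (rule tris_rot) (auto simp: tris_X)

lemma rot_X_cases:
  assumes "(a, b, c) \<in> rot X"
  obtains x y where "noncomm x y"
    "(a, b, c) \<in> {((x, 1), (y, 1), (x \<otimes> y, 2)), ((y, 1), (x \<otimes> y, 2), (x, 1)), ((x \<otimes> y, 2), (x, 1), (y, 1))}"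
  using assms unfolding rot_def tris_X by auto

lemma rot_X_cj:
  assumes h: "h \<in> carrier G" and r: "(a, b, c) \<in> rot X"
  shows "(cjv h a, cjv h b, cjv h c) \<in> rot X"
proof -
  obtain x y where xy: "noncomm x y"
    "(a, b, c) \<in> {((x, 1), (y, 1), (x \<otimes> y, 2)), ((y, 1), (x \<otimes> y, 2), (x, 1)), ((x \<otimes> y, 2), (x, 1), (y, 1))}"
    using r by (rule rot_X_cases)
  have c: "x \<in> carrier G" "y \<in> carrier G" using xy(1) by (auto simp: noncomm_def)
  have R: "((cj h x, 1), (cj h y, 1), (cj h (x \<otimes> y), 2)) \<in> rot X"
    using rot_X[OF noncomm_cj[OF h xy(1)]] cj_mult[OF h c] by simp
  show ?thesis
    using xy(2) R rot_cyc[OF R] rot_cyc[OF rot_cyc[OF R]] by (auto simp: cjv_def)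
qed

text \<open>The vertices \<open>P u v\<close>, \<open>P v u\<close> and \<open>W u v\<close> are those of the triangle of \<open>Y_complex G\<close>
  which lies over \<open>[(u, 1), (v, 1), (uv, 2)]\<close>.\<close>

definition P :: "'a \<Rightarrow> 'a \<Rightarrow> 'a yvertex" where
  "P u v = sheet_vertex X (u, 1) (v, 1)"

definition W :: "'a \<Rightarrow> 'a \<Rightarrow> 'a yvertex" where
  "W u v = sheet_vertex X (u \<otimes> v, 2) (u, 1)"

lemma fst_P [simp]: "fst (P u v) = (u, 1)" and fst_W [simp]: "fst (W u v) = (u \<otimes> v, 2)"
  by (simp_all add: P_def W_def)

lemma vtype_P [simp]: "vtype (P u v) = 1" and vtype_W [simp]: "vtype (W u v) = 2"
  by (simp_all add: vtype_def)

lemma P_neq_W [simp]: "P u v \<noteq> W u' v'" "W u' v' \<noteq> P u v"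
  by (metis vtype_P vtype_W numeral_One numeral_eq_iff semiring_norm(85))+

lemma nbrs_X: "(b, j) \<in> nbrs X (a, i) \<longleftrightarrow>
  noncomm a b \<and> (i = 1 \<and> j = 1 \<or> i = 1 \<and> j = 2 \<or> i = 2 \<and> j = 1)"
  by (simp add: nbrs_def edges_X)

lemma sheet_vertex_12:
  assumes "noncomm u v"
  shows "sheet_vertex X (v, 1) (u \<otimes> v, 2) = P v u" "sheet_vertex X (u, 1) (u \<otimes> v, 2) = P u v"
    "sheet_vertex X (u \<otimes> v, 2) (v, 1) = W u v"
  using X.sv_rot2[OF rot_X[OF assms]] X.sv_rot[OF rot_X[OF assms]] by (simp_all add: P_def W_def)

lemma lift_X: "noncomm u v \<Longrightarrow> lift_tri X ((u, 1), (v, 1), (u \<otimes> v, 2)) = (P u v, P v u, W u v)"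
  using sheet_vertex_12 by (simp add: lift_tri_def) (simp add: P_def W_def)

lemma tris_Y: "t \<in> tris Y \<longleftrightarrow> (\<exists>u v. noncomm u v \<and> t = (P u v, P v u, W u v))"
  unfolding Y_complex_def X.tris_desingularize image_iff Bex_def tris_X using lift_X by metis

lemma rot_Y: "noncomm u v \<Longrightarrow> (P u v, P v u, W u v) \<in> rot Y"
  by (rule tris_rot) (auto simp: tris_Y)

lemma rot_Y_cases:
  assumes "(A, B, C) \<in> rot Y"
  obtains u v where "noncomm u v"
    "(A, B, C) \<in> {(P u v, P v u, W u v), (P v u, W u v, P u v), (W u v, P u v, P v u)}"
  using assms unfolding rot_def tris_Y by auto

text \<open>The pairs \<open>(u, v)\<close> and \<open>(cj u v, u)\<close> have the same product, so
  their triangles share the edge between \<open>(u, 1)\<close> and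
  \<open>(u \<otimes> v, 2)\<close>; the vertex over \<open>(u, 1)\<close> on it can be named from
  either triangle.\<close>

lemma P_conj: "noncomm u v \<Longrightarrow> P u (cj u v) = P u v"
proof -
  assume n: "noncomm u v"
  have c: "u \<in> carrier G" "v \<in> carrier G" using n by (auto simp: noncomm_def)
  have n': "noncomm (cj u v) u" using noncomm_sym[OF noncomm_cj[OF c(1) n]] c by simp
  have e: "cj u v \<otimes> u = u \<otimes> v" using c by (simp add: cj_def m_assoc)
  show ?thesis using sheet_vertex_12(1)[OF n'] sheet_vertex_12(2)[OF n] unfolding e by simp
qed

text \<open>The same common edge, now seen from its type 2 end.\<close>

lemma W_rotate: "noncomm u v \<Longrightarrow> W (cj u v) u = W u v"
proof -
  assume n: "noncomm u v"
  have c: "u \<in> carrier G" "v \<in> carrier G" using n by (auto simp: noncomm_def)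
  have n': "noncomm (cj u v) u" using noncomm_sym[OF noncomm_cj[OF c(1) n]] c by simp
  have e: "cj u v \<otimes> u = u \<otimes> v" using c by (simp add: cj_def m_assoc)
  show ?thesis using sheet_vertex_12(3)[OF n'] unfolding e by (simp add: W_def)
qed

definition act :: "'a \<Rightarrow> 'a yvertex \<Rightarrow> 'a yvertex" where
  "act h = lift_map (cjv h)"

lemma act_P: "h \<in> carrier G \<Longrightarrow> noncomm u v \<Longrightarrow> act h (P u v) = P (cj h u) (cj h v)"
  unfolding act_def P_def
  using X.lift_map_sheet_vertex[of "cjv h", OF rot_X_cj, of "(v, 1)" "(u, 1)"] by (simp add: nbrs_X cjv_def)

lemma act_W: "h \<in> carrier G \<Longrightarrow> noncomm u v \<Longrightarrow> act h (W u v) = W (cj h u) (cj h v)"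
  unfolding act_def W_def
  using X.lift_map_sheet_vertex[of "cjv h", OF rot_X_cj, of "(u, 1)" "(u \<otimes> v, 2)"] noncomm_sym[OF noncomm_mult(1)[of u v]]
    cj_mult[of h u v]
  by (simp add: nbrs_X cjv_def noncomm_def)

lemma Y_vertex_cases:
  assumes "A \<in> verts Y"
  obtains (P) u v where "noncomm u v" "A = P u v" | (W) u v where "noncomm u v" "A = W u v"
proof -
  obtain B where "B \<in> nbrs Y A" using Y.nonisolated[OF assms] by blast
  then have r: "(A, B, nxt Y A B) \<in> rot Y" by (rule Y.nxt_rot)
  then obtain u v where "noncomm u v"
    "(A, B, nxt Y A B) \<in> {(P u v, P v u, W u v), (P v u, W u v, P u v), (W u v, P u v, P v u)}"
    by (rule rot_Y_cases)
  then show ?thesis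
    using that(1)[of u v] that(1)[of v u] that(2)[of u v] noncomm_sym[of u v] by auto
qed

lemma act_act:
  assumes "h \<in> carrier G" "k \<in> carrier G" "A \<in> verts Y"
  shows "act h (act k A) = act (h \<otimes> k) A"
  using assms(3)
proof (cases rule: Y_vertex_cases)
  case (P u v)
  then show ?thesis
    using assms(1,2) noncomm_cj[OF assms(2) P(1)] noncomm_carrier[OF P(1)] by (simp add: act_P cj_cj)
next
  case (W u v)
  then show ?thesis
    using assms(1,2) noncomm_cj[OF assms(2) W(1)] noncomm_carrier[OF W(1)] by (simp add: act_W cj_cj)
qed

lemma act_one: "A \<in> verts Y \<Longrightarrow> act \<one> A = A"
  by (erule Y_vertex_cases) (simp_all add: act_P act_W noncomm_carrier)

lemma edges_Y_11:
  assumes "{A, B} \<in> edges Y" "vtype A = 1" "vtype B = 1"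
  obtains u v where "noncomm u v" "A = P u v" "B = P v u"
proof -
  obtain C where r: "(A, B, C) \<in> rot Y" using assms(1) by (rule Y.rot_ex)
  obtain u v where "noncomm u v"
    "(A, B, C) \<in> {(P u v, P v u, W u v), (P v u, W u v, P u v), (W u v, P u v, P v u)}"
    using r by (rule rot_Y_cases)
  then show ?thesis using that assms(2,3) by auto
qed

text \<open>The link of \<open>(u, 1)\<close> alternates between the types: from
  \<open>(v, 1)\<close> it goes to \<open>(u \<otimes> v, 2)\<close> and on to
  \<open>(cj u v, 1)\<close>. Two turns are one conjugation by \<open>u\<close>, and an odd number
  of turns ends at type 2.\<close>

lemma P_eq_iff:
  assumes "noncomm u v" "noncomm u' v'"
  shows "P u v = P u' v' \<longleftrightarrow> u = u' \<and> (\<exists>i. v' = (cj u ^^ i) v)"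
proof -
  have nb: "(v, 1) \<in> nbrs X (u, 1)" "(v', 1) \<in> nbrs X (u', 1)" using assms by (simp_all add: nbrs_X)
  have n2: "nxt X (u, 1) (nxt X (u, 1) (w, 1)) = (cj u w, 1)" "nxt X (u, 1) (w, 1) = (u \<otimes> w, 2)"
    if w: "noncomm u w" for w
  proof -
    have c: "u \<in> carrier G" "w \<in> carrier G" using w by (auto simp: noncomm_def)
    show 1: "nxt X (u, 1) (w, 1) = (u \<otimes> w, 2)" by (rule X.nxt_eq[OF rot_X[OF w]])
    have n': "noncomm (cj u w) u" using noncomm_sym[OF noncomm_cj[OF c(1) w]] c by simp
    have e: "cj u w \<otimes> u = u \<otimes> w" using c by (simp add: cj_def m_assoc)
    show "nxt X (u, 1) (nxt X (u, 1) (w, 1)) = (cj u w, 1)"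
      unfolding 1 using X.nxt_eq[OF rot_cyc[OF rot_X[OF n']]] unfolding e .
  qed
  have it: "(nxt X (u, 1) ^^ (2 * i)) (v, 1) = ((cj u ^^ i) v, 1) \<and> noncomm u ((cj u ^^ i) v)" for i
  proof (induction i)
    case 0
    then show ?case using assms(1) by simp
  next
    case (Suc i)
    let ?w = "(cj u ^^ i) v"
    have w: "noncomm u ?w" using Suc by blast
    have c: "u \<in> carrier G" using w by (auto simp: noncomm_def)
    have "noncomm (cj u u) (cj u ?w)" by (rule noncomm_cj[OF c w])
    moreover have "(nxt X (u, 1) ^^ (2 * Suc i)) (v, 1) = nxt X (u, 1) (nxt X (u, 1) ((nxt X (u, 1) ^^ (2 * i)) (v, 1)))"
      by simp
    ultimately show ?case using Suc n2(1)[OF w] c by simp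
  qed
  have odd: "snd ((nxt X (u, 1) ^^ Suc (2 * i)) (v, 1)) = 2" for i
    using it[of i] n2(2)[of "(cj u ^^ i) v"] by simp
  show ?thesis
  proof
    assume "P u v = P u' v'"
    then obtain i where i: "u = u'" "(v', 1) = (nxt X (u, 1) ^^ i) (v, 1)"
      using X.sv_eq_iff[OF nb] unfolding P_def by blast
    have "even i"
    proof (rule ccontr)
      assume "odd i"
      then obtain k where "i = 2 * k + 1" by (rule oddE)
      then have "(v', 1) = (nxt X (u, 1) ^^ Suc (2 * k)) (v, 1)" using i(2) by (simp only: Suc_eq_plus1)
      then have "snd (v', 1 :: nat) = 2" using odd[of k] by metis
      then show False by simp
    qed
    then obtain k where "i = 2 * k" by (rule evenE)
    then have "v' = (cj u ^^ k) v" using it[of k] i(2) by simp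
    then show "u = u' \<and> (\<exists>i. v' = (cj u ^^ i) v)" using i(1) by blast
  next
    assume "u = u' \<and> (\<exists>i. v' = (cj u ^^ i) v)"
    then obtain i where i: "u = u'" "v' = (cj u ^^ i) v" by blast
    then have "(v', 1) = (nxt X (u, 1) ^^ (2 * i)) (v, 1)" using it[of i] by simp
    then show "P u v = P u' v'" using X.sv_eq_iff[OF nb] i(1) unfolding P_def by blast
  qed
qed

lemma nxt_type2: "noncomm u v \<Longrightarrow> nxt X (u \<otimes> v, 2) (u, 1) = (v, 1)"
  by (rule X.nxt_eq[OF rot_cyc[OF rot_cyc[OF rot_X]]])

end

section \<open>The component of a noncommuting pair\<close>

locale noncommuting_pair = finite_group +
  fixes x y
  assumes xy: "noncomm x y"
begin

lemma x_in [simp]: "x \<in> carrier G" and y_in [simp]: "y \<in> carrier G"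
  using xy by (auto simp: noncomm_def)

definition C :: "'a yvertex set" where "C = conn_class Y (P x y)"

definition T :: "'a yvertex complex2" where "T = full_subcomplex Y C"

lemma P_verts: "P x y \<in> verts Y"
  by (rule Y.rot_edges(7)[OF rot_Y[OF xy]])

sublocale T: closed_surface T
  unfolding T_def C_def by (rule Y.closed_surface_component(1)[OF P_verts])

lemma verts_T: "verts T = C"
  unfolding T_def C_def by (rule Y.closed_surface_component(5)[OF P_verts])

lemma rot_T: "rot T = {(a, b, c) \<in> rot Y. a \<in> C}"
  unfolding T_def C_def by (rule Y.closed_surface_component(2)[OF P_verts])

lemma C_verts: "C \<subseteq> verts Y"
  unfolding C_def conn_class_def by auto

lemma finite_C: "finite C"
  using C_verts Y.finite_verts by (rule finite_subset)

lemma P_C: "P x y \<in> C"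
  unfolding C_def by (rule conn_class_refl[OF P_verts])

lemma C_edge: "A \<in> C \<Longrightarrow> {A, B} \<in> edges Y \<Longrightarrow> B \<in> C"
  unfolding C_def by (rule Y.conn_class_edge)

lemma edges_T: "e \<in> edges T \<longleftrightarrow> e \<in> edges Y \<and> e \<subseteq> C"
  by (auto simp: T_def full_subcomplex_def)

lemma tris_T: "t \<in> tris T \<longleftrightarrow> (\<exists>u v. noncomm u v \<and> P u v \<in> C \<and> t = (P u v, P v u, W u v))"
proof
  assume t: "t \<in> tris T"
  then obtain u v where uv: "noncomm u v" "t = (P u v, P v u, W u v)"
    by (auto simp: T_def full_subcomplex_def tris_Y)
  then have "P u v \<in> C" using t by (simp add: T_def full_subcomplex_def tri_set_def)
  then show "\<exists>u v. noncomm u v \<and> P u v \<in> C \<and> t = (P u v, P v u, W u v)" using uv by blast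
next
  assume "\<exists>u v. noncomm u v \<and> P u v \<in> C \<and> t = (P u v, P v u, W u v)"
  then obtain u v where uv: "noncomm u v" "P u v \<in> C" "t = (P u v, P v u, W u v)" by blast
  have t: "t \<in> tris Y" using uv by (auto simp: tris_Y)
  have "P u v \<in> tri_set t" by (simp add: uv tri_set_def)
  then have "tri_set t \<subseteq> C" using Y.tri_conn_class[OF t] uv(2) unfolding C_def by blast
  then show "t \<in> tris T" using t by (simp add: T_def full_subcomplex_def)
qed

lemma tri_C:
  assumes "noncomm u v"
  shows "P u v \<in> C \<longleftrightarrow> W u v \<in> C" "P u v \<in> C \<longleftrightarrow> P v u \<in> C"
proof -
  note E = Y.rot_edges(4-6)[OF rot_Y[OF assms]]
  have "{W u v, P u v} \<in> edges Y" "{P v u, P u v} \<in> edges Y" using E(1,3) by (simp_all add: insert_commute)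
  then show "P u v \<in> C \<longleftrightarrow> W u v \<in> C" "P u v \<in> C \<longleftrightarrow> P v u \<in> C"
    using E C_edge by blast+
qed

definition good :: "'a \<Rightarrow> 'a \<Rightarrow> bool" where
  "good u v \<longleftrightarrow> (\<exists>h \<in> carrier G. (u = cj h x \<and> v = cj h y) \<or> (u = cj h y \<and> v = cj h x))"

lemma good_swap: "good u v \<Longrightarrow> good v u"
  unfolding good_def by blast

lemma good_cj:
  assumes k: "k \<in> carrier G" and g: "good u v"
  shows "good (cj k u) (cj k v)"
proof -
  obtain h where h: "h \<in> carrier G" "(u = cj h x \<and> v = cj h y) \<or> (u = cj h y \<and> v = cj h x)"
    using g unfolding good_def by blast
  then show ?thesis
    unfolding good_def using k cj_cj[OF k h(1)] by (intro bexI[of _ "k \<otimes> h"]) auto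
qed

lemma good_noncomm: "good u v \<Longrightarrow> noncomm u v"
  unfolding good_def using noncomm_cj[OF _ xy] noncomm_sym by blast

text \<open>Every triangle that shares an edge with the triangle of \<open>(u, v)\<close> is the triangle of a
  conjugate of \<open>(v, u)\<close>.\<close>

lemma good_pair:
  assumes uv: "noncomm u v" "P u v \<in> C"
  shows "good u v"
proof -
  define R where "R u v = {(P u v, P v u, W u v), (P v u, W u v, P u v), (W u v, P u v, P v u)}" for u v
  have rot_R: "f \<in> rot Y" if "noncomm u v" "f \<in> R u v" for f u v
    using that(2) rot_Y[OF that(1)] rot_cyc[OF rot_Y[OF that(1)]] rot_cyc[OF rot_cyc[OF rot_Y[OF that(1)]]]
    unfolding R_def by auto
  \<comment> \<open>A vertex of \<open>Y\<close> has several names, so the invariant only asserts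
    that some good pair names the triangle; the labels in the first components identify the pair at
    the end.\<close>
  define Q where "Q f \<longleftrightarrow> (\<exists>u v. good u v \<and> f \<in> R u v)" for f
  have Q1: "Q (P x y, P y x, W x y)"
    unfolding Q_def R_def good_def by (rule exI[of _ x], rule exI[of _ y]) (auto intro!: bexI[of _ \<one>])
  have r1: "(P x y, P y x, W x y) \<in> rot T" unfolding rot_T using rot_Y[OF xy] P_C by auto
  have r2: "(P u v, P v u, W u v) \<in> rot T" unfolding rot_T using rot_Y[OF uv(1)] uv(2) by auto
  have "Q (P u v, P v u, W u v)"
  proof (rule T.flag_induct[where P = Q, OF r1 Q1 _ _ r2])
    show "Q (b, c, a)" if "Q (a, b, c)" for a b c
      using that unfolding Q_def R_def by blast
    show "Q (b, a, d)" if r: "(b, a, d) \<in> rot T" and q: "Q (a, b, c)" for a b c d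
    proof -
      obtain u v where g: "good u v" and R: "(a, b, c) \<in> R u v" using q unfolding Q_def by blast
      have n: "noncomm u v" by (rule good_noncomm[OF g])
      have c: "u \<in> carrier G" "v \<in> carrier G" using n by (auto simp: noncomm_def)
      have rot: "(b, a, d) \<in> rot Y" using r unfolding rot_T by auto
      \<comment> \<open>The triangle across an edge is unique, so it suffices to exhibit a good pair
        whose triangle contains the reversed edge.\<close>
      have fin: "Q (b, a, d)" if "good u' v'" "(b, a, d') \<in> R u' v'" for u' v' d'
      proof -
        have "(b, a, d') \<in> rot Y" by (rule rot_R[OF good_noncomm[OF that(1)] that(2)])
        then have "d' = d" by (rule Y.rot_unique[OF _ rot])
        then show ?thesis using that unfolding Q_def by blast
      qed
      from R consider "a = P u v" "b = P v u" | "a = P v u" "b = W u v" | "a = W u v" "b = P u v"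
        unfolding R_def by auto
      then show ?thesis
      proof cases
        case 1
        then have "(b, a, W v u) \<in> R v u" unfolding R_def by simp
        then show ?thesis by (rule fin[OF good_swap[OF g]])
      next
        case 2
        \<comment> \<open>Conjugating \<open>(v, u)\<close> by \<open>inv v\<close> gives
          \<open>(v, ?w)\<close>, whose product is again \<open>u \<otimes> v\<close>.\<close>
        let ?w = "cj (inv v) u"
        have gw: "good v ?w"
          using good_cj[OF _ good_swap[OF g], of "inv v"] c by (simp add: cj_def m_assoc)
        have vw: "cj v ?w = u" using c by simp
        have "W v ?w = W u v" "P v ?w = P v u"
          using W_rotate[OF good_noncomm[OF gw]] P_conj[OF good_noncomm[OF gw]] unfolding vw by simp_all
        then have "(b, a, P ?w v) \<in> R v ?w" unfolding R_def 2 by simp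
        then show ?thesis by (rule fin[OF gw])
      next
        case 3
        \<comment> \<open>Conjugating \<open>(v, u)\<close> by \<open>u\<close> gives
          \<open>(?w, u)\<close>, again with product \<open>u \<otimes> v\<close>.\<close>
        let ?w = "cj u v"
        have gw: "good ?w u" using good_cj[OF _ good_swap[OF g], of u] c by simp
        have "W ?w u = W u v" "P u ?w = P u v" using W_rotate[OF n] P_conj[OF n] by simp_all
        then have "(b, a, P ?w u) \<in> R ?w u" unfolding R_def 3 by simp
        then show ?thesis by (rule fin[OF gw])
      qed
    qed
  qed
  then obtain u' v' where g: "good u' v'" "(P u v, P v u, W u v) \<in> R u' v'" unfolding Q_def by blast
  then have e: "P u v = P u' v'" "P v u = P v' u'" unfolding R_def by auto
  have "u = u'" "v = v'" using arg_cong[OF e(1), of fst] arg_cong[OF e(2), of fst] by simp_all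
  then show ?thesis using g(1) by simp
qed

subsection \<open>The stabilizer of the component\<close>

text \<open>Inclusion amounts to equality here, since \<open>act h\<close> is injective on vertices
  and \<open>C\<close> is finite.\<close>

definition H :: "'a set" where "H = {h \<in> carrier G. act h ` C \<subseteq> C}"

lemma H_in: "h \<in> H \<Longrightarrow> h \<in> carrier G"
  by (simp add: H_def)

lemma H_act: "h \<in> H \<Longrightarrow> A \<in> C \<Longrightarrow> act h A \<in> C"
  unfolding H_def by blast

lemma H_mult:
  assumes h: "h \<in> H" and k: "k \<in> H"
  shows "h \<otimes> k \<in> H"
proof -
  have "act (h \<otimes> k) A \<in> C" if A: "A \<in> C" for A
  proof -
    have "A \<in> verts Y" using A C_verts by blast
    then have "act (h \<otimes> k) A = act h (act k A)" using act_act[OF H_in[OF h] H_in[OF k]] by simp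
    then show ?thesis using H_act[OF h H_act[OF k A]] by simp
  qed
  then show ?thesis using H_in[OF h] H_in[OF k] unfolding H_def by blast
qed

lemma act_inv: "h \<in> carrier G \<Longrightarrow> A \<in> verts Y \<Longrightarrow> act (inv h) (act h A) = A"
  using act_act[of "inv h" h A] act_one by simp

lemma act_inj: "h \<in> carrier G \<Longrightarrow> inj_on (act h) (verts Y)"
  by (rule inj_on_inverseI[of _ "act (inv h)"]) (rule act_inv)

lemma H_surj: "h \<in> H \<Longrightarrow> act h ` C = C"
  using endo_inj_surj[OF finite_C _ inj_on_subset[OF act_inj[OF H_in] C_verts]] unfolding H_def by blast

lemma H_inv: "h \<in> H \<Longrightarrow> inv h \<in> H"
proof -
  assume h: "h \<in> H"
  have "act (inv h) A \<in> C" if A: "A \<in> C" for A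
  proof -
    have "A \<in> act h ` C" using A H_surj[OF h] by simp
    then obtain B where B: "B \<in> C" "A = act h B" by blast
    have "B \<in> verts Y" using B(1) C_verts by blast
    then show ?thesis using act_inv[OF H_in[OF h]] B by simp
  qed
  then show "inv h \<in> H" using H_in[OF h] unfolding H_def by blast
qed

lemma act_inv2: "h \<in> H \<Longrightarrow> A \<in> C \<Longrightarrow> act h (act (inv h) A) = A"
  using act_act[of h "inv h" A] act_one[of A] H_in C_verts by auto

lemma act_inv2_image:
  assumes "h \<in> H" "e \<subseteq> C"
  shows "act h ` (act (inv h) ` e) = e"
proof -
  have "(\<lambda>A. act h (act (inv h) A)) ` e = (\<lambda>A. A) ` e"
    by (rule image_cong[OF refl]) (use act_inv2[OF assms(1)] assms(2) in blast)
  then show ?thesis by (simp add: image_image)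
qed

text \<open>Connectedness of \<open>C\<close> turns one vertex with image in \<open>C\<close> into
  membership in the stabilizer.\<close>

lemma H_I:
  assumes "h \<in> carrier G" "A \<in> C" "act h A \<in> C"
  shows "h \<in> H"
proof -
  have "act h B \<in> C" if "B \<in> C" for B
    using X.lift_map_conn_class[of "cjv h", OF rot_X_cj[OF assms(1)]] assms(2,3) that
    unfolding C_def act_def Y_complex_def by blast
  then show ?thesis using assms(1) unfolding H_def by blast
qed

lemma Q_C: "P y x \<in> C" and W_C: "W x y \<in> C" and W_C': "W y x \<in> C"
  using tri_C[OF xy] tri_C[OF noncomm_sym[OF xy]] P_C by auto

text \<open>By \<open>P_conj\<close>, \<open>x\<close> fixes the vertex
  \<open>P x y\<close>.\<close>

lemma H_x: "x \<in> H"
  using H_I[of x "P x y"] act_P[OF _ xy, of x] P_conj[OF xy] P_C by simp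

text \<open>The element \<open>x\<close> rotates about its fixed vertex \<open>P x y\<close> and
  carries one face at the edge of the pair to the other. Hence one orbit contains all faces,
  whichever order of the pair names a triangle.\<close>

lemma act_W_other: "W y x = act (inv x) (W x y)"
proof -
  have "act x (W y x) = W x y"
    using act_W[OF x_in noncomm_sym[OF xy]] W_rotate[OF xy] by simp
  then show ?thesis using act_inv[OF x_in, of "W y x"] W_C' C_verts by auto
qed

text \<open>The conjugating element supplied by \<open>good\<close> sends a vertex of
  \<open>C\<close> into \<open>C\<close>, so it belongs to \<open>H\<close>.\<close>

lemma triangle_rep:
  assumes uv: "noncomm u v" "P u v \<in> C"
  obtains (same) h where "h \<in> H" "P u v = act h (P x y)" "P v u = act h (P y x)" "W u v = act h (W x y)"
    | (swap) h where "h \<in> H" "P u v = act h (P y x)" "P v u = act h (P x y)" "W u v = act h (W y x)"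
proof -
  obtain h where h: "h \<in> carrier G" "(u = cj h x \<and> v = cj h y) \<or> (u = cj h y \<and> v = cj h x)"
    using good_pair[OF uv] unfolding good_def by blast
  note yx = noncomm_sym[OF xy]
  note a = act_P[OF h(1) xy] act_P[OF h(1) yx] act_W[OF h(1) xy] act_W[OF h(1) yx]
  from h(2) show ?thesis
  proof
    assume "u = cj h x \<and> v = cj h y"
    then have "P u v = act h (P x y)" "P v u = act h (P y x)" "W u v = act h (W x y)" using a by simp_all
    moreover from this have "h \<in> H" using H_I[OF h(1) P_C] uv(2) by simp
    ultimately show ?thesis using same by blast
  next
    assume "u = cj h y \<and> v = cj h x"
    then have "P u v = act h (P y x)" "P v u = act h (P x y)" "W u v = act h (W y x)" using a by simp_all
    moreover from this have "h \<in> H" using H_I[OF h(1) Q_C] uv(2) by simp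
    ultimately show ?thesis using swap by blast
  qed
qed

lemma T_vertex_cases:
  assumes "A \<in> C"
  obtains (P) u v where "noncomm u v" "A = P u v" "vtype A = 1" | (W) u v where "noncomm u v" "A = W u v" "vtype A = 2"
proof -
  have "A \<in> verts Y" using assms C_verts by blast
  then show ?thesis by (rule Y_vertex_cases) (use that in auto)
qed

lemma cell_verts_T: "cell_verts T = {A \<in> C. vtype A = 1}"
  by (simp add: cell_verts_def verts_T)

lemma cell_verts_cases:
  assumes "A \<in> cell_verts T"
  obtains u v where "noncomm u v" "A = P u v" "P u v \<in> C"
proof -
  have A: "A \<in> C" "vtype A = 1" using assms by (auto simp: cell_verts_T)
  from A(1) show ?thesis by (rule T_vertex_cases) (use that A in auto)
qed

lemma cell_verts_rep:
  assumes "A \<in> cell_verts T"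
  shows "\<exists>h \<in> H. A = act h (P x y) \<or> A = act h (P y x)"
proof -
  obtain u v where "noncomm u v" "A = P u v" "P u v \<in> C" using assms by (rule cell_verts_cases)
  then show ?thesis using triangle_rep by metis
qed

lemma type2_cases:
  assumes "w \<in> C" "vtype w = 2"
  obtains u v where "noncomm u v" "w = W u v" "P u v \<in> C"
  using assms(1)
proof (cases rule: T_vertex_cases)
  case (W u v)
  then show ?thesis using that tri_C(1)[OF W(1)] assms(1) by blast
qed (use assms(2) in simp)

lemma type2_rep:
  assumes w: "w \<in> C" "vtype w = 2"
  shows "\<exists>h \<in> H. w = act h (W x y)"
proof -
  obtain u v where uv: "noncomm u v" "w = W u v" "P u v \<in> C" using w by (rule type2_cases)
  from uv(1,3) show ?thesis
  proof (cases rule: triangle_rep)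
    case (same h)
    then show ?thesis using uv(2) by blast
  next
    case (swap h)
    have "W x y \<in> verts Y" using W_C C_verts by blast
    then have "w = act (h \<otimes> inv x) (W x y)"
      using swap(4) uv(2) act_W_other act_act[OF H_in[OF swap(1)] inv_closed[OF x_in]] by simp
    moreover have "h \<otimes> inv x \<in> H" by (rule H_mult[OF swap(1) H_inv[OF H_x]])
    ultimately show ?thesis by blast
  qed
qed

lemma cell_edges_T: "e \<in> cell_edges T \<longleftrightarrow> (\<exists>u v. noncomm u v \<and> P u v \<in> C \<and> e = {P u v, P v u})"
proof
  assume e: "e \<in> cell_edges T"
  then have eY: "e \<in> edges Y" "e \<subseteq> C" and t: "\<forall>A\<in>e. vtype A = 1"
    by (auto simp: cell_edges_def edges_T cell_verts_T)
  obtain A B where AB: "e = {A, B}" using Y.edge_cases[OF eY(1)] by metis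
  have "{A, B} \<in> edges Y" "vtype A = 1" "vtype B = 1" using eY t AB by simp_all
  then obtain u v where uv: "noncomm u v" "A = P u v" "B = P v u" by (rule edges_Y_11)
  then show "\<exists>u v. noncomm u v \<and> P u v \<in> C \<and> e = {P u v, P v u}" using AB eY(2) by blast
next
  assume "\<exists>u v. noncomm u v \<and> P u v \<in> C \<and> e = {P u v, P v u}"
  then obtain u v where uv: "noncomm u v" "P u v \<in> C" "e = {P u v, P v u}" by blast
  then have "e \<in> edges Y" "e \<subseteq> C" using Y.rot_edges(4)[OF rot_Y[OF uv(1)]] tri_C(2)[OF uv(1)] by auto
  then show "e \<in> cell_edges T" using uv(3) by (simp add: cell_edges_def edges_T cell_verts_T)
qed

lemma cell_edges_rep:
  assumes "e \<in> cell_edges T"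
  shows "\<exists>h \<in> H. e = {act h (P x y), act h (P y x)}"
proof -
  obtain u v where uv: "noncomm u v" "P u v \<in> C" "e = {P u v, P v u}" using assms cell_edges_T by auto
  from uv(1,2) show ?thesis
  proof (cases rule: triangle_rep)
    case (same h)
    then have "e = {act h (P x y), act h (P y x)}" using uv(3) by simp
    then show ?thesis using same(1) by (rule rev_bexI[rotated])
  next
    case (swap h)
    then have "e = {act h (P x y), act h (P y x)}" using uv(3) by (simp add: insert_commute)
    then show ?thesis using swap(1) by (rule rev_bexI[rotated])
  qed
qed

lemma act_vtype: "h \<in> carrier G \<Longrightarrow> A \<in> verts Y \<Longrightarrow> vtype (act h A) = vtype A"
  by (erule Y_vertex_cases) (simp_all add: act_P act_W)

lemma act_cell_verts: "h \<in> H \<Longrightarrow> A \<in> cell_verts T \<Longrightarrow> act h A \<in> cell_verts T"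
  using H_act act_vtype[OF H_in, of h A] C_verts by (auto simp: cell_verts_T)

lemma act_cell_edges:
  assumes "h \<in> H" "e \<in> cell_edges T"
  shows "act h ` e \<in> cell_edges T"
proof -
  obtain u v where uv: "noncomm u v" "P u v \<in> C" "e = {P u v, P v u}" using assms(2) cell_edges_T by auto
  have h: "h \<in> carrier G" by (rule H_in[OF assms(1)])
  have "act h ` e = {P (cj h u) (cj h v), P (cj h v) (cj h u)}"
    unfolding uv(3) using act_P[OF h uv(1)] act_P[OF h noncomm_sym[OF uv(1)]] by simp
  moreover have "P (cj h u) (cj h v) \<in> C" using H_act[OF assms(1) uv(2)] act_P[OF h uv(1)] by simp
  ultimately show ?thesis using cell_edges_T noncomm_cj[OF h uv(1)] by auto
qed

subsection \<open>Faces\<close>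

abbreviation bd :: "'a yvertex \<Rightarrow> 'a yvertex set set" where
  "bd w \<equiv> face_boundary T (sheet T w)"

lemma cell_faces_T: "cell_faces T = sheet T ` {w \<in> C. vtype w = 2}"
  by (simp add: cell_faces_def verts_T)

text \<open>A triangle of the sheet has one edge between type 1 vertices, the one opposite to
  \<open>w\<close>.\<close>

lemma bd_eq:
  assumes w: "w \<in> C" "vtype w = 2"
  shows "bd w = {{P u v, P v u} | u v. noncomm u v \<and> W u v = w}"
proof (intro equalityI subsetI)
  fix e assume "e \<in> bd w"
  then obtain t where e: "e \<in> cell_edges T" "t \<in> tris T" "w \<in> tri_set t" "e \<subseteq> tri_set t"
    unfolding face_boundary_def sheet_def by blast
  obtain u v where uv: "noncomm u v" "P u v \<in> C" "t = (P u v, P v u, W u v)" using e(2) tris_T by auto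
  have ts: "tri_set t = {P u v, P v u, W u v}" using uv(3) by (simp add: tri_set_def)
  have wt: "W u v = w" using e(3) w(2) unfolding ts by auto
  obtain u' v' where uv': "noncomm u' v'" "e = {P u' v', P v' u'}" using e(1) cell_edges_T by auto
  have "u' \<noteq> v'" using uv'(1) by (auto simp: noncomm_def)
  then have "P u' v' \<noteq> P v' u'" by (metis fst_P prod.inject)
  moreover have "{P u' v', P v' u'} \<subseteq> {P u v, P v u}" using e(4) unfolding ts uv'(2) by auto
  ultimately have "e = {P u v, P v u}" unfolding uv'(2) by (auto simp: doubleton_eq_iff)
  then show "e \<in> {{P u v, P v u} | u v. noncomm u v \<and> W u v = w}" using uv(1) wt by blast
next
  fix e assume "e \<in> {{P u v, P v u} | u v. noncomm u v \<and> W u v = w}"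
  then obtain u v where uv: "e = {P u v, P v u}" "noncomm u v" "W u v = w" by blast
  have PC: "P u v \<in> C" using tri_C(1)[OF uv(2)] uv(3) w(1) by simp
  have "e \<in> cell_edges T" using cell_edges_T uv PC by auto
  moreover have "(P u v, P v u, W u v) \<in> sheet T w"
    unfolding sheet_def using tris_T uv PC by (auto simp: tri_set_def)
  moreover have "e \<subseteq> tri_set (P u v, P v u, W u v)" using uv(1) by (simp add: tri_set_def)
  ultimately show "e \<in> bd w" unfolding face_boundary_def by blast
qed

lemma act_type2: "h \<in> H \<Longrightarrow> w \<in> C \<Longrightarrow> vtype w = 2 \<Longrightarrow> act h w \<in> C \<and> vtype (act h w) = 2"
  using H_act act_vtype[OF H_in, of h w] C_verts by auto

lemma act_bd_subset:
  assumes h: "h \<in> H" and w: "w \<in> C" "vtype w = 2"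
  shows "image (act h) ` bd w \<subseteq> bd (act h w)"
proof
  fix e assume "e \<in> image (act h) ` bd w"
  then obtain u v where uv: "e = act h ` {P u v, P v u}" "noncomm u v" "W u v = w"
    unfolding bd_eq[OF w] by blast
  have hc: "h \<in> carrier G" by (rule H_in[OF h])
  have "e = {P (cj h u) (cj h v), P (cj h v) (cj h u)}" "W (cj h u) (cj h v) = act h w"
    using act_P[OF hc uv(2)] act_P[OF hc noncomm_sym[OF uv(2)]] act_W[OF hc uv(2)] uv by simp_all
  moreover have "act h w \<in> C" "vtype (act h w) = 2" using act_type2[OF h w] by auto
  ultimately show "e \<in> bd (act h w)" using bd_eq noncomm_cj[OF hc uv(2)] by auto
qed

lemma bd_C: "w \<in> C \<Longrightarrow> vtype w = 2 \<Longrightarrow> e \<in> bd w \<Longrightarrow> e \<in> cell_edges T \<and> e \<subseteq> C"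
  unfolding face_boundary_def by (auto simp: cell_edges_def cell_verts_T)

text \<open>The reverse inclusion is the previous lemma for \<open>inv h\<close>.\<close>

lemma act_bd:
  assumes h: "h \<in> H" and w: "w \<in> C" "vtype w = 2"
  shows "image (act h) ` bd w = bd (act h w)"
proof
  show "image (act h) ` bd w \<subseteq> bd (act h w)" by (rule act_bd_subset[OF assms])
  have w': "act h w \<in> C" "vtype (act h w) = 2" using act_type2[OF assms] by auto
  have inv: "act (inv h) (act h w) = w" using act_inv[OF H_in[OF h]] w(1) C_verts by blast
  show "bd (act h w) \<subseteq> image (act h) ` bd w"
  proof
    fix e assume e: "e \<in> bd (act h w)"
    have eC: "e \<subseteq> C" using bd_C[OF w' e] by blast
    have "act (inv h) ` e \<in> bd w" using act_bd_subset[OF H_inv[OF h] w'] e inv by auto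
    moreover have "act h ` (act (inv h) ` e) = e" by (rule act_inv2_image[OF h eC])
    ultimately show "e \<in> image (act h) ` bd w" by (metis imageI)
  qed
qed

subsection \<open>Automorphisms\<close>

text \<open>Elements of \<open>Bij\<close> are extensional, hence the restriction.\<close>

definition aut :: "'a \<Rightarrow> 'a yvertex \<Rightarrow> 'a yvertex" where
  "aut h = restrict (act h) (cell_verts T)"

lemma aut_edge: "e \<in> cell_edges T \<Longrightarrow> aut h ` e = act h ` e"
  unfolding aut_def cell_edges_def by (intro image_cong) auto

lemma aut_bd: "w \<in> C \<Longrightarrow> vtype w = 2 \<Longrightarrow> image (aut h) ` bd w = image (act h) ` bd w"
  by (rule image_cong[OF refl], rule aut_edge) (blast dest: bd_C)

lemma aut_in:
  assumes h: "h \<in> H"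
  shows "aut h \<in> carrier (cell_aut_group T)"
proof -
  have "bij_betw (act h) (cell_verts T) (cell_verts T)"
    unfolding bij_betw_def
  proof
    show inj: "inj_on (act h) (cell_verts T)"
      by (rule inj_on_subset[OF act_inj[OF H_in[OF h]]]) (use C_verts in \<open>auto simp: cell_verts_T\<close>)
    have "finite (cell_verts T)" using finite_C by (simp add: cell_verts_T)
    then show "act h ` cell_verts T = cell_verts T"
      using act_cell_verts[OF h] inj by (intro endo_inj_surj) auto
  qed
  then have "aut h \<in> Bij (cell_verts T)"
    unfolding Bij_def aut_def by (simp add: bij_betw_restrict_eq)
  moreover have "image (aut h) ` cell_edges T = cell_edges T"
  proof -
    have "image (aut h) ` cell_edges T = image (act h) ` cell_edges T"
      by (intro image_cong refl aut_edge)
    also have "\<dots> = cell_edges T"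
    proof
      show "image (act h) ` cell_edges T \<subseteq> cell_edges T" using act_cell_edges[OF h] by blast
      show "cell_edges T \<subseteq> image (act h) ` cell_edges T"
      proof
        fix e assume e: "e \<in> cell_edges T"
        then have "e \<subseteq> C" by (auto simp: cell_edges_def cell_verts_T)
        then show "e \<in> image (act h) ` cell_edges T"
          using act_cell_edges[OF H_inv[OF h] e] act_inv2_image[OF h] by (metis imageI)
      qed
    qed
    finally show ?thesis .
  qed
  moreover have "image (image (aut h)) ` (face_boundary T ` cell_faces T) = face_boundary T ` cell_faces T"
  proof -
    let ?W = "{w \<in> C. vtype w = 2}"
    have fb: "face_boundary T ` cell_faces T = bd ` ?W" by (simp add: cell_faces_T image_image)
    have "image (aut h) ` bd w = bd (act h w)" if "w \<in> ?W" for w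
    proof -
      have "image (aut h) ` bd w = image (act h) ` bd w"
        using aut_bd that by simp
      then show ?thesis using act_bd[OF h] that by simp
    qed
    then have "image (image (aut h)) ` (bd ` ?W) = (\<lambda>w. bd (act h w)) ` ?W"
      unfolding image_image by (intro image_cong) auto
    also have "\<dots> = bd ` ?W"
    proof -
      have "act h ` ?W = ?W"
      proof
        show "act h ` ?W \<subseteq> ?W" using act_type2[OF h] by auto
        show "?W \<subseteq> act h ` ?W"
        proof
          fix w assume w: "w \<in> ?W"
          then have "act (inv h) w \<in> ?W" using act_type2[OF H_inv[OF h]] by auto
          then show "w \<in> act h ` ?W" using act_inv2[OF h, of w] w by (metis (no_types, lifting) imageI mem_Collect_eq)
        qed
      qed
      then have "bd ` (act h ` ?W) = bd ` ?W" by (rule arg_cong)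
      then show ?thesis by (simp only: image_image)
    qed
    finally show ?thesis unfolding fb .
  qed
  ultimately show ?thesis by (simp add: cell_aut_group_def)
qed

lemma orbit_cell_aut: "orbit (cell_aut_group T) \<phi> a = {\<phi> f a | f. f \<in> carrier (cell_aut_group T)}"
  by (simp add: orbit_def)

lemma autD:
  assumes "f \<in> carrier (cell_aut_group T)"
  shows "f ` cell_verts T = cell_verts T" "image f ` cell_edges T = cell_edges T"
  using assms by (auto simp: cell_aut_group_def Bij_def bij_betw_def)

lemma P_cell: "P x y \<in> cell_verts T" and Q_cell: "P y x \<in> cell_verts T"
  using P_C Q_C by (auto simp: cell_verts_T)

lemma edge_transitive: "edge_transitive T"
  unfolding edge_transitive_def
proof
  fix e assume e: "e \<in> cell_edges T"
  show "orbit (cell_aut_group T) (\<lambda>f. (`) f) e = cell_edges T"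
  proof
    show "orbit (cell_aut_group T) (\<lambda>f. (`) f) e \<subseteq> cell_edges T"
      unfolding orbit_cell_aut using autD(2) e by blast
    show "cell_edges T \<subseteq> orbit (cell_aut_group T) (\<lambda>f. (`) f) e"
    proof
      fix e' assume e': "e' \<in> cell_edges T"
      obtain h where h: "h \<in> H" "e = {act h (P x y), act h (P y x)}" using cell_edges_rep[OF e] by blast
      obtain k where k: "k \<in> H" "e' = {act k (P x y), act k (P y x)}" using cell_edges_rep[OF e'] by blast
      \<comment> \<open>Both edges are translates of the edge of \<open>(x, y)\<close>;
        \<open>?g\<close> undoes one translation and applies the other.\<close>
      let ?g = "k \<otimes> inv h"
      have g: "?g \<in> H" by (rule H_mult[OF k(1) H_inv[OF h(1)]])
      have "act ?g (act h A) = act k A" if "A \<in> C" for A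
      proof -
        have A: "A \<in> verts Y" "act h A \<in> verts Y" using that C_verts H_act[OF h(1)] by blast+
        show ?thesis
          using act_act[OF H_in[OF k(1)] H_in[OF H_inv[OF h(1)]] A(2)] act_inv[OF H_in[OF h(1)] A(1)] by simp
      qed
      then have "aut ?g ` e = e'" using aut_edge[OF e] h(2) k(2) P_C Q_C by simp
      then show "e' \<in> orbit (cell_aut_group T) (\<lambda>f. (`) f) e"
        unfolding orbit_cell_aut using aut_in[OF g] by blast
    qed
  qed
qed

lemma face_transitive: "face_transitive T"
  unfolding face_transitive_def
proof (intro ballI)
  fix F F' assume "F \<in> cell_faces T" "F' \<in> cell_faces T"
  then obtain w w' where w: "w \<in> C" "vtype w = 2" "F = sheet T w" and w': "w' \<in> C" "vtype w' = 2" "F' = sheet T w'"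
    unfolding cell_faces_T by blast
  obtain h where h: "h \<in> H" "w = act h (W x y)" using type2_rep[OF w(1,2)] by blast
  obtain k where k: "k \<in> H" "w' = act k (W x y)" using type2_rep[OF w'(1,2)] by blast
  let ?g = "k \<otimes> inv h"
  have g: "?g \<in> H" by (rule H_mult[OF k(1) H_inv[OF h(1)]])
  have V: "W x y \<in> verts Y" "w \<in> verts Y" using W_C w(1) C_verts by blast+
  have "act ?g w = w'"
    using act_act[OF H_in[OF k(1)] H_in[OF H_inv[OF h(1)]] V(2)] act_inv[OF H_in[OF h(1)] V(1)] h(2) k(2) by simp
  moreover have "image (aut ?g) ` bd w = image (act ?g) ` bd w"
    by (rule aut_bd[OF w(1,2)])
  ultimately have "image (aut ?g) ` face_boundary T F = face_boundary T F'"
    using act_bd[OF g w(1,2)] w(3) w'(3) by simp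
  then show "\<exists>f \<in> carrier (cell_aut_group T). image f ` face_boundary T F = face_boundary T F'"
    using aut_in[OF g] by blast
qed

lemma vertex_orbit_subset: "A \<in> cell_verts T \<Longrightarrow> vertex_orbit T A \<subseteq> cell_verts T"
  unfolding vertex_orbit_def orbit_cell_aut using autD(1) by blast

lemma act_vertex_orbit:
  assumes "h \<in> H" "A \<in> cell_verts T"
  shows "act h A \<in> vertex_orbit T A"
  unfolding vertex_orbit_def orbit_cell_aut using aut_in[OF assms(1)] assms(2)
  by (auto simp: aut_def intro!: exI[of _ "aut h"])

lemma vertex_orbits: "cell_verts T = vertex_orbit T (P x y) \<union> vertex_orbit T (P y x)"
proof
  show "cell_verts T \<subseteq> vertex_orbit T (P x y) \<union> vertex_orbit T (P y x)"
    using cell_verts_rep act_vertex_orbit P_cell Q_cell by blast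
qed (use vertex_orbit_subset P_cell Q_cell in blast)

end

subsection \<open>Conjugacy classes and valencies\<close>

context finite_group
begin

text \<open>Natural powers of \<open>a\<close> exhaust the cyclic group, as \<open>G\<close> is
  finite, so this is \<open>cyclic_conj_class\<close> in a form suited to iteration.\<close>

definition cls :: "'a \<Rightarrow> 'a \<Rightarrow> 'a set" where
  "cls a g = range (\<lambda>i. (cj a ^^ i) g)"

lemma cj_funpow: "a \<in> carrier G \<Longrightarrow> g \<in> carrier G \<Longrightarrow> (cj a ^^ i) g = cj (a [^] i) g"
proof (induction i)
  case (Suc i)
  then show ?case using nat_pow_Suc2[of a i] by (simp add: cj_cj)
qed simp

lemma cyclic_conj_class_eq:
  assumes a: "a \<in> carrier G" and g: "g \<in> carrier G"
  shows "cyclic_conj_class G a g = cls a g"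
proof -
  have "carrier (subgroup_generated G {a}) = generate G {a}"
    using a by (simp add: carrier_subgroup_generated)
  also have "\<dots> = {a [^] k | k. k \<in> (UNIV :: nat set)}"
    by (rule generate_pow_on_finite_carrier[OF fin a])
  finally have "carrier (subgroup_generated G {a}) = {a [^] k | k. k \<in> (UNIV :: nat set)}" .
  then have "cyclic_conj_class G a g = {cj (a [^] k) g | k. k \<in> (UNIV :: nat set)}"
    unfolding cyclic_conj_class_def orbit_def cj_def using g by auto
  also have "\<dots> = cls a g" unfolding cls_def cj_funpow[OF a g] by blast
  finally show ?thesis .
qed

lemma cls_carrier: "a \<in> carrier G \<Longrightarrow> g \<in> carrier G \<Longrightarrow> cls a g \<subseteq> carrier G"
  unfolding cls_def by (auto simp: cj_funpow)

lemma finite_cls: "a \<in> carrier G \<Longrightarrow> g \<in> carrier G \<Longrightarrow> finite (cls a g)"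
  using cls_carrier fin by (rule finite_subset)

lemma noncomm_funpow: "noncomm u v \<Longrightarrow> noncomm u ((cj u ^^ i) v)"
proof (induction i)
  case (Suc i)
  then have "noncomm (cj u u) (cj u ((cj u ^^ i) v))"
    using noncomm_cj[of u u] noncomm_carrier(1) by blast
  then show ?case using noncomm_carrier(1)[OF Suc.prems] by simp
qed simp

text \<open>Conjugation by \<open>u\<close> commutes with multiplication by \<open>u\<close> on
  either side, so the classes are translates of each other. Edges at \<open>P u v\<close> are
  counted by the class of \<open>v\<close>, while the theorem speaks of the class of the
  product.\<close>

lemma card_cls_mult:
  assumes "noncomm u v"
  shows "card (cls u (u \<otimes> v)) = card (cls u v)" "card (cls u (v \<otimes> u)) = card (cls u v)"
proof -
  have c: "u \<in> carrier G" "v \<in> carrier G" using assms by (auto simp: noncomm_def)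
  have w: "(cj u ^^ i) v \<in> carrier G" for i using noncomm_funpow[OF assms] by (auto simp: noncomm_def)
  have "(cj u ^^ i) (u \<otimes> v) = u \<otimes> (cj u ^^ i) v \<and> (cj u ^^ i) (v \<otimes> u) = (cj u ^^ i) v \<otimes> u" for i
  proof (induction i)
    case (Suc i)
    then show ?case using cj_mult[OF c(1) c(1) w] cj_mult[OF c(1) w c(1)] c by simp
  qed simp
  then have "cls u (u \<otimes> v) = (\<lambda>w. u \<otimes> w) ` cls u v" "cls u (v \<otimes> u) = (\<lambda>w. w \<otimes> u) ` cls u v"
    unfolding cls_def by (simp_all add: image_image)
  moreover have "inj_on (\<lambda>w. u \<otimes> w) (cls u v)" "inj_on (\<lambda>w. w \<otimes> u) (cls u v)"
    by (rule inj_on_subset[OF _ cls_carrier[OF c]], rule inj_on_cmult inj_on_multc, rule c(1))+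
  ultimately show "card (cls u (u \<otimes> v)) = card (cls u v)" "card (cls u (v \<otimes> u)) = card (cls u v)"
    by (simp_all add: card_image)
qed

lemma card_cls_ge_2:
  assumes "noncomm u v"
  shows "card (cls u v) \<ge> 2"
proof -
  have c: "u \<in> carrier G" "v \<in> carrier G" using assms by (auto simp: noncomm_def)
  have "cj u v \<noteq> v"
  proof
    assume "cj u v = v"
    then have "cj u v \<otimes> u = v \<otimes> u" by simp
    then show False using assms c by (simp add: cj_def m_assoc noncomm_def)
  qed
  moreover have "v \<in> cls u v" "cj u v \<in> cls u v"
    unfolding cls_def by (rule range_eqI[of _ _ 0], simp, rule range_eqI[of _ _ 1], simp)
  then have "card {v, cj u v} \<le> card (cls u v)" by (intro card_mono finite_cls c) simp
  ultimately show ?thesis by simp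
qed

lemma card_cls_cj:
  assumes h: "h \<in> carrier G" and uv: "noncomm u v"
  shows "card (cls (cj h u) (cj h v)) = card (cls u v)"
proof -
  have c: "u \<in> carrier G" "v \<in> carrier G" using uv by (auto simp: noncomm_def)
  have w: "(cj u ^^ i) v \<in> carrier G" for i using noncomm_funpow[OF uv] by (auto simp: noncomm_def)
  have "(cj (cj h u) ^^ i) (cj h v) = cj h ((cj u ^^ i) v)" for i
  proof (induction i)
    case (Suc i)
    have "cj (cj h u) (cj h z) = cj h (cj u z)" if "z \<in> carrier G" for z
      using h c that by (simp add: cj_def m_assoc inv_mult_group)
    then show ?case using Suc w by simp
  qed simp
  then have "cls (cj h u) (cj h v) = cj h ` cls u v" unfolding cls_def by (simp add: image_image)
  moreover have "inj_on (cj h) (cls u v)"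
    using cls_carrier[OF c] cj_inj[OF h] by (auto simp: inj_on_def subset_iff)
  ultimately show ?thesis by (simp add: card_image)
qed

end

context noncommuting_pair
begin

lemma cell_edgesI: "noncomm u v \<Longrightarrow> P u v \<in> C \<Longrightarrow> {P u v, P v u} \<in> cell_edges T"
  unfolding cell_edges_T by blast

text \<open>By \<open>P_eq_iff\<close> the vertex has the names \<open>P u w\<close> with
  \<open>w\<close> in the class of \<open>v\<close>. Each name gives one edge, and the label of its
  other end recovers \<open>w\<close>.\<close>

lemma valency_P:
  assumes uv: "noncomm u v" "P u v \<in> C"
  shows "valency T (P u v) = card (cls u v)"
proof -
  define f where "f w = {P u w, P w u}" for w
  have w: "noncomm u w \<and> P u w = P u v" if w: "w \<in> cls u v" for w
  proof -
    obtain i where i: "w = (cj u ^^ i) v" using w unfolding cls_def by blast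
    have n: "noncomm u w" unfolding i by (rule noncomm_funpow[OF uv(1)])
    then show ?thesis using P_eq_iff[OF uv(1) n] i by auto
  qed
  have "{e \<in> cell_edges T. P u v \<in> e} = f ` cls u v"
  proof (intro equalityI subsetI)
    fix e assume "e \<in> {e \<in> cell_edges T. P u v \<in> e}"
    then have e: "e \<in> cell_edges T" "P u v \<in> e" by auto
    obtain a b where ab: "noncomm a b" "e = {P a b, P b a}" using e(1) cell_edges_T by auto
    have "\<exists>w. noncomm u w \<and> P u v = P u w \<and> e = f w"
    proof (cases "P u v = P a b")
      case True
      then have "u = a" using True by (metis fst_P prod.inject)
      then show ?thesis using True ab unfolding f_def by blast
    next
      case False
      then have q: "P u v = P b a" using e(2) ab(2) by blast
      then have "u = b" using q by (metis fst_P prod.inject)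
      then show ?thesis using q ab noncomm_sym unfolding f_def by (intro exI[of _ a]) auto
    qed
    then obtain w where w: "noncomm u w" "P u v = P u w" "e = f w" by blast
    have "w \<in> cls u v" using P_eq_iff[OF uv(1) w(1)] w(2) unfolding cls_def by blast
    then show "e \<in> f ` cls u v" using w(3) by blast
  next
    fix e assume "e \<in> f ` cls u v"
    then obtain w' where w': "w' \<in> cls u v" "e = f w'" by blast
    have n: "noncomm u w'" "P u w' = P u v" using w[OF w'(1)] by blast+
    have "{P u w', P w' u} \<in> cell_edges T" using n uv(2) by (intro cell_edgesI) simp_all
    then show "e \<in> {e \<in> cell_edges T. P u v \<in> e}" unfolding w'(2) f_def using n(2) by simp
  qed
  moreover have "inj_on f (cls u v)"
  proof (rule inj_onI)
    fix w1 w2 assume w12: "w1 \<in> cls u v" "w2 \<in> cls u v" "f w1 = f w2"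
    have "u \<noteq> w1" using w[OF w12(1)] by (auto simp: noncomm_def)
    then have "P w1 u \<noteq> P u w2" by (metis fst_P prod.inject)
    then have "P w1 u = P w2 u" using w12(3) unfolding f_def by (auto simp: doubleton_eq_iff)
    then show "w1 = w2" by (metis fst_P prod.inject)
  qed
  ultimately show ?thesis unfolding valency_def by (simp add: card_image)
qed

lemma valency_act:
  assumes "h \<in> H" "A \<in> cell_verts T"
  shows "valency T (act h A) = valency T A"
proof -
  obtain u v where uv: "noncomm u v" "A = P u v" "P u v \<in> C" using assms(2) by (rule cell_verts_cases)
  have h: "h \<in> carrier G" by (rule H_in[OF assms(1)])
  have a: "act h A = P (cj h u) (cj h v)" unfolding uv(2) by (rule act_P[OF h uv(1)])
  have "P (cj h u) (cj h v) \<in> C" using H_act[OF assms(1) uv(3)] act_P[OF h uv(1)] by simp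
  then show ?thesis
    unfolding a using valency_P[OF noncomm_cj[OF h uv(1)]] valency_P[OF uv(1,3)] card_cls_cj[OF h uv(1)] uv(2)
    by simp
qed

lemma valency_values:
  "A \<in> cell_verts T \<Longrightarrow> valency T A = valency T (P x y) \<or> valency T A = valency T (P y x)"
  using cell_verts_rep valency_act P_cell Q_cell by metis

lemma valency_edge:
  "e \<in> cell_edges T \<Longrightarrow> \<exists>A B. e = {A, B} \<and> valency T A = valency T (P x y) \<and> valency T B = valency T (P y x)"
  using cell_edges_rep valency_act P_cell Q_cell by metis

lemma finite_cell_edges: "finite (cell_edges T)"
  using T.finite_edges unfolding cell_edges_def by simp

lemma finite_cell_verts: "finite (cell_verts T)"
  using finite_C by (simp add: cell_verts_T)

text \<open>Double counting of incidences. Besides the handshake formula, the version for subsets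
  counts edges by their ends of a given valency.\<close>

lemma sum_valency:
  assumes "S \<subseteq> cell_verts T"
  shows "(\<Sum>v\<in>S. valency T v) = (\<Sum>e\<in>cell_edges T. card (e \<inter> S))"
proof -
  have finS: "finite S" using assms finite_cell_verts by (rule finite_subset)
  have "(\<Sum>v\<in>S. valency T v) = (\<Sum>v\<in>S. \<Sum>e\<in>cell_edges T. if v \<in> e then 1 else 0)"
    unfolding valency_def using finite_cell_edges by (simp add: sum.If_cases Int_def)
  also have "\<dots> = (\<Sum>e\<in>cell_edges T. \<Sum>v\<in>S. if v \<in> e then 1 else 0)" by (rule sum.swap)
  also have "\<dots> = (\<Sum>e\<in>cell_edges T. card (e \<inter> S))"
    using finS by (simp add: sum.If_cases Int_def conj_commute)
  finally show ?thesis .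
qed

lemma cell_edge_card: "e \<in> cell_edges T \<Longrightarrow> e \<subseteq> cell_verts T \<and> card e = 2"
  using T.wf unfolding cell_edges_def wf_complex2_def by simp

lemma handshake: "(\<Sum>v\<in>cell_verts T. valency T v) = 2 * card (cell_edges T)"
proof -
  have "(\<Sum>e\<in>cell_edges T. card (e \<inter> cell_verts T)) = (\<Sum>e\<in>cell_edges T. 2)"
    using cell_edge_card by (intro sum.cong refl) (simp add: inf_absorb1)
  then show ?thesis using sum_valency[OF subset_refl] by simp
qed

subsection \<open>The polygons\<close>

text \<open>The group labels met when turning about \<open>(x \<otimes> y, 2)\<close> from
  \<open>(x, 1)\<close>; consecutive ones have product \<open>x \<otimes> y\<close>.\<close>

definition su :: "nat \<Rightarrow> 'a" where
  "su i = fst ((nxt X (x \<otimes> y, 2) ^^ i) (x, 1))"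

lemma su_step:
  "noncomm (su i) (su (Suc i)) \<and> su i \<otimes> su (Suc i) = x \<otimes> y \<and> (nxt X (x \<otimes> y, 2) ^^ i) (x, 1) = (su i, 1) \<and>
    (nxt X (x \<otimes> y, 2) ^^ Suc i) (x, 1) = (su (Suc i), 1) \<and> cj (su (Suc i)) (su (Suc (Suc i))) = su i"
proof -
  let ?n = "nxt X (x \<otimes> y, 2)"
  \<comment> \<open>After \<open>u\<close>, \<open>v\<close> comes the solution \<open>w\<close> of
    \<open>v \<otimes> w = u \<otimes> v\<close>, which is \<open>cj (inv v) u\<close>.\<close>
  have nx0: "?n (v, 1) = (cj (inv v) u, 1) \<and> noncomm v (cj (inv v) u) \<and> v \<otimes> cj (inv v) u = x \<otimes> y"
    if uv: "noncomm u v" "u \<otimes> v = x \<otimes> y" for u v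
  proof -
    have c: "u \<in> carrier G" "v \<in> carrier G" using uv(1) by (auto simp: noncomm_def)
    have "noncomm (cj (inv v) v) (cj (inv v) u)"
      by (rule noncomm_cj[OF inv_closed[OF c(2)] noncomm_sym[OF uv(1)]])
    moreover have "cj (inv v) v = v" using c by (simp add: cj_def m_assoc)
    ultimately have n: "noncomm v (cj (inv v) u)" by simp
    have e: "v \<otimes> cj (inv v) u = x \<otimes> y" using c by (simp add: cj_def m_assoc flip: uv(2))
    show ?thesis using nxt_type2[OF n] n unfolding e by simp
  qed
  have "noncomm (su i) (su (Suc i)) \<and> su i \<otimes> su (Suc i) = x \<otimes> y \<and> (?n ^^ i) (x, 1) = (su i, 1) \<and>
    (?n ^^ Suc i) (x, 1) = (su (Suc i), 1)" for i
  proof (induction i)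
    case 0
    have "?n (x, 1) = (y, 1)" by (rule nxt_type2[OF xy])
    then show ?case using xy by (simp add: su_def)
  next
    case (Suc i)
    let ?v = "cj (inv (su (Suc i))) (su i)"
    have 1: "noncomm (su i) (su (Suc i))" "su i \<otimes> su (Suc i) = x \<otimes> y" "(?n ^^ Suc i) (x, 1) = (su (Suc i), 1)"
      using Suc by blast+
    note nx = nx0[OF 1(1,2)]
    have it: "(?n ^^ Suc (Suc i)) (x, 1) = ?n (su (Suc i), 1)" using 1(3) by simp
    then have "su (Suc (Suc i)) = ?v" unfolding su_def[of "Suc (Suc i)"] it using nx by simp
    then show ?case using nx 1(3) it by simp
  qed
  note S = this
  have 1: "noncomm (su i) (su (Suc i))" "su i \<otimes> su (Suc i) = x \<otimes> y" using S by blast+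
  have "(?n ^^ Suc i) (x, 1) = (su (Suc i), 1)" using S by blast
  then have "(?n ^^ Suc (Suc i)) (x, 1) = ?n (su (Suc i), 1)"
    by (simp only: funpow.simps(2)[of "Suc i"] comp_apply)
  then have "su (Suc (Suc i)) = cj (inv (su (Suc i))) (su i)"
    unfolding su_def[of "Suc (Suc i)"] using nx0[OF 1] by simp
  then have "cj (su (Suc i)) (su (Suc (Suc i))) = su i" using noncomm_carrier[OF 1(1)] by simp
  then show ?thesis using S by blast
qed

lemma su_noncomm: "noncomm (su i) (su (Suc i))" and su_mult: "su i \<otimes> su (Suc i) = x \<otimes> y"
  and su_nxt: "(nxt X (x \<otimes> y, 2) ^^ i) (x, 1) = (su i, 1)"
  and su_conj: "cj (su (Suc i)) (su (Suc (Suc i))) = su i"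
  using su_step[of i] by blast+

lemma su_0: "su 0 = x" by (simp add: su_def)

lemma su_1: "su (Suc 0) = y"
  using su_mult[of 0] su_noncomm[of 0] xy unfolding su_0 by (metis cancel(1) noncomm_carrier(2) x_in)

lemma su_carrier: "su i \<in> carrier G"
  using noncomm_carrier(1)[OF su_noncomm] .

text \<open>Write the product as \<open>su i \<otimes> su (Suc i)\<close>: conjugation by the second
  factor already gives \<open>su i\<close>, which the first factor fixes. Conjugation by
  \<open>x \<otimes> y\<close> thus goes back two places.\<close>

lemma su_conj_alpha: "cj (x \<otimes> y) (su (i + 2)) = su i"
proof -
  have "cj (x \<otimes> y) (su (i + 2)) = cj (su i \<otimes> su (Suc i)) (su (Suc (Suc i)))" by (simp add: su_mult)
  also have "\<dots> = cj (su i) (su i)" by (simp add: su_conj su_carrier flip: cj_cj)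
  finally show ?thesis by (simp add: su_carrier)
qed

text \<open>The conditions make \<open>m\<close> the first return time of \<open>su\<close> to
  \<open>x\<close>; it is the number of sides of the faces.\<close>

definition period :: nat where
  "period = (SOME m. m \<ge> 3 \<and> su m = x \<and> inj_on su {..<m})"

lemma period: "period \<ge> 3" "su period = x" "inj_on su {..<period}"
proof -
  have nb: "(x, 1) \<in> nbrs X (x \<otimes> y, 2)" using noncomm_sym[OF noncomm_mult(1)[OF xy]] by (simp add: nbrs_X)
  obtain m where m: "m \<ge> 3" "(nxt X (x \<otimes> y, 2) ^^ m) (x, 1) = (x, 1)"
    "inj_on (\<lambda>i. (nxt X (x \<otimes> y, 2) ^^ i) (x, 1)) {..<m}"
    by (rule X.link_cycle[OF nb])
  have "inj_on su {..<m}" using m(3) unfolding su_nxt by (simp add: inj_on_def)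
  then have "m \<ge> 3 \<and> su m = x \<and> inj_on su {..<m}" using m(1,2) unfolding su_nxt by simp
  then have "period \<ge> 3 \<and> su period = x \<and> inj_on su {..<period}" unfolding period_def by (rule someI)
  then show "period \<ge> 3" "su period = x" "inj_on su {..<period}" by blast+
qed

lemma su_mod: "su (i mod period) = su i"
proof -
  have "(nxt X (x \<otimes> y, 2) ^^ period) (x, 1) = (x, 1)" unfolding su_nxt using period(2) by simp
  then have "(nxt X (x \<otimes> y, 2) ^^ (i mod period)) (x, 1) = (nxt X (x \<otimes> y, 2) ^^ i) (x, 1)"
    by (rule funpow_mod_eq)
  then show ?thesis unfolding su_nxt by simp
qed

lemma su_eq_iff: "su i = su j \<longleftrightarrow> i mod period = j mod period"
proof
  assume "su i = su j"
  then have "su (i mod period) = su (j mod period)" unfolding su_mod .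
  moreover have "i mod period \<in> {..<period}" "j mod period \<in> {..<period}" using period(1) by auto
  ultimately show "i mod period = j mod period" using period(3) by (meson inj_onD)
next
  assume "i mod period = j mod period"
  then show "su i = su j" using su_mod[of i] su_mod[of j] by simp
qed

text \<open>Conjugation goes back two places, and the class uses natural exponents only. Adding
  multiples of the period turns steps back into steps forward, in both inclusions.\<close>

lemma cls_alpha: "cls (x \<otimes> y) (su r) = range (\<lambda>j. su (r + 2 * j))"
proof -
  have bk: "(cj (x \<otimes> y) ^^ k) (su (i + 2 * k)) = su i" for i k
  proof (induction k arbitrary: i)
    case (Suc k)
    have "(cj (x \<otimes> y) ^^ Suc k) (su (i + 2 * Suc k)) = cj (x \<otimes> y) ((cj (x \<otimes> y) ^^ k) (su ((i + 2) + 2 * k)))"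
      by simp
    then show ?case using Suc.IH[of "i + 2"] su_conj_alpha[of i] by simp
  qed simp
  have per: "su (r + 2 * (period * k)) = su r" for k
    unfolding su_eq_iff by (metis mod_mult_self2 mult.assoc mult.commute)
  show ?thesis
  proof (intro equalityI subsetI)
    fix g assume "g \<in> cls (x \<otimes> y) (su r)"
    then obtain i where i: "g = (cj (x \<otimes> y) ^^ i) (su r)" unfolding cls_def by blast
    have "period * i = (period * i - i) + i" using period(1) by simp
    then have "r + 2 * (period * i) = (r + 2 * (period * i - i)) + 2 * i" by linarith
    then have "su r = su ((r + 2 * (period * i - i)) + 2 * i)" using per[of i] by metis
    then have "g = su (r + 2 * (period * i - i))" using bk[of i "r + 2 * (period * i - i)"] i by metis
    then show "g \<in> range (\<lambda>j. su (r + 2 * j))" by (rule range_eqI)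
  next
    fix g assume "g \<in> range (\<lambda>j. su (r + 2 * j))"
    then obtain j where j: "g = su (r + 2 * j)" by blast
    have "period * j = (period * j - j) + j" using period(1) by simp
    then have "r + 2 * (period * j) = (r + 2 * j) + 2 * (period * j - j)" by linarith
    then have "su r = su ((r + 2 * j) + 2 * (period * j - j))" using per[of j] by metis
    then have "g = (cj (x \<otimes> y) ^^ (period * j - j)) (su r)"
      using bk[of "period * j - j" "r + 2 * j"] j by metis
    then show "g \<in> cls (x \<otimes> y) (su r)" unfolding cls_def by (rule range_eqI)
  qed
qed

text \<open>Adding an odd period changes the parity of an index, so steps of two reach every
  position.\<close>

lemma odd_period:
  assumes "odd period"
  shows "cls (x \<otimes> y) (su r) = range su" "card (range su) = period"
proof -
  have "su i \<in> range (\<lambda>j. su (r + 2 * j))" for i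
  proof -
    \<comment> \<open>The new index must have the parity of \<open>r\<close> and be at least
      \<open>r\<close>; adding \<open>2 * r\<close> or \<open>2 * r + 1\<close> periods achieves
      both.\<close>
    have "\<exists>k. even (i + period * k + r) \<and> i + period * k \<ge> r"
    proof (cases "even (i + r)")
      case True
      have "1 * r \<le> period * (2 * r)" by (rule mult_le_mono) (use period(1) in auto)
      then have "r \<le> i + period * (2 * r)" by linarith
      moreover have "even (i + period * (2 * r) + r)" using True by simp
      ultimately show ?thesis by blast
    next
      case False
      have "1 * r \<le> period * (2 * r + 1)" by (rule mult_le_mono) (use period(1) in auto)
      then have "r \<le> i + period * (2 * r + 1)" by linarith
      moreover have "even (i + period * (2 * r + 1) + r)" using False assms by simp
      ultimately show ?thesis by blast
    qed
    then obtain k where k: "even (i + period * k + r)" "i + period * k \<ge> r" by blast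
    then have "even (i + period * k - r)" by simp
    then obtain j where "i + period * k - r = 2 * j" by (rule evenE)
    then have "i + period * k = r + 2 * j" using k(2) by linarith
    moreover have "su (i + period * k) = su i" unfolding su_eq_iff by simp
    ultimately have "su i = su (r + 2 * j)" by simp
    then show ?thesis by (rule range_eqI)
  qed
  then show "cls (x \<otimes> y) (su r) = range su" unfolding cls_alpha by blast
  have "range su = su ` {..<period}"
  proof
    show "range su \<subseteq> su ` {..<period}"
    proof
      fix g assume "g \<in> range su"
      then obtain i where "g = su (i mod period)" using su_mod by auto
      then show "g \<in> su ` {..<period}" using period(1) by auto
    qed
  qed blast
  then show "card (range su) = period" using card_image[OF period(3)] by simp
qed

text \<open>The parity of a position is now well defined. The class of \<open>x\<close> fills the
  even positions, and \<open>y\<close> stands at position 1.\<close>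

lemma even_period:
  assumes "even period"
  shows "y \<notin> cls (x \<otimes> y) x" "period = 2 * card (cls (x \<otimes> y) x)"
proof -
  have c: "cls (x \<otimes> y) x = range (\<lambda>j. su (2 * j))" using cls_alpha[of 0] by (simp add: su_0)
  show "y \<notin> cls (x \<otimes> y) x"
  proof
    assume "y \<in> cls (x \<otimes> y) x"
    then obtain j where "su (Suc 0) = su (2 * j)" unfolding c su_1 by blast
    then have "Suc 0 mod period = 2 * j mod period" unfolding su_eq_iff .
    moreover have "even (2 * j mod period)" using assms by (simp add: dvd_mod)
    moreover have "Suc 0 mod period = Suc 0" using period(1) by (intro mod_less) linarith
    ultimately show False by (metis odd_one One_nat_def)
  qed
  obtain k where k: "period = 2 * k" using assms by (rule evenE)
  have "range (\<lambda>j. su (2 * j)) = (\<lambda>j. su (2 * j)) ` {..<k}"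
  proof
    show "range (\<lambda>j. su (2 * j)) \<subseteq> (\<lambda>j. su (2 * j)) ` {..<k}"
    proof
      fix g assume "g \<in> range (\<lambda>j. su (2 * j))"
      then obtain j where g: "g = su (2 * j)" by blast
      have e: "2 * (j mod k) = 2 * j mod (2 * k)" by (rule mult_mod_right)
      have "su (2 * j) = su (2 * (j mod k))"
        unfolding su_eq_iff k e by (rule mod_mod_trivial[symmetric])
      moreover have "j mod k < k" using period(1) k by simp
      ultimately show "g \<in> (\<lambda>j. su (2 * j)) ` {..<k}" using g by blast
    qed
  qed blast
  moreover have "inj_on (\<lambda>j. su (2 * j)) {..<k}"
    unfolding inj_on_def su_eq_iff k by simp
  ultimately have "card (cls (x \<otimes> y) x) = k" unfolding c by (simp add: card_image)
  then show "period = 2 * card (cls (x \<otimes> y) x)" using k by simp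
qed

lemma ngon_image:
  assumes B: "ngon_boundary n B" and f: "inj_on f (\<Union>B)"
  shows "ngon_boundary n (image f ` B)"
proof -
  obtain p where p: "inj_on p {..<n}" "B = {{p i, p (Suc i mod n)} | i. i < n}"
    using B unfolding ngon_boundary_def by blast
  have "p ` {..<n} \<subseteq> \<Union>B" unfolding p(2) by blast
  then have "inj_on (f \<circ> p) {..<n}" using p(1) f by (intro comp_inj_on) (auto intro: inj_on_subset)
  moreover have "image f ` B = {{(f \<circ> p) i, (f \<circ> p) (Suc i mod n)} | i. i < n}"
  proof -
    have "image f ` B = image f ` ((\<lambda>i. {p i, p (Suc i mod n)}) ` {..<n})"
      unfolding p(2) by (rule arg_cong[of _ _ "image (image f)"]) blast
    also have "\<dots> = (\<lambda>i. {(f \<circ> p) i, (f \<circ> p) (Suc i mod n)}) ` {..<n}" by (simp add: image_image)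
    also have "\<dots> = {{(f \<circ> p) i, (f \<circ> p) (Suc i mod n)} | i. i < n}" by blast
    finally show ?thesis .
  qed
  ultimately show ?thesis unfolding ngon_boundary_def by blast
qed

text \<open>The corners are \<open>P (su i) (su (Suc i))\<close>, distinct because their labels are.
  The edge of the pair \<open>(su i, su (Suc i))\<close> leads from such a corner to
  \<open>P (su (Suc i)) (su i)\<close>, which \<open>P_conj\<close> and \<open>su_conj\<close>
  identify with the next corner.\<close>

lemma ngon_W: "ngon_boundary period (bd (W x y))"
proof -
  define p where "p i = P (su i) (su (Suc i))" for i
  have W: "W u v = W x y \<longleftrightarrow> (\<exists>i<period. u = su i \<and> v = su (Suc i))" if uv: "noncomm u v" for u v
  proof
    assume eq: "W u v = W x y"
    then have e: "u \<otimes> v = x \<otimes> y" using eq by (metis fst_W prod.inject)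
    have nb: "(x, 1) \<in> nbrs X (x \<otimes> y, 2)" "(u, 1) \<in> nbrs X (x \<otimes> y, 2)"
      using noncomm_sym[OF noncomm_mult(1)[OF xy]] noncomm_sym[OF noncomm_mult(1)[OF uv]]
      unfolding e by (simp_all add: nbrs_X)
    have "sheet_vertex X (x \<otimes> y, 2) (x, 1) = sheet_vertex X (x \<otimes> y, 2) (u, 1)"
      using eq e by (simp add: W_def)
    then obtain i where "(u, 1) = (nxt X (x \<otimes> y, 2) ^^ i) (x, 1)" using X.sv_eq_iff[OF nb] by blast
    then have u: "u = su (i mod period)" unfolding su_nxt su_mod by simp
    have c: "u \<in> carrier G" "v \<in> carrier G" using uv by (auto simp: noncomm_def)
    have "u \<otimes> v = u \<otimes> su (Suc (i mod period))" using su_mult[of "i mod period"] e u by simp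
    then have "v = su (Suc (i mod period))" using c su_carrier by (metis cancel(1))
    moreover have "i mod period < period" using period(1) by simp
    ultimately show "\<exists>i<period. u = su i \<and> v = su (Suc i)" using u by blast
  next
    assume "\<exists>i<period. u = su i \<and> v = su (Suc i)"
    then obtain i where i: "u = su i" "v = su (Suc i)" by blast
    have e: "u \<otimes> v = x \<otimes> y" using su_mult i by simp
    have nb: "(x, 1) \<in> nbrs X (x \<otimes> y, 2)" "(u, 1) \<in> nbrs X (x \<otimes> y, 2)"
      using noncomm_sym[OF noncomm_mult(1)[OF xy]] noncomm_sym[OF noncomm_mult(1)[OF uv]]
      unfolding e by (simp_all add: nbrs_X)
    have "(u, 1) = (nxt X (x \<otimes> y, 2) ^^ i) (x, 1)" unfolding su_nxt i(1) ..
    then have "sheet_vertex X (x \<otimes> y, 2) (x, 1) = sheet_vertex X (x \<otimes> y, 2) (u, 1)"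
      using X.sv_eq_iff[OF nb] by blast
    then show "W u v = W x y" unfolding W_def e by simp
  qed
  have p_Suc: "P (su (Suc i)) (su i) = p (Suc i)" for i
    using P_conj[OF su_noncomm[of "Suc i"]] unfolding su_conj p_def .
  have p_mod: "p (i mod period) = p i" for i
  proof -
    have "Suc (i mod period) mod period = Suc i mod period" by (rule mod_Suc_eq)
    then have "su (Suc (i mod period)) = su (Suc i)" unfolding su_eq_iff .
    then show ?thesis unfolding p_def su_mod by simp
  qed
  have "bd (W x y) = {{P u v, P v u} | u v. noncomm u v \<and> W u v = W x y}"
    by (rule bd_eq[OF W_C]) simp
  also have "\<dots> = {{p i, p (Suc i mod period)} | i. i < period}"
  proof (intro equalityI subsetI)
    fix e assume "e \<in> {{P u v, P v u} | u v. noncomm u v \<and> W u v = W x y}"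
    then obtain u v where uv: "e = {P u v, P v u}" "noncomm u v" "W u v = W x y" by blast
    obtain i where i: "i < period" "u = su i" "v = su (Suc i)" using W[OF uv(2)] uv(3) by blast
    have "e = {p i, p (Suc i mod period)}" unfolding p_mod uv(1) i p_Suc by (simp add: p_def)
    then show "e \<in> {{p i, p (Suc i mod period)} | i. i < period}" using i(1) by blast
  next
    fix e assume "e \<in> {{p i, p (Suc i mod period)} | i. i < period}"
    then obtain i where i: "i < period" "e = {p i, p (Suc i mod period)}" by blast
    have "e = {P (su i) (su (Suc i)), P (su (Suc i)) (su i)}" unfolding i(2) p_mod p_Suc by (simp add: p_def)
    moreover have "W (su i) (su (Suc i)) = W x y" using W[OF su_noncomm] i(1) by blast
    ultimately show "e \<in> {{P u v, P v u} | u v. noncomm u v \<and> W u v = W x y}" using su_noncomm by blast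
  qed
  finally have bd: "bd (W x y) = {{p i, p (Suc i mod period)} | i. i < period}" .
  have "inj_on p {..<period}"
  proof (rule inj_onI)
    fix i j assume ij: "i \<in> {..<period}" "j \<in> {..<period}" "p i = p j"
    have "su i = su j" using ij(3) unfolding p_def by (metis fst_P prod.inject)
    then show "i = j" using period(3) ij by (meson inj_onD)
  qed
  then show ?thesis unfolding ngon_boundary_def bd by blast
qed

lemma ngon_bd:
  assumes w: "w \<in> C" "vtype w = 2"
  shows "ngon_boundary period (bd w)"
proof -
  obtain h where h: "h \<in> H" "w = act h (W x y)" using type2_rep[OF w] by blast
  have "bd w = image (act h) ` bd (W x y)" using act_bd[OF h(1) W_C] h(2) by simp
  moreover have "\<Union>(bd (W x y)) \<subseteq> verts Y" using bd_C[OF W_C vtype_W] C_verts by blast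
  then have "inj_on (act h) (\<Union>(bd (W x y)))" by (rule inj_on_subset[OF act_inj[OF H_in[OF h(1)]]])
  ultimately show ?thesis using ngon_image[OF ngon_W] by simp
qed

lemma ngon_faces: "Fc \<in> cell_faces T \<Longrightarrow> ngon_boundary period (face_boundary T Fc)"
  using ngon_bd unfolding cell_faces_T by blast

text \<open>Equal sides at different indices would make each index the successor of the other modulo
  \<open>n\<close>, which is impossible for \<open>n \<ge> 3\<close>.\<close>

lemma card_ngon:
  assumes "ngon_boundary n B" "n \<ge> 3"
  shows "card B = n"
proof -
  obtain p where p: "inj_on p {..<n}" "B = {{p i, p (Suc i mod n)} | i. i < n}"
    using assms(1) unfolding ngon_boundary_def by blast
  have "inj_on (\<lambda>i. {p i, p (Suc i mod n)}) {..<n}"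
  proof (rule inj_onI)
    fix i j assume ij: "i \<in> {..<n}" "j \<in> {..<n}" "{p i, p (Suc i mod n)} = {p j, p (Suc j mod n)}"
    have m: "Suc i mod n \<in> {..<n}" "Suc j mod n \<in> {..<n}" using assms(2) by auto
    show "i = j"
    proof (rule ccontr)
      assume "i \<noteq> j"
      then have "p i \<noteq> p j" using p(1) ij by (meson inj_onD)
      then have "p i = p (Suc j mod n)" "p (Suc i mod n) = p j" using ij(3) by (auto simp: doubleton_eq_iff)
      then have a: "i = Suc j mod n" and b: "j = Suc i mod n" using p(1) ij m by (metis inj_onD)+
      have wrap: "k = 0 \<and> Suc l = n \<or> k = Suc l" if "k = Suc l mod n" "l < n" for k l
      proof (cases "Suc l = n")
        case True
        then show ?thesis using that(1) by simp
      next
        case False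
        then show ?thesis using that by simp
      qed
      have "i = 0 \<and> Suc j = n \<or> i = Suc j" using wrap[OF a] ij(2) by simp
      moreover have "j = 0 \<and> Suc i = n \<or> j = Suc i" using wrap[OF b] ij(1) by simp
      ultimately show False using assms(2) by linarith
    qed
  qed
  moreover have "B = (\<lambda>i. {p i, p (Suc i mod n)}) ` {..<n}" unfolding p(2) by blast
  ultimately show ?thesis by (simp add: card_image)
qed

subsection \<open>Counting cells\<close>

abbreviation C2 :: "'a yvertex set" where "C2 \<equiv> {w \<in> C. vtype w = 2}"

text \<open>A triangle has one type 2 vertex only, so a sheet determines its centre.\<close>

lemma card_faces: "card (cell_faces T) = card C2"
proof -
  have "inj_on (sheet T) C2"
  proof (rule inj_onI)
    fix w w' assume w: "w \<in> C2" "w' \<in> C2" "sheet T w = sheet T w'"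
    obtain u v where uv: "noncomm u v" "w = W u v" "P u v \<in> C" using w(1) type2_cases by blast
    have "(P u v, P v u, W u v) \<in> sheet T w"
      unfolding sheet_def using tris_T uv by (auto simp: tri_set_def)
    then have "(P u v, P v u, W u v) \<in> sheet T w'" using w(3) by simp
    then have "w' \<in> tri_set (P u v, P v u, W u v)" unfolding sheet_def by blast
    then show "w = w'" using w(2) uv(2) by (auto simp: tri_set_def)
  qed
  then show ?thesis unfolding cell_faces_T by (rule card_image)
qed

lemma card_verts_T: "card (verts T) = card (cell_verts T) + card (cell_faces T)"
proof -
  have "verts T = cell_verts T \<union> C2"
    unfolding verts_T cell_verts_T by (auto elim: T_vertex_cases)
  moreover have "cell_verts T \<inter> C2 = {}" by (auto simp: cell_verts_T)
  ultimately show ?thesis using finite_C unfolding card_faces by (simp add: card_Un_disjoint cell_verts_T)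
qed

lemma pair_eq:
  assumes "noncomm u v" "{P u v, P v u} = {P u' v', P v' u'}"
  shows "u' = u \<and> v' = v \<or> u' = v \<and> v' = u"
  using assms(2) by (auto simp: doubleton_eq_iff dest!: arg_cong[where f = fst])

lemma P_W_distinct:
  assumes "noncomm u v"
  shows "P u v \<noteq> P v u" "W u v \<noteq> W v u"
  using assms by (auto simp: noncomm_def dest!: arg_cong[where f = fst])

text \<open>Each triangle contains one cell edge, and the two triangles at that edge are those of
  \<open>(u, v)\<close> and \<open>(v, u)\<close>.\<close>

lemma card_tris_T: "card (tris T) = 2 * card (cell_edges T)"
proof (rule card_fibres[where f = "\<lambda>(A, B, D). {A, B}"])
  show "(case t of (A, B, D) \<Rightarrow> {A, B}) \<in> cell_edges T" if "t \<in> tris T" for t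
    using that tris_T cell_edges_T by auto
  fix e assume "e \<in> cell_edges T"
  then obtain u v where uv: "noncomm u v" "P u v \<in> C" "e = {P u v, P v u}" using cell_edges_T by auto
  have "{t \<in> tris T. (case t of (A, B, D) \<Rightarrow> {A, B}) = e} = {(P u v, P v u, W u v), (P v u, P u v, W v u)}"
  proof (intro equalityI subsetI)
    fix t assume t: "t \<in> {t \<in> tris T. (case t of (A, B, D) \<Rightarrow> {A, B}) = e}"
    then obtain a b where ab: "noncomm a b" "t = (P a b, P b a, W a b)" using tris_T by auto
    then have "{P u v, P v u} = {P a b, P b a}" using t uv(3) by simp
    then show "t \<in> {(P u v, P v u, W u v), (P v u, P u v, W v u)}" using pair_eq[OF uv(1)] ab(2) by blast
  next
    fix t assume "t \<in> {(P u v, P v u, W u v), (P v u, P u v, W v u)}"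
    then show "t \<in> {t \<in> tris T. (case t of (A, B, D) \<Rightarrow> {A, B}) = e}"
      using tris_T uv noncomm_sym[OF uv(1)] tri_C(2)[OF uv(1)] by (auto simp: insert_commute)
  qed
  then show "card {t \<in> tris T. (case t of (A, B, D) \<Rightarrow> {A, B}) = e} = 2"
    using P_W_distinct[OF uv(1)] by simp
qed (rule T.finite_tris finite_cell_edges)+

lemma card_edges_T: "card (edges T) = 3 * card (cell_edges T)"
  using T.three_tris_two_edges card_tris_T by simp

text \<open>Double counting of faces and their sides. An edge borders two faces, with centres
  \<open>W u v\<close> and \<open>W v u\<close>; these differ because
  \<open>u \<otimes> v \<noteq> v \<otimes> u\<close>.\<close>

lemma faces_edges: "period * card (cell_faces T) = 2 * card (cell_edges T)"
proof -
  have "(\<Sum>w\<in>C2. card (bd w)) = (\<Sum>w\<in>C2. \<Sum>e\<in>cell_edges T. if e \<in> bd w then 1 else 0)"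
  proof (rule sum.cong[OF refl])
    fix w assume w: "w \<in> C2"
    have "bd w = {e \<in> cell_edges T. e \<in> bd w}" using bd_C w by blast
    then show "card (bd w) = (\<Sum>e\<in>cell_edges T. if e \<in> bd w then 1 else 0)"
      using finite_cell_edges by (simp add: sum.If_cases Int_def)
  qed
  also have "\<dots> = (\<Sum>e\<in>cell_edges T. \<Sum>w\<in>C2. if e \<in> bd w then 1 else 0)" by (rule sum.swap)
  also have "\<dots> = (\<Sum>e\<in>cell_edges T. 2)"
  proof (rule sum.cong[OF refl])
    fix e assume "e \<in> cell_edges T"
    then obtain u v where uv: "noncomm u v" "P u v \<in> C" "e = {P u v, P v u}" using cell_edges_T by auto
    have "{w \<in> C2. e \<in> bd w} = {W u v, W v u}"
    proof (intro equalityI subsetI)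
      fix w assume w: "w \<in> {w \<in> C2. e \<in> bd w}"
      then have "e \<in> {{P a b, P b a} | a b. noncomm a b \<and> W a b = w}" using bd_eq[of w] by simp
      then obtain a b where ab: "{P u v, P v u} = {P a b, P b a}" "W a b = w" using uv(3) by blast
      then show "w \<in> {W u v, W v u}" using pair_eq[OF uv(1) ab(1)] by blast
    next
      fix w assume "w \<in> {W u v, W v u}"
      then have w: "w \<in> C" "vtype w = 2" "w = W u v \<or> w = W v u"
        using tri_C[OF uv(1)] tri_C[OF noncomm_sym[OF uv(1)]] uv(2) by auto
      have "{P v u, P u v} = e" using uv(3) by (simp add: insert_commute)
      then have "e \<in> {{P a b, P b a} | a b. noncomm a b \<and> W a b = w}"
        using uv(1,3) noncomm_sym[OF uv(1)] w(3) by blast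
      then show "w \<in> {w \<in> C2. e \<in> bd w}" using bd_eq[OF w(1,2)] w(1,2) by simp
    qed
    then have "card {w \<in> C2. e \<in> bd w} = 2" using P_W_distinct(2)[OF uv(1)] by simp
    then show "(\<Sum>w\<in>C2. if e \<in> bd w then 1 else 0) = (2 :: nat)"
      using finite_C by (simp add: sum.If_cases Int_def)
  qed
  finally have "(\<Sum>w\<in>C2. card (bd w)) = 2 * card (cell_edges T)" by simp
  moreover have "(\<Sum>w\<in>C2. card (bd w)) = (\<Sum>w\<in>C2. period)"
    using card_ngon[OF ngon_bd period(1)] by (intro sum.cong) auto
  ultimately show ?thesis unfolding card_faces by (simp add: mult.commute)
qed

subsection \<open>Vertex transitivity\<close>

text \<open>A power \<open>h\<close> of \<open>x \<otimes> y\<close> that conjugates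
  \<open>x\<close> to \<open>y\<close> fixes the centre \<open>W x y\<close>, hence lies in
  \<open>H\<close>. It rotates the face so that \<open>P x y\<close> goes to \<open>P y x\<close>,
  which merges the two vertex orbits.\<close>

lemma vertex_transitive:
  assumes "y \<in> cls (x \<otimes> y) x"
  shows "vertex_transitive T"
proof -
  have xyc: "x \<otimes> y \<in> carrier G" by simp
  obtain i where i: "y = (cj (x \<otimes> y) ^^ i) x" using assms unfolding cls_def by blast
  define h where "h = (x \<otimes> y) [^] i"
  have h: "h \<in> carrier G" unfolding h_def by simp
  have hx: "cj h x = y" unfolding h_def using cj_funpow[OF xyc x_in] i by simp
  have "(cj (x \<otimes> y) ^^ j) (x \<otimes> y) = x \<otimes> y" for j
    by (induction j) simp_all
  then have hxy: "cj h (x \<otimes> y) = x \<otimes> y" unfolding h_def using cj_funpow[OF xyc xyc] by metis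
  have n: "noncomm y (cj h y)" using noncomm_cj[OF h xy] hx by simp
  have e: "y \<otimes> cj h y = x \<otimes> y" using hxy cj_mult[OF h x_in y_in] hx by simp
  have "act h (W x y) = W y (cj h y)" using act_W[OF h xy] hx by simp
  also have "\<dots> = sheet_vertex X (x \<otimes> y, 2) (y, 1)" unfolding W_def e ..
  also have "\<dots> = W x y" by (rule sheet_vertex_12(3)[OF xy])
  finally have hH: "h \<in> H" using H_I[OF h W_C] W_C by simp
  have "act h (P x y) = P y (cj h y)" using act_P[OF h xy] hx by simp
  also have "\<dots> = sheet_vertex X (y, 1) (x \<otimes> y, 2)" using sheet_vertex_12(2)[OF n] unfolding e by simp
  also have "\<dots> = P y x" by (rule sheet_vertex_12(1)[OF xy])
  finally have hP: "act h (P x y) = P y x" .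
  have rep: "\<exists>k \<in> H. A = act k (P x y)" if A: "A \<in> cell_verts T" for A
  proof -
    obtain k where k: "k \<in> H" "A = act k (P x y) \<or> A = act k (P y x)" using cell_verts_rep[OF A] by blast
    show ?thesis
    proof (cases "A = act k (P x y)")
      case False
      then have "A = act (k \<otimes> h) (P x y)"
        using k(2) hP act_act[OF H_in[OF k(1)] h P_verts] by simp
      then show ?thesis using H_mult[OF k(1) hH] by blast
    qed (use k(1) in blast)
  qed
  show ?thesis
    unfolding vertex_transitive_def
  proof (intro ballI equalityI)
    fix A assume A: "A \<in> cell_verts T"
    show "vertex_orbit T A \<subseteq> cell_verts T" by (rule vertex_orbit_subset[OF A])
    show "cell_verts T \<subseteq> vertex_orbit T A"
    proof
      fix B assume "B \<in> cell_verts T"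
      then obtain k where k: "k \<in> H" "B = act k (P x y)" using rep by blast
      obtain l where l: "l \<in> H" "A = act l (P x y)" using rep[OF A] by blast
      let ?g = "k \<otimes> inv l"
      have AV: "A \<in> verts Y" using A C_verts by (auto simp: cell_verts_T)
      have "act ?g A = B"
        using act_act[OF H_in[OF k(1)] H_in[OF H_inv[OF l(1)]] AV] act_inv[OF H_in[OF l(1)] P_verts] l(2) k(2)
        by simp
      then show "B \<in> vertex_orbit T A"
        using act_vertex_orbit[OF H_mult[OF k(1) H_inv[OF l(1)]] A] by simp
    qed
  qed
qed

end

section \<open>The numerical statements for the component\<close>

context noncommuting_pair
begin

lemma component_iff:
  "T' \<in> components2 Y \<and> (P x y, P y x, W x y) \<in> tris T' \<longleftrightarrow> T' = T"
proof
  assume *: "T' \<in> components2 Y \<and> (P x y, P y x, W x y) \<in> tris T'"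
  then obtain u where u: "T' = full_subcomplex Y (conn_class Y u)" unfolding components2_def by blast
  have "P x y \<in> conn_class Y u" using * by (simp add: u full_subcomplex_def tri_set_def)
  then have "C = conn_class Y u" unfolding C_def by (rule Y.conn_class_eq)
  then show "T' = T" using u T_def by simp
next
  assume "T' = T"
  moreover have "T \<in> components2 Y" unfolding components2_def T_def C_def using P_verts by blast
  ultimately show "T' \<in> components2 Y \<and> (P x y, P y x, W x y) \<in> tris T'" using tris_T xy P_C by blast
qed

text \<open>This turns the case distinction of the theorem into the parity of the number of
  sides.\<close>

lemma classes_iff: "cls (x \<otimes> y) x = cls (x \<otimes> y) y \<longleftrightarrow> odd period"
proof
  assume eq: "cls (x \<otimes> y) x = cls (x \<otimes> y) y"
  have "y \<in> cls (x \<otimes> y) y" unfolding cls_def by (rule range_eqI[of _ _ 0]) simp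
  then show "odd period" using even_period(1) eq by blast
next
  assume "odd period"
  then show "cls (x \<otimes> y) x = cls (x \<otimes> y) y"
    using odd_period(1)[of 0] odd_period(1)[of "Suc 0"] by (simp add: su_0 su_1)
qed

lemma valency_xy: "valency T (P x y) = card (cls x (x \<otimes> y))" "valency T (P y x) = card (cls y (x \<otimes> y))"
  using valency_P[OF xy P_C] valency_P[OF noncomm_sym[OF xy] Q_C]
    card_cls_mult(1)[OF xy] card_cls_mult(2)[OF noncomm_sym[OF xy]] by simp_all

lemma valency_ge_2: "A \<in> cell_verts T \<Longrightarrow> valency T A \<ge> 2"
  using valency_values[of A] valency_P[OF xy P_C] valency_P[OF noncomm_sym[OF xy] Q_C]
    card_cls_ge_2[OF xy] card_cls_ge_2[OF noncomm_sym[OF xy]] by auto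

lemma average_valency_eq: "average_valency T = 2 * real (card (cell_edges T)) / real (card (cell_verts T))"
  unfolding average_valency_def using handshake by (metis of_nat_mult of_nat_numeral of_nat_sum)

lemma cells_pos: "card (cell_verts T) > 0" "card (cell_edges T) > 0" "card (cell_faces T) > 0"
proof -
  show "card (cell_verts T) > 0" using P_cell finite_cell_verts by (auto simp: card_gt_0_iff)
  show e: "card (cell_edges T) > 0"
    using cell_edgesI[OF xy P_C] finite_cell_edges by (auto simp: card_gt_0_iff)
  then show "card (cell_faces T) > 0" using faces_edges by (auto intro: gr0I)
qed

lemma average_valency_ge_2: "average_valency T \<ge> 2"
proof -
  have "(\<Sum>v\<in>cell_verts T. 2) \<le> (\<Sum>v\<in>cell_verts T. valency T v)"
    by (rule sum_mono) (rule valency_ge_2)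
  then have "2 * card (cell_verts T) \<le> 2 * card (cell_edges T)" unfolding handshake by simp
  then have "2 * real (card (cell_verts T)) \<le> 2 * real (card (cell_edges T))" by linarith
  then show ?thesis unfolding average_valency_eq using cells_pos(1) by (simp add: le_divide_eq)
qed

text \<open>Every edge is a translate of that of \<open>(x, y)\<close>, so it has exactly one end of
  valency \<open>l\<close> when the two valencies differ. Summing valencies over these ends counts
  each edge once.\<close>

lemma edges_by_endpoint:
  assumes ne: "valency T (P x y) \<noteq> valency T (P y x)"
    and l: "l = valency T (P x y) \<or> l = valency T (P y x)"
  shows "card (cell_edges T) = l * card {v \<in> cell_verts T. valency T v = l}"
proof -
  let ?S = "{v \<in> cell_verts T. valency T v = l}"
  have "card (e \<inter> ?S) = 1" if e: "e \<in> cell_edges T" for e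
  proof -
    obtain A B where AB: "e = {A, B}" "valency T A = valency T (P x y)" "valency T B = valency T (P y x)"
      using valency_edge[OF e] by blast
    have V: "A \<in> cell_verts T" "B \<in> cell_verts T" using cell_edge_card[OF e] AB(1) by auto
    have "e \<inter> ?S = {A} \<or> e \<inter> ?S = {B}" using AB V ne l by auto
    then show ?thesis by auto
  qed
  then have "(\<Sum>e\<in>cell_edges T. card (e \<inter> ?S)) = card (cell_edges T)" by simp
  moreover have "(\<Sum>v\<in>?S. valency T v) = (\<Sum>e\<in>cell_edges T. card (e \<inter> ?S))"
    by (rule sum_valency) blast
  moreover have "(\<Sum>v\<in>?S. valency T v) = (\<Sum>v\<in>?S. l)" by (rule sum.cong) auto
  ultimately show ?thesis by (simp add: mult.commute)
qed

lemma verts_by_valency: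
  assumes "valency T (P x y) \<noteq> valency T (P y x)"
  shows "card (cell_verts T) = card {v \<in> cell_verts T. valency T v = valency T (P x y)} +
    card {v \<in> cell_verts T. valency T v = valency T (P y x)}"
proof -
  have "cell_verts T = {v \<in> cell_verts T. valency T v = valency T (P x y)} \<union>
    {v \<in> cell_verts T. valency T v = valency T (P y x)}"
    using valency_values by blast
  moreover have "{v \<in> cell_verts T. valency T v = valency T (P x y)} \<inter>
    {v \<in> cell_verts T. valency T v = valency T (P y x)} = {}" using assms by auto
  ultimately show ?thesis using finite_cell_verts by (metis (no_types, lifting) card_Un_disjoint finite_Un)
qed

text \<open>With V and E the numbers of cell vertices and edges, the left side is V/E. For different
  valencies it splits into V1/E + V2/E, and each summand is the reciprocal of a valency; for equal
  ones the handshake formula suffices.\<close>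

lemma harmonic_average:
  "2 / average_valency T = 1 / real (valency T (P x y)) + 1 / real (valency T (P y x))"
proof -
  let ?l1 = "valency T (P x y)" and ?l2 = "valency T (P y x)"
  let ?E = "card (cell_edges T)" and ?V = "card (cell_verts T)"
  have l: "?l1 > 0" "?l2 > 0" using valency_ge_2[OF P_cell] valency_ge_2[OF Q_cell] by auto
  have avg: "2 / average_valency T = real ?V / real ?E"
    unfolding average_valency_eq using cells_pos by simp
  show ?thesis
  proof (cases "?l1 = ?l2")
    case True
    have "(\<Sum>v\<in>cell_verts T. valency T v) = (\<Sum>v\<in>cell_verts T. ?l1)"
      using valency_values True by (intro sum.cong) auto
    then have "?V * ?l1 = 2 * ?E" unfolding handshake by simp
    then have "real ?V * real ?l1 = 2 * real ?E" by (metis of_nat_mult of_nat_numeral)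
    then show ?thesis unfolding avg using True l cells_pos(2) by (simp add: field_simps)
  next
    case False
    define V1 where "V1 = card {v \<in> cell_verts T. valency T v = ?l1}"
    define V2 where "V2 = card {v \<in> cell_verts T. valency T v = ?l2}"
    have E: "?E = ?l1 * V1" "?E = ?l2 * V2" and V: "?V = V1 + V2"
      unfolding V1_def V2_def using edges_by_endpoint[OF False] verts_by_valency[OF False] by blast+
    have "real V1 / real ?E = 1 / real ?l1"
      using cells_pos(2) l unfolding E(1) by (simp add: field_simps)
    moreover have "real V2 / real ?E = 1 / real ?l2"
      using cells_pos(2) l unfolding E(2) by (simp add: field_simps)
    ultimately show ?thesis unfolding avg V by (simp add: add_divide_distrib)
  qed
qed

lemma average_valency_weighted:
  assumes ne: "valency T (P x y) \<noteq> valency T (P y x)"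
  defines "l1 \<equiv> valency T (P x y)" and "l2 \<equiv> valency T (P y x)"
  defines "V1 \<equiv> card {v \<in> cell_verts T. valency T v = l1}"
    and "V2 \<equiv> card {v \<in> cell_verts T. valency T v = l2}"
  shows "average_valency T = real (l1 * V1 + l2 * V2) / real (V1 + V2)"
proof -
  have "card (cell_edges T) = l1 * V1" "card (cell_edges T) = l2 * V2" "card (cell_verts T) = V1 + V2"
    unfolding l1_def l2_def V1_def V2_def using edges_by_endpoint[OF ne] verts_by_valency[OF ne] by blast+
  then show ?thesis unfolding average_valency_eq by simp
qed

text \<open>In terms of the cells, the triangulation has V + F vertices, 3E edges and 2E triangles,
  and V + F - 3E + 2E = V - E + F.\<close>

lemma genus_T:
  obtains g where "has_genus T g"
    "2 - 2 * int g = int (card (cell_verts T)) - int (card (cell_edges T)) + int (card (cell_faces T))"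
proof -
  obtain g where g: "has_genus T g"
    "2 - 2 * int g = int (card (verts T)) - int (card (edges T)) + int (card (tris T))"
    using T.genus_euler by blast
  have "2 - 2 * int g = int (card (cell_verts T)) - int (card (cell_edges T)) + int (card (cell_faces T))"
    using g(2) unfolding card_verts_T card_edges_T card_tris_T by simp
  then show ?thesis using that g(1) by blast
qed

lemma euler_average:
  assumes "2 - 2 * int g = int (card (cell_verts T)) - int (card (cell_edges T)) + int (card (cell_faces T))"
  shows "real_of_int (2 - 2 * int g) =
    2 * (1 / average_valency T + 1 / real period - 1 / 2) * real (card (cell_edges T))"
proof -
  let ?E = "real (card (cell_edges T))"
  have n: "real period > 0" using period(1) by simp
  have "real period * real (card (cell_faces T)) = 2 * ?E"
    using faces_edges by (metis of_nat_mult of_nat_numeral)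
  then have F: "real (card (cell_faces T)) = 2 * (1 / real period) * ?E" using n by (simp add: field_simps)
  have V: "real (card (cell_verts T)) = 2 * (1 / average_valency T) * ?E"
    unfolding average_valency_eq using cells_pos(1,2) by (simp add: field_simps)
  have "real_of_int (2 - 2 * int g) = real (card (cell_verts T)) - ?E + real (card (cell_faces T))"
    unfolding assms by simp
  then show ?thesis unfolding F V by (simp add: algebra_simps)
qed

text \<open>The automorphism that moves \<open>P x y\<close> to \<open>A\<close> is arbitrary, not
  one given by \<open>H\<close>. It still maps the edges at a vertex bijectively onto those at the
  image.\<close>

lemma valency_constant:
  assumes "odd period" "A \<in> cell_verts T"
  shows "valency T A = valency T (P x y)"
proof -
  have "y \<in> cls (x \<otimes> y) y" unfolding cls_def by (rule range_eqI[of _ _ 0]) simp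
  then have vt: "vertex_transitive T" using vertex_transitive classes_iff assms(1) by simp
  then have "A \<in> vertex_orbit T (P x y)" using assms(2) P_cell unfolding vertex_transitive_def by blast
  then obtain f where f: "f \<in> carrier (cell_aut_group T)" "A = f (P x y)"
    unfolding vertex_orbit_def orbit_cell_aut by blast
  have inj: "inj_on f (cell_verts T)" using f(1) by (simp add: cell_aut_group_def Bij_def bij_betw_def)
  have "{e \<in> cell_edges T. A \<in> e} = image f ` {e \<in> cell_edges T. P x y \<in> e}"
  proof (intro equalityI subsetI)
    fix e assume e: "e \<in> {e \<in> cell_edges T. A \<in> e}"
    then obtain e' where e': "e' \<in> cell_edges T" "e = f ` e'" using autD(2)[OF f(1)] by blast
    have "f (P x y) \<in> f ` e'" using e e' f(2) by simp
    then have "P x y \<in> e'" using inj_on_image_mem_iff[OF inj P_cell] cell_edge_card[OF e'(1)] by blast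
    then show "e \<in> image f ` {e \<in> cell_edges T. P x y \<in> e}" using e' by blast
  next
    fix e assume "e \<in> image f ` {e \<in> cell_edges T. P x y \<in> e}"
    then show "e \<in> {e \<in> cell_edges T. A \<in> e}" using autD(2)[OF f(1)] f(2) by blast
  qed
  moreover have "inj_on (image f) {e \<in> cell_edges T. P x y \<in> e}"
    by (rule inj_on_subset[OF inj_on_image_Pow[OF inj]]) (use cell_edge_card in blast)
  ultimately show ?thesis unfolding valency_def by (simp add: card_image)
qed

end

theorem theorem2p32:
  fixes G :: "('a, 'b) monoid_scheme" and x y \<alpha> :: 'a
    and tri :: "'a yvertex \<times> 'a yvertex \<times> 'a yvertex"
    and T :: "'a yvertex complex2"
    and p q :: "'a yvertex"
    and V E F l1 l2 :: nat and lam :: real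
  assumes "group G" and "finite (carrier G)" and "\<not> comm_group G"
    and "x \<in> carrier G" and "y \<in> carrier G" and "x \<otimes>\<^bsub>G\<^esub> y \<noteq> y \<otimes>\<^bsub>G\<^esub> x"
    and "\<alpha> = x \<otimes>\<^bsub>G\<^esub> y"
    and "tri = lift_tri (X_complex G) ((x, 1), (y, 1), (\<alpha>, 2))"
    and "p = fst tri" and "q = fst (snd tri)"
    and "T = (THE T'. T' \<in> components2 (Y_complex G) \<and> tri \<in> tris T')"
    and "V = card (cell_verts T)" and "E = card (cell_edges T)" and "F = card (cell_faces T)"
    and "l1 = valency T p" and "l2 = valency T q" and "lam = average_valency T"
  shows
    "(\<exists>!T'. T' \<in> components2 (Y_complex G) \<and> tri \<in> tris T') \<and>
     compact_connected_oriented_surface T \<and>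
     face_transitive T \<and> edge_transitive T \<and>
     (\<exists>g n. has_genus T g \<and>
        n \<ge> 3 \<and> (\<forall>P \<in> cell_faces T. ngon_boundary n (face_boundary T P)) \<and>
        (cyclic_conj_class G \<alpha> x \<noteq> cyclic_conj_class G \<alpha> y \<longrightarrow>
           even n \<and> n = 2 * card (cyclic_conj_class G \<alpha> x) \<and>
           cell_verts T = vertex_orbit T p \<union> vertex_orbit T q \<and>
           l1 = card (cyclic_conj_class G x \<alpha>) \<and> l1 \<ge> 2 \<and>
           l2 = card (cyclic_conj_class G y \<alpha>) \<and> l2 \<ge> 2 \<and>
           (l1 \<noteq> l2 \<longrightarrow>
              (let V1 = card {v \<in> cell_verts T. valency T v = l1};
                   V2 = card {v \<in> cell_verts T. valency T v = l2}
               in lam = real (l1 * V1 + l2 * V2) / real (V1 + V2) \<and> lam \<ge> 2 \<and>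
                  (\<forall>e \<in> cell_edges T. \<exists>u v. e = {u, v} \<and> valency T u = l1 \<and> valency T v = l2) \<and>
                  E = l1 * V1 \<and> E = l2 * V2)) \<and>
           lam = 2 * real E / real V \<and>
           2 / lam = 1 / real l1 + 1 / real l2) \<and>
        (cyclic_conj_class G \<alpha> x = cyclic_conj_class G \<alpha> y \<longrightarrow>
           odd n \<and> n = card (cyclic_conj_class G \<alpha> x) \<and>
           edge_transitive T \<and> vertex_transitive T \<and>
           (\<forall>v \<in> cell_verts T. valency T v = card (cyclic_conj_class G x \<alpha>)) \<and>
           lam = real (card (cyclic_conj_class G x \<alpha>)) \<and> lam \<ge> 2) \<and>
        n * F = 2 * E \<and>
        real (n * F) = lam * real V \<and>
        2 - 2 * int g = int V - int E + int F \<and>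
        real_of_int (2 - 2 * int g) = 2 * (1 / lam + 1 / real n - 1 / 2) * real E)"
proof -
  interpret grp: group G by (rule assms(1))
  interpret fg: finite_group G by unfold_locales (rule assms(2))
  interpret N: noncommuting_pair G x y
    by unfold_locales (use assms(4-6) in \<open>simp add: fg.noncomm_def\<close>)
  have \<alpha>: "\<alpha> \<in> carrier G" using assms(4,5,7) by simp
  have tri: "tri = (fg.P x y, fg.P y x, fg.W x y)" using assms(7,8) fg.lift_X[OF N.xy] by simp
  have comp: "T' \<in> components2 (Y_complex G) \<and> tri \<in> tris T' \<longleftrightarrow> T' = N.T" for T'
    unfolding tri by (rule N.component_iff)
  then have ex1: "\<exists>!T'. T' \<in> components2 (Y_complex G) \<and> tri \<in> tris T'" by simp
  have T: "T = N.T" unfolding assms(11) comp by simp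
  have p: "p = fg.P x y" and q: "q = fg.P y x" using assms(9,10) tri by simp_all
  have classes: "cyclic_conj_class G \<alpha> x = fg.cls (x \<otimes>\<^bsub>G\<^esub> y) x" "cyclic_conj_class G \<alpha> y = fg.cls (x \<otimes>\<^bsub>G\<^esub> y) y"
    "cyclic_conj_class G x \<alpha> = fg.cls x (x \<otimes>\<^bsub>G\<^esub> y)" "cyclic_conj_class G y \<alpha> = fg.cls y (x \<otimes>\<^bsub>G\<^esub> y)"
    using fg.cyclic_conj_class_eq \<alpha> assms(4,5,7) by simp_all
  have l: "l1 = card (cyclic_conj_class G x \<alpha>)" "l2 = card (cyclic_conj_class G y \<alpha>)"
    unfolding assms(15,16) T p q classes by (rule N.valency_xy)+
  have l2: "l1 \<ge> 2" "l2 \<ge> 2"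
    unfolding assms(15,16) T p q using N.valency_ge_2 N.P_cell N.Q_cell by blast+
  have lam: "lam = 2 * real E / real V" unfolding assms(12,13,17) T by (rule N.average_valency_eq)
  have lam2: "lam \<ge> 2" unfolding assms(17) T by (rule N.average_valency_ge_2)
  have Vpos: "real V > 0" unfolding assms(12) T using N.cells_pos(1) by simp
  have nF: "N.period * F = 2 * E" unfolding assms(13,14) T by (rule N.faces_edges)
  then have "real (N.period * F) = 2 * real E" by simp
  then have nF': "real (N.period * F) = lam * real V" unfolding lam using Vpos by simp
  obtain g where g: "has_genus T g" "2 - 2 * int g = int V - int E + int F"
    using N.genus_T unfolding assms(12-14) T by blast
  have chi: "real_of_int (2 - 2 * int g) = 2 * (1 / lam + 1 / real N.period - 1 / 2) * real E"
    using N.euler_average g(2) unfolding assms(12-14,17) T by blast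
  have ft: "face_transitive T" and et: "edge_transitive T"
    unfolding T by (rule N.face_transitive, rule N.edge_transitive)
  have evenc: "even N.period \<and> N.period = 2 * card (cyclic_conj_class G \<alpha> x) \<and>
      cell_verts T = vertex_orbit T p \<union> vertex_orbit T q \<and>
      l1 = card (cyclic_conj_class G x \<alpha>) \<and> l1 \<ge> 2 \<and>
      l2 = card (cyclic_conj_class G y \<alpha>) \<and> l2 \<ge> 2 \<and>
      (l1 \<noteq> l2 \<longrightarrow>
         (let V1 = card {v \<in> cell_verts T. valency T v = l1};
              V2 = card {v \<in> cell_verts T. valency T v = l2}
          in lam = real (l1 * V1 + l2 * V2) / real (V1 + V2) \<and> lam \<ge> 2 \<and>
             (\<forall>e \<in> cell_edges T. \<exists>u v. e = {u, v} \<and> valency T u = l1 \<and> valency T v = l2) \<and>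
             E = l1 * V1 \<and> E = l2 * V2)) \<and>
      lam = 2 * real E / real V \<and>
      2 / lam = 1 / real l1 + 1 / real l2"
    if ne: "cyclic_conj_class G \<alpha> x \<noteq> cyclic_conj_class G \<alpha> y"
  proof (intro conjI impI l l2 lam)
    show ev: "even N.period" using ne N.classes_iff unfolding classes by blast
    show "N.period = 2 * card (cyclic_conj_class G \<alpha> x)" unfolding classes by (rule N.even_period(2)[OF ev])
    show "cell_verts T = vertex_orbit T p \<union> vertex_orbit T q" unfolding T p q by (rule N.vertex_orbits)
    show "2 / lam = 1 / real l1 + 1 / real l2"
      unfolding assms(15-17) T p q by (rule N.harmonic_average)
    assume "l1 \<noteq> l2"
    then have ne': "valency N.T (fg.P x y) \<noteq> valency N.T (fg.P y x)" unfolding assms(15,16) T p q .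
    show "let V1 = card {v \<in> cell_verts T. valency T v = l1};
              V2 = card {v \<in> cell_verts T. valency T v = l2}
          in lam = real (l1 * V1 + l2 * V2) / real (V1 + V2) \<and> lam \<ge> 2 \<and>
             (\<forall>e \<in> cell_edges T. \<exists>u v. e = {u, v} \<and> valency T u = l1 \<and> valency T v = l2) \<and>
             E = l1 * V1 \<and> E = l2 * V2"
      unfolding Let_def
    proof (intro conjI ballI)
      show "lam = real (l1 * card {v \<in> cell_verts T. valency T v = l1} +
          l2 * card {v \<in> cell_verts T. valency T v = l2}) /
        real (card {v \<in> cell_verts T. valency T v = l1} + card {v \<in> cell_verts T. valency T v = l2})"
        unfolding assms(15-17) T p q by (rule N.average_valency_weighted[OF ne'])
      show "lam \<ge> 2" by (rule lam2)
      show "\<exists>u v. e = {u, v} \<and> valency T u = l1 \<and> valency T v = l2" if "e \<in> cell_edges T" for e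
        using N.valency_edge that unfolding assms(15,16) T p q by blast
      show "E = l1 * card {v \<in> cell_verts T. valency T v = l1}"
        "E = l2 * card {v \<in> cell_verts T. valency T v = l2}"
        unfolding assms(13,15,16) T p q using N.edges_by_endpoint[OF ne'] by blast+
    qed
  qed
  have oddc: "odd N.period \<and> N.period = card (cyclic_conj_class G \<alpha> x) \<and> edge_transitive T \<and> vertex_transitive T \<and>
      (\<forall>v \<in> cell_verts T. valency T v = card (cyclic_conj_class G x \<alpha>)) \<and>
      lam = real (card (cyclic_conj_class G x \<alpha>)) \<and> lam \<ge> 2"
    if eq: "cyclic_conj_class G \<alpha> x = cyclic_conj_class G \<alpha> y"
  proof (intro conjI et lam2)
    show od: "odd N.period" using eq N.classes_iff unfolding classes by blast
    show "N.period = card (cyclic_conj_class G \<alpha> x)"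
      unfolding classes using N.odd_period(1)[OF od, of 0] N.odd_period(2)[OF od] by (simp add: N.su_0)
    have "y \<in> fg.cls (x \<otimes>\<^bsub>G\<^esub> y) y" unfolding fg.cls_def by (rule range_eqI[of _ _ 0]) simp
    then show "vertex_transitive T"
      unfolding T using N.vertex_transitive eq[unfolded classes] by blast
    show val: "\<forall>v \<in> cell_verts T. valency T v = card (cyclic_conj_class G x \<alpha>)"
      unfolding l(1)[symmetric] assms(15) T p using N.valency_constant[OF od] by blast
    \<comment> \<open>Both valencies equal \<open>l1\<close>, so the harmonic average is
      \<open>l1\<close>.\<close>
    have "2 / lam = 2 / real l1"
      using N.harmonic_average N.valency_constant[OF od N.Q_cell] unfolding assms(15,17) T p by simp
    then show "lam = real (card (cyclic_conj_class G x \<alpha>))"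
      using lam2 l2(1) unfolding l(1)[symmetric] by (simp add: field_simps)
  qed
  have surf: "compact_connected_oriented_surface T" unfolding T by (rule N.T.compact_connected_oriented_surface)
  have ng: "\<forall>P \<in> cell_faces T. ngon_boundary N.period (face_boundary T P)"
    unfolding T using N.ngon_faces by blast
  note facts = g(1) N.period(1) ng impI[OF evenc] impI[OF oddc] nF nF' g(2) chi
  show ?thesis
    by (rule conjI[OF ex1 conjI[OF surf conjI[OF ft conjI[OF et]]]], rule exI[of _ g], rule exI[of _ N.period])
      (rule conjI[OF facts(1) conjI[OF facts(2) conjI[OF facts(3) conjI[OF facts(4) conjI[OF facts(5)
        conjI[OF facts(6) conjI[OF facts(7) conjI[OF facts(8,9)]]]]]]]])
qed

end
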